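(* For any Coxeter group $W$ one has: (a) $\mathbf{H}(W)$ and $\underline{\mathbf{H}}(W)$ admit an anti-involution $\overline{\cdot}$ such that $\overline{s_i}=s_i$, $\overline{D_i}=D_i$ for $i\in I$. (b) $\mathbf{D}(W)$ and $\underline{\mathbf{D}}(W)$ admit the following symmetries: (i) A $W$-action by automorphisms via $s_i(D_s)=1-D_{s_i}$ if $s=s_i$ and $s_i(D_s)=D_{s_iss_i}$ if $s\ne s_i$, for $s\in\mathcal{S}$, $i\in I$. (ii) For $s\in\mathcal{S}$, an $s$-derivation $d_s$ (i.e., $d_s(xy)=d_s(x)y+s(x)d_s(y)$, where $s(x)$ refers to the action in (i)) such that $d_s(D_{s'})=\delta_{s,s'}$ for $s,s'\in\mathcal{S}$. (c) $\mathbf{H}(W)$ admits an involution $\theta$ (an involutive algebra automorphism) such that $\theta(s_i)=-s_i$, $\theta(D_i)=1-D_i$ for $i\in I$.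
   Context: A Coxeter group $W$ is generated by $s_i$, $i\in I$, subject to relations $(s_is_j)^{m_{ij}}=1$, where $m_{ij}=m_{ji}\in\mathbb{Z}_{\ge 0}$ are such that $m_{ij}=1$ iff $i=j$ ($m_{ij}=0$ imposes no relation). $\hat{\mathbf{H}}(W)$ is the (unital associative) $\mathbb{Z}$-algebra generated by $s_i,D_i$, $i\in I$, subject to relations: (i) $s_i^2=1$, $D_i^2=D_i$, $s_iD_i+D_is_i=s_i-1$ for $i\in I$; (ii) $(s_is_j)^{m_{ij}}=1$; (iii) $\underbrace{D_is_js_i\cdots s_{j'}}_{m_{ij}}=\underbrace{s_j\cdots s_{i'}s_{j'}D_{i'}}_{m_{ij}}$ for all distinct $i,j\in I$ with $m_{ij}\ne 0$, where $i'=i$ if $m_{ij}$ is even, $i'=j$ if $m_{ij}$ is odd, and $\{i',j'\}=\{i,j\}$ (each side has $m_{ij}$ factors with indices alternating between $i$ and $j$). It is a Hopf algebra over $\mathbb{Z}$ with $\Delta(s_i)=s_i\otimes s_i$, $\Delta(D_i)=D_i\otimes 1+s_i\otimes D_i$, $\varepsilon(s_i)=1$, $\varepsilon(D_i)=0$. $\mathcal{S}:=\{ws_iw^{-1}\mid w\in W,i\in I\}$. For each $s\in\mathcal{S}$ there is a unique $D_s\in\hat{\mathbf{H}}(W)$ such that $D_{s_i}=D_i$ for $i\in I$ and $D_{s_iss_i}=s_iD_ss_i$ for any $i\in I$, $s\in\mathcal{S}\setminus\{s_i\}$. $\hat{\mathbf{D}}(W)$ is the subalgebra of $\hat{\mathbf{H}}(W)$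 generated by all $D_s$, $s\in\mathcal{S}$, and $\mathbf{K}(W):=\bigcap_{w\in W}w\hat{\mathbf{D}}(W)w^{-1}$. $\underline{\mathbf{H}}(W)=\hat{\mathbf{H}}(W)/\mathbf{J}(W)$, where $\mathbf{J}(W)$ is the ideal generated by $\mathbf{K}(W)\cap\operatorname{Ker}\varepsilon$. For $J\subset I$, $W_J$ is the (Coxeter) subgroup generated by $s_j$, $j\in J$; $\hat{\mathbf{D}}(W_J)$ is identified with the subalgebra of $\hat{\mathbf{D}}(W)$ generated by all $D_s$ with $s\in\mathcal{S}\cap W_J$. $\hat{\mathbf{D}}(W)$ is filtered by $\deg D_s=1$ (degree at most $r$ means: lies in the $\mathbb{Z}$-span of products of at most $r$ of the $D_s$). For distinct $i,j\in I$, $\mathbf{K}_{ij}(W)$ is the set of all elements of $\mathbf{K}(W_{\{i,j\}})\cap\operatorname{Ker}\varepsilon$ having degree at most $m_{ij}$. $\mathbf{H}(W)=\hat{\mathbf{H}}(W)/\underline{\mathbf{J}}(W)$, where $\underline{\mathbf{J}}(W)$ is the ideal generated by all $\mathbf{K}_{ij}(W)$, $i\ne j$. $\underline{\mathbf{D}}(W)$ and $\mathbf{D}(W)$ are the images of $\hat{\mathbf{D}}(W)$ in $\underline{\mathbf{H}}(W)$ and $\mathbf{H}(W)$. Images of $s_i,D_i,D_s$ in quotients are denoted by the same symbols. An anti-involution is an involutive algebra anti-automorphism. *)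

theory Defs
  imports "HOL-Algebra.Algebra" "HOL-Library.Poly_Mapping"
begin

section \<open>Free algebras over the integers\<close>

text \<open>Words form an additively written monoid (concatenation), so that the convolution
  product of finitely supported functions (\<^theory>\<open>HOL-Library.Poly_Mapping\<close>) is the
  product of the free associative algebra.\<close>

datatype 'g fword = Word (letters: "'g list")

instantiation fword :: (type) monoid_add
begin

definition zero_fword :: "'a fword" where
  "zero_fword = Word []"

definition plus_fword :: "'a fword \<Rightarrow> 'a fword \<Rightarrow> 'a fword" where
  "plus_fword u v = Word (letters u @ letters v)"

instance
  by standard (simp_all add: zero_fword_def plus_fword_def)

end

type_synonym 'g falg = "'g fword \<Rightarrow>\<^sub>0 int"

definition free_algebra :: "'g set \<Rightarrow> 'g falg ring" where
  "free_algebra G =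
    \<lparr>carrier = {p. \<forall>w \<in> Poly_Mapping.keys p. set (letters w) \<subseteq> G},
     monoid.mult = (*), one = 1, ring.zero = 0, ring.add = (+)\<rparr>"

definition mon :: "'g list \<Rightarrow> 'g falg" where
  "mon xs = Poly_Mapping.single (Word xs) 1"

section \<open>Coxeter groups\<close>

text \<open>The value 0 of \<open>m i j\<close> stands for ``no relation''.\<close>

definition coxeter_matrix :: "'i set \<Rightarrow> ('i \<Rightarrow> 'i \<Rightarrow> nat) \<Rightarrow> bool" where
  "coxeter_matrix I m \<longleftrightarrow>
    (\<forall>i\<in>I. \<forall>j\<in>I. m i j = m j i \<and> (m i j = 1 \<longleftrightarrow> i = j))"

text \<open>Since \<open>m i i = 1\<close> makes every generator its own inverse, the group given by the Coxeter
  presentation is the monoid with the same presentation: words in \<open>I\<close> modulo the congruence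
  generated by \<open>(i j)^(m i j) \<sim> []\<close>, which is void for \<open>m i j = 0\<close>.\<close>

inductive cox_eq :: "'i set \<Rightarrow> ('i \<Rightarrow> 'i \<Rightarrow> nat) \<Rightarrow> 'i list \<Rightarrow> 'i list \<Rightarrow> bool"
  for I m where
  refl: "u \<in> lists I \<Longrightarrow> cox_eq I m u u"
| sym: "cox_eq I m u v \<Longrightarrow> cox_eq I m v u"
| trans: "cox_eq I m u v \<Longrightarrow> cox_eq I m v w \<Longrightarrow> cox_eq I m u w"
| rel: "u \<in> lists I \<Longrightarrow> v \<in> lists I \<Longrightarrow> i \<in> I \<Longrightarrow> j \<in> I \<Longrightarrow>
    cox_eq I m (u @ concat (replicate (m i j) [i, j]) @ v) (u @ v)"

definition cox_class :: "'i set \<Rightarrow> ('i \<Rightarrow> 'i \<Rightarrow> nat) \<Rightarrow> 'i list \<Rightarrow> 'i list set" where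
  "cox_class I m u = {v. cox_eq I m u v}"

definition coxeter_group :: "'i set \<Rightarrow> ('i \<Rightarrow> 'i \<Rightarrow> nat) \<Rightarrow> 'i list set monoid" where
  "coxeter_group I m =
    \<lparr>carrier = cox_class I m ` lists I,
     monoid.mult = (\<lambda>A B. \<Union>u\<in>A. \<Union>v\<in>B. cox_class I m (u @ v)),
     one = cox_class I m []\<rparr>"

definition cox_gen :: "'i set \<Rightarrow> ('i \<Rightarrow> 'i \<Rightarrow> nat) \<Rightarrow> 'i \<Rightarrow> 'i list set" where
  "cox_gen I m i = cox_class I m [i]"

definition reflections :: "'i set \<Rightarrow> ('i \<Rightarrow> 'i \<Rightarrow> nat) \<Rightarrow> 'i list set set" where
  "reflections I m =
    {w \<otimes>\<^bsub>coxeter_group I m\<^esub> cox_gen I m i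
       \<otimes>\<^bsub>coxeter_group I m\<^esub> inv\<^bsub>coxeter_group I m\<^esub> w |
     w i. w \<in> carrier (coxeter_group I m) \<and> i \<in> I}"

definition parabolic :: "'i set \<Rightarrow> ('i \<Rightarrow> 'i \<Rightarrow> nat) \<Rightarrow> 'i set \<Rightarrow> 'i list set set" where
  "parabolic I m J = generate (coxeter_group I m) (cox_gen I m ` J)"

section \<open>The Hecke-Hopf algebra\<close>

datatype 'i gen = SG 'i | DG 'i

primrec alt :: "nat \<Rightarrow> 'i \<Rightarrow> 'i \<Rightarrow> 'i list" where
  "alt 0 i j = []"
| "alt (Suc n) i j = i # alt n j i"

text \<open>Each defining relation \<open>l = r\<close> is encoded as the element \<open>l - r\<close>.  In the last set, the
  word \<open>alt (m i j - 1) j i\<close> is the common string \<open>s_j s_i s_j \<dots>\<close> of \<open>m i j - 1\<close> involutions on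
  the two sides of the braid-type relation.\<close>

definition hecke_hopf_relations :: "'i set \<Rightarrow> ('i \<Rightarrow> 'i \<Rightarrow> nat) \<Rightarrow> 'i gen falg set" where
  "hecke_hopf_relations I m =
     {mon [SG i, SG i] - 1 | i. i \<in> I}
   \<union> {mon [DG i, DG i] - mon [DG i] | i. i \<in> I}
   \<union> {mon [SG i, DG i] + mon [DG i, SG i] - (mon [SG i] - 1) | i. i \<in> I}
   \<union> {mon (concat (replicate (m i j) [SG i, SG j])) - 1 | i j. i \<in> I \<and> j \<in> I}
   \<union> {mon (DG i # map SG (alt (m i j - 1) j i))
        - mon (map SG (alt (m i j - 1) j i) @ [DG (if even (m i j) then i else j)]) |
      i j. i \<in> I \<and> j \<in> I \<and> i \<noteq> j \<and> m i j \<noteq> 0}"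

definition HF :: "'i set \<Rightarrow> 'i gen falg ring" where
  "HF I = free_algebra (SG ` I \<union> DG ` I)"

definition hecke_hopf_ideal :: "'i set \<Rightarrow> ('i \<Rightarrow> 'i \<Rightarrow> nat) \<Rightarrow> 'i gen falg set" where
  "hecke_hopf_ideal I m = genideal (HF I) (hecke_hopf_relations I m)"

definition Hhat :: "'i set \<Rightarrow> ('i \<Rightarrow> 'i \<Rightarrow> nat) \<Rightarrow> 'i gen falg set ring" where
  "Hhat I m = HF I Quot hecke_hopf_ideal I m"

definition Hmon :: "'i set \<Rightarrow> ('i \<Rightarrow> 'i \<Rightarrow> nat) \<Rightarrow> 'i gen list \<Rightarrow> 'i gen falg set" where
  "Hmon I m xs = hecke_hopf_ideal I m +>\<^bsub>HF I\<^esub> mon xs"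

definition s_hat :: "'i set \<Rightarrow> ('i \<Rightarrow> 'i \<Rightarrow> nat) \<Rightarrow> 'i \<Rightarrow> 'i gen falg set" where
  "s_hat I m i = Hmon I m [SG i]"

definition D_hat :: "'i set \<Rightarrow> ('i \<Rightarrow> 'i \<Rightarrow> nat) \<Rightarrow> 'i \<Rightarrow> 'i gen falg set" where
  "D_hat I m i = Hmon I m [DG i]"

text \<open>The homomorphism from the Coxeter group to the units of the algebra; its value does not
  depend on the word chosen to represent the group element.\<close>

definition W_hat ::
    "'i set \<Rightarrow> ('i \<Rightarrow> 'i \<Rightarrow> nat) \<Rightarrow> 'i list set \<Rightarrow> 'i gen falg set" where
  "W_hat I m w = the_elem ((\<lambda>u. Hmon I m (map SG u)) ` w)"

text \<open>The counit is the algebra homomorphism sending every \<open>s_i\<close> to 1 and every \<open>D_i\<close> to 0; it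
  is defined on the free algebra and is constant on cosets of the defining ideal.\<close>

primrec counit_gen :: "'i gen \<Rightarrow> int" where
  "counit_gen (SG i) = 1"
| "counit_gen (DG i) = 0"

definition counit_free :: "'i gen falg \<Rightarrow> int" where
  "counit_free p = (\<Sum>w \<in> Poly_Mapping.keys p.
     Poly_Mapping.lookup p w * prod_list (map counit_gen (letters w)))"

definition counit :: "'i gen falg set \<Rightarrow> int" where
  "counit x = the_elem (counit_free ` x)"

definition Ker_counit :: "'i set \<Rightarrow> ('i \<Rightarrow> 'i \<Rightarrow> nat) \<Rightarrow> 'i gen falg set set" where
  "Ker_counit I m = {x \<in> carrier (Hhat I m). counit x = 0}"

section \<open>The elements attached to reflections and the subalgebras they generate\<close>

text \<open>The unique family \<open>(D_s)\<close> indexed by the reflections; it is taken to be extensional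
  because the conditions say nothing about arguments that are not reflections.\<close>

definition D_refl ::
    "'i set \<Rightarrow> ('i \<Rightarrow> 'i \<Rightarrow> nat) \<Rightarrow> 'i list set \<Rightarrow> 'i gen falg set" where
  "D_refl I m = (THE D. D \<in> reflections I m \<rightarrow>\<^sub>E carrier (Hhat I m)
     \<and> (\<forall>i\<in>I. D (cox_gen I m i) = D_hat I m i)
     \<and> (\<forall>i\<in>I. \<forall>s \<in> reflections I m - {cox_gen I m i}.
          D (cox_gen I m i \<otimes>\<^bsub>coxeter_group I m\<^esub> s \<otimes>\<^bsub>coxeter_group I m\<^esub> cox_gen I m i)
          = s_hat I m i \<otimes>\<^bsub>Hhat I m\<^esub> D s \<otimes>\<^bsub>Hhat I m\<^esub> s_hat I m i))"

text \<open>For a subgroup \<open>V\<close> of the Coxeter group: the subalgebra generated by the \<open>D_s\<close> with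
  \<open>s \<in> V\<close>, and the intersection of its conjugates under \<open>V\<close>.  They are used for the whole group
  and for standard parabolic subgroups.\<close>

definition Dhat ::
    "'i set \<Rightarrow> ('i \<Rightarrow> 'i \<Rightarrow> nat) \<Rightarrow> 'i list set set \<Rightarrow> 'i gen falg set set" where
  "Dhat I m V = generate_ring (Hhat I m) (D_refl I m ` (reflections I m \<inter> V))"

definition K_alg ::
    "'i set \<Rightarrow> ('i \<Rightarrow> 'i \<Rightarrow> nat) \<Rightarrow> 'i list set set \<Rightarrow> 'i gen falg set set" where
  "K_alg I m V = (\<Inter>w\<in>V.
     {W_hat I m w \<otimes>\<^bsub>Hhat I m\<^esub> x \<otimes>\<^bsub>Hhat I m\<^esub> W_hat I m (inv\<^bsub>coxeter_group I m\<^esub> w) |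
      x. x \<in> Dhat I m V})"

text \<open>Elements of filtration degree at most \<open>r\<close>: the additive subgroup generated by all products
  of at most \<open>r\<close> of the \<open>D_s\<close>.\<close>

definition Dhat_deg_le ::
    "'i set \<Rightarrow> ('i \<Rightarrow> 'i \<Rightarrow> nat) \<Rightarrow> nat \<Rightarrow> 'i gen falg set set" where
  "Dhat_deg_le I m r = generate (add_monoid (Hhat I m))
     {foldr (\<lambda>s x. D_refl I m s \<otimes>\<^bsub>Hhat I m\<^esub> x) ss \<one>\<^bsub>Hhat I m\<^esub> |
      ss. ss \<in> lists (reflections I m) \<and> length ss \<le> r}"

definition K_rank2 ::
    "'i set \<Rightarrow> ('i \<Rightarrow> 'i \<Rightarrow> nat) \<Rightarrow> 'i \<Rightarrow> 'i \<Rightarrow> 'i gen falg set set" where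
  "K_rank2 I m i j =
     K_alg I m (parabolic I m {i, j}) \<inter> Ker_counit I m \<inter> Dhat_deg_le I m (m i j)"

section \<open>The two quotients\<close>

definition J_full :: "'i set \<Rightarrow> ('i \<Rightarrow> 'i \<Rightarrow> nat) \<Rightarrow> 'i gen falg set set" where
  "J_full I m = genideal (Hhat I m)
     (K_alg I m (carrier (coxeter_group I m)) \<inter> Ker_counit I m)"

definition J_rank2 :: "'i set \<Rightarrow> ('i \<Rightarrow> 'i \<Rightarrow> nat) \<Rightarrow> 'i gen falg set set" where
  "J_rank2 I m = genideal (Hhat I m)
     (\<Union>i\<in>I. \<Union>j\<in>I - {i}. K_rank2 I m i j)"

text \<open>\<open>H_alg\<close> is $\mathbf{H}(W)$ and \<open>H_low\<close> is $\underline{\mathbf{H}}(W)$.\<close>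

definition H_alg :: "'i set \<Rightarrow> ('i \<Rightarrow> 'i \<Rightarrow> nat) \<Rightarrow> 'i gen falg set set ring" where
  "H_alg I m = Hhat I m Quot J_rank2 I m"

definition H_low :: "'i set \<Rightarrow> ('i \<Rightarrow> 'i \<Rightarrow> nat) \<Rightarrow> 'i gen falg set set ring" where
  "H_low I m = Hhat I m Quot J_full I m"

definition proj_H ::
    "'i set \<Rightarrow> ('i \<Rightarrow> 'i \<Rightarrow> nat) \<Rightarrow> 'i gen falg set \<Rightarrow> 'i gen falg set set" where
  "proj_H I m x = J_rank2 I m +>\<^bsub>Hhat I m\<^esub> x"

definition proj_low ::
    "'i set \<Rightarrow> ('i \<Rightarrow> 'i \<Rightarrow> nat) \<Rightarrow> 'i gen falg set \<Rightarrow> 'i gen falg set set" where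
  "proj_low I m x = J_full I m +>\<^bsub>Hhat I m\<^esub> x"

definition D_alg :: "'i set \<Rightarrow> ('i \<Rightarrow> 'i \<Rightarrow> nat) \<Rightarrow> 'i gen falg set set ring" where
  "D_alg I m = (H_alg I m)\<lparr>carrier := proj_H I m ` Dhat I m (carrier (coxeter_group I m))\<rparr>"

definition D_low :: "'i set \<Rightarrow> ('i \<Rightarrow> 'i \<Rightarrow> nat) \<Rightarrow> 'i gen falg set set ring" where
  "D_low I m = (H_low I m)\<lparr>carrier := proj_low I m ` Dhat I m (carrier (coxeter_group I m))\<rparr>"

section \<open>Symmetries of rings\<close>

definition anti_involution :: "('a, 'b) ring_scheme \<Rightarrow> ('a \<Rightarrow> 'a) \<Rightarrow> bool" where
  "anti_involution R f \<longleftrightarrow>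
     f \<in> carrier R \<rightarrow> carrier R
   \<and> f \<one>\<^bsub>R\<^esub> = \<one>\<^bsub>R\<^esub>
   \<and> (\<forall>x\<in>carrier R. \<forall>y\<in>carrier R. f (x \<oplus>\<^bsub>R\<^esub> y) = f x \<oplus>\<^bsub>R\<^esub> f y)
   \<and> (\<forall>x\<in>carrier R. \<forall>y\<in>carrier R. f (x \<otimes>\<^bsub>R\<^esub> y) = f y \<otimes>\<^bsub>R\<^esub> f x)
   \<and> (\<forall>x\<in>carrier R. f (f x) = x)"

definition ring_involution :: "('a, 'b) ring_scheme \<Rightarrow> ('a \<Rightarrow> 'a) \<Rightarrow> bool" where
  "ring_involution R f \<longleftrightarrow> f \<in> ring_iso R R \<and> (\<forall>x\<in>carrier R. f (f x) = x)"

definition twisted_derivation ::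
    "('a, 'b) ring_scheme \<Rightarrow> ('a \<Rightarrow> 'a) \<Rightarrow> ('a \<Rightarrow> 'a) \<Rightarrow> bool" where
  "twisted_derivation R \<sigma> d \<longleftrightarrow>
     d \<in> carrier R \<rightarrow> carrier R
   \<and> (\<forall>x\<in>carrier R. \<forall>y\<in>carrier R. d (x \<oplus>\<^bsub>R\<^esub> y) = d x \<oplus>\<^bsub>R\<^esub> d y)
   \<and> (\<forall>x\<in>carrier R. \<forall>y\<in>carrier R.
        d (x \<otimes>\<^bsub>R\<^esub> y) = d x \<otimes>\<^bsub>R\<^esub> y \<oplus>\<^bsub>R\<^esub> \<sigma> x \<otimes>\<^bsub>R\<^esub> d y)"

end

theory Submission
  imports Defs
begin

text \<open>The algebra \<open>\<^bold>H(W)\<close> hat has the normal form \<open>D\<close> hat times the group ring, where \<open>D\<close> hat is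
  the free product of the rings generated by the single idempotents \<open>D\<^sub>s\<close>.  Commuting \<open>s\<^sub>i\<close> past an
  element \<open>x\<close> of \<open>D\<close> hat therefore defines \<open>s\<^sub>i(x)\<close> and \<open>d\<^sub>i(x)\<close> by \<open>s\<^sub>i x = s\<^sub>i(x) s\<^sub>i - d\<^sub>i(x)\<close>, which
  are the action and the twisted derivations on \<open>D\<close> hat.  An element all of whose conjugates stay in
  \<open>D\<close> hat is killed by every \<open>d\<^sub>s\<close> and is conjugated by \<open>w\<close> into \<open>w(x)\<close>; hence the ideal generated by
  such elements meets \<open>D\<close> hat in an ideal that is stable under the action and the derivations.

  The anti-involution and \<open>\<theta>\<close> exist already upstairs.  They fix, respectively send to \<open>1 - D\<^sub>s\<close>, each
  \<open>D\<^sub>s\<close>, so they preserve \<open>K(W)\<close>.  The counit is preserved by the former.  On \<open>K\<close> of a finite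
  rank two parabolic subgroup it is preserved by \<open>\<theta>\<close> as well, because there \<open>\<theta>(x)\<close> and \<open>w\<^sub>0(x) = w\<^sub>0 x w\<^sub>0\<^sup>-\<^sup>1\<close>
  have the same counit for the longest element \<open>w\<^sub>0\<close>;
  for \<open>m i j = 0\<close> the degree bound leaves only constants.

  The existence of the \<open>D\<^sub>s\<close> is Deodhar's theorem on elements mapping simple roots to simple roots,
  which uses that \<open>s\<^sub>i s\<^sub>j\<close> has order exactly \<open>m i j\<close>; the normal form follows from an explicit module
  on which the algebra acts.\<close>

section \<open>Coxeter groups\<close>

text \<open>Roots are replaced by a sign: \<open>flip w t\<close> says that \<open>w\<close> makes
  the positive root of \<open>t\<close> negative. It is computed from words, so exchange and length
  arguments stay combinatorial; the real representation enters only to bound the order of a product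
  of two generators from below.

  The obstacle with a presented algebra is well-definedness: nothing can be read off from an element
  of \<open>DD\<close> directly. Every map out of \<open>DD\<close> is therefore defined by letting
  the element act on the vector \<open>e0\<close>, where its normal form becomes visible, and by
  interpreting the resulting list of reflections. What remains to be checked is a recursion on one
  letter, compatible with the idempotents.

  Elements of a rank two K are stable only under their own parabolic subgroup, whereas all
  derivations have to kill them. For a reflection \<open>s\<close> outside the subgroup this is
  automatic, since d_s kills every generator \<open>Dr t\<close> with t different from s.

  The counit argument for theta uses a longest element; it reaches the rank two generators, but not
  K(W) for arbitrary W.\<close>

locale coxeter =
  fixes I :: "'i set" and m :: "'i \<Rightarrow> 'i \<Rightarrow> nat"
  assumes coxeter_matrix: "coxeter_matrix I m"
begin

abbreviation W where "W \<equiv> coxeter_group I m"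
abbreviation Wmult (infixl \<open>\<star>\<close> 70) where "x \<star> y \<equiv> x \<otimes>\<^bsub>W\<^esub> y"
abbreviation gen where "gen \<equiv> cox_gen I m"
abbreviation ev where "ev \<equiv> cox_class I m"
abbreviation T where "T \<equiv> reflections I m"

lemma m_diag: "i \<in> I \<Longrightarrow> m i i = 1"
  and m_sym: "i \<in> I \<Longrightarrow> j \<in> I \<Longrightarrow> m i j = m j i"
  and m_eq_1: "i \<in> I \<Longrightarrow> j \<in> I \<Longrightarrow> m i j = 1 \<longleftrightarrow> i = j"
  using coxeter_matrix unfolding coxeter_matrix_def by auto

lemma lists_iff: "u \<in> lists J \<longleftrightarrow> set u \<subseteq> J"
  by auto

lemma cox_eq_lists: "cox_eq I m u v \<Longrightarrow> set u \<subseteq> I \<and> set v \<subseteq> I"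
proof (induction rule: cox_eq.induct)
  case (rel u v i j)
  have "set (concat (replicate k [i, j])) \<subseteq> I" for k using rel by (induction k) auto
  then show ?case using rel by (simp add: lists_iff)
qed auto

lemma cox_eq_context:
  "cox_eq I m u v \<Longrightarrow> set x \<subseteq> I \<Longrightarrow> set y \<subseteq> I \<Longrightarrow> cox_eq I m (x @ u @ y) (x @ v @ y)"
proof (induction rule: cox_eq.induct)
  case (refl u)
  then show ?case by (intro cox_eq.refl) (simp add: lists_iff)
next
  case (rel u v i j)
  then show ?case using cox_eq.rel[of "x @ u" I "v @ y" i j m] by (simp add: lists_iff)
qed (blast intro: cox_eq.sym cox_eq.trans)+

lemma ev_eq_iff: "set u \<subseteq> I \<Longrightarrow> ev u = ev v \<longleftrightarrow> cox_eq I m u v"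
  unfolding cox_class_def by (blast intro: cox_eq.refl[unfolded lists_iff] cox_eq.sym cox_eq.trans)

lemma W_carrier: "carrier W = ev ` {u. set u \<subseteq> I}"
  and W_one: "\<one>\<^bsub>W\<^esub> = ev []"
  by (simp_all add: coxeter_group_def lists_eq_set)

lemma W_mult:
  assumes "set u \<subseteq> I" "set v \<subseteq> I"
  shows "ev u \<star> ev v = ev (u @ v)"
proof -
  have "ev (u' @ v') = ev (u @ v)" if "u' \<in> ev u" "v' \<in> ev v" for u' v'
  proof -
    have *: "cox_eq I m u u'" "cox_eq I m v v'" using that by (auto simp: cox_class_def)
    have "cox_eq I m (u @ v) (u' @ v)"
      using cox_eq_context[OF *(1), of "[]" v] assms by simp
    moreover have "cox_eq I m (u' @ v) (u' @ v')"
      using cox_eq_context[OF *(2), of u' "[]"] cox_eq_lists[OF *(1)] by simp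
    ultimately show ?thesis
      using ev_eq_iff assms cox_eq.trans by (metis Un_subset_iff set_append)
  qed
  moreover have "u \<in> ev u" "v \<in> ev v"
    using assms by (simp_all add: cox_class_def lists_iff cox_eq.refl)
  ultimately have "(\<Union>u'\<in>ev u. \<Union>v'\<in>ev v. ev (u' @ v')) = ev (u @ v)" by blast
  then show ?thesis by (simp add: coxeter_group_def)
qed

lemma ev_in_W [simp]: "set u \<subseteq> I \<Longrightarrow> ev u \<in> carrier W"
  by (simp add: W_carrier)

lemma ev_eqI: "cox_eq I m u v \<Longrightarrow> ev u = ev v"
  using ev_eq_iff cox_eq_lists by blast

lemma cox_rel:
  "set u \<subseteq> I \<Longrightarrow> set v \<subseteq> I \<Longrightarrow> i \<in> I \<Longrightarrow> j \<in> I \<Longrightarrow>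
    ev (u @ concat (replicate (m i j) [i, j]) @ v) = ev (u @ v)"
  by (intro ev_eqI cox_eq.rel) (simp_all add: lists_iff)

lemma ev_square:
  assumes "i \<in> I" "set u \<subseteq> I"
  shows "ev (i # i # u) = ev u"
  using cox_rel[OF _ assms(2,1,1), of "[]"] m_diag[OF assms(1)] by simp

lemma ev_rev: "set u \<subseteq> I \<Longrightarrow> ev (rev u @ u) = ev []"
proof (induction u)
  case (Cons i u)
  have "ev (rev u @ i # i # u) = ev (rev u) \<star> ev (i # i # u)"
    using Cons.prems by (subst W_mult) auto
  also have "\<dots> = ev (rev u @ u)"
    using Cons.prems by (simp add: ev_square W_mult)
  finally show ?case using Cons by simp
qed simp

lemma W_cases:
  assumes "w \<in> carrier W" obtains u where "set u \<subseteq> I" "w = ev u"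
  using assms unfolding W_carrier by blast

lemma W_group: "group W"
proof (rule groupI)
  fix x y assume "x \<in> carrier W" "y \<in> carrier W"
  then obtain u v where *: "set u \<subseteq> I" "x = ev u" "set v \<subseteq> I" "y = ev v" by (metis W_cases)
  then show "x \<star> y \<in> carrier W" by (simp add: W_mult)
next
  show "\<one>\<^bsub>W\<^esub> \<in> carrier W" by (simp add: W_one)
next
  fix x y z assume "x \<in> carrier W" "y \<in> carrier W" "z \<in> carrier W"
  then obtain u v w where "set u \<subseteq> I" "x = ev u" "set v \<subseteq> I" "y = ev v"
    "set w \<subseteq> I" "z = ev w" by (metis W_cases)
  then show "x \<star> y \<star> z = x \<star> (y \<star> z)" by (simp add: W_mult)
next
  fix x assume "x \<in> carrier W"
  then obtain u where u: "set u \<subseteq> I" "x = ev u" by (metis W_cases)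
  then show "\<one>\<^bsub>W\<^esub> \<star> x = x" by (simp add: W_mult W_one)
  from u have "ev (rev u) \<star> x = \<one>\<^bsub>W\<^esub>" by (simp add: W_mult ev_rev W_one)
  then show "\<exists>y\<in>carrier W. y \<star> x = \<one>\<^bsub>W\<^esub>"
    using u by (intro bexI[of _ "ev (rev u)"]) simp_all
qed

sublocale W: group W by (rule W_group)

lemma gen_closed [simp]: "i \<in> I \<Longrightarrow> gen i \<in> carrier W"
  by (simp add: cox_gen_def)

lemma gen_mult_ev: "i \<in> I \<Longrightarrow> set u \<subseteq> I \<Longrightarrow> gen i \<star> ev u = ev (i # u)"
  by (simp add: cox_gen_def W_mult)

lemma ev_mult_gen: "i \<in> I \<Longrightarrow> set u \<subseteq> I \<Longrightarrow> ev u \<star> gen i = ev (u @ [i])"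
  by (simp add: cox_gen_def W_mult)

lemma gen_square [simp]: "i \<in> I \<Longrightarrow> gen i \<star> gen i = \<one>\<^bsub>W\<^esub>"
  using gen_mult_ev[of i "[i]"] ev_square[of i "[]"] by (simp add: cox_gen_def W_one)

lemma inv_gen [simp]: "i \<in> I \<Longrightarrow> inv\<^bsub>W\<^esub> gen i = gen i"
  using W.inv_equality by simp

lemma W_cancel [simp]:
  "w \<in> carrier W \<Longrightarrow> x \<in> carrier W \<Longrightarrow> inv\<^bsub>W\<^esub> w \<star> (w \<star> x) = x"
  "w \<in> carrier W \<Longrightarrow> x \<in> carrier W \<Longrightarrow> w \<star> (inv\<^bsub>W\<^esub> w \<star> x) = x"
  "i \<in> I \<Longrightarrow> x \<in> carrier W \<Longrightarrow> gen i \<star> (gen i \<star> x) = x"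
  by (simp_all flip: W.m_assoc)

lemma inv_ev: "set u \<subseteq> I \<Longrightarrow> inv\<^bsub>W\<^esub> ev u = ev (rev u)"
  using W.inv_equality[of "ev (rev u)" "ev u"] by (simp add: W_mult ev_rev W_one)

lemma W_induct [consumes 1, case_names one gen]:
  assumes "w \<in> carrier W" "P \<one>\<^bsub>W\<^esub>"
    and "\<And>i w. i \<in> I \<Longrightarrow> w \<in> carrier W \<Longrightarrow> P w \<Longrightarrow> P (gen i \<star> w)"
  shows "P w"
proof -
  have "P (ev u)" if "set u \<subseteq> I" for u
    using that
  proof (induction u)
    case Nil
    then show ?case using assms(2) by (simp add: W_one)
  next
    case (Cons i u)
    then show ?case using assms(3)[of i "ev u"] gen_mult_ev[of i u] by simp
  qed
  then show ?thesis using assms(1) W_cases by metis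
qed

subsection \<open>Conjugation and reflections\<close>

definition conj where "conj w t = w \<star> t \<star> inv\<^bsub>W\<^esub> w"

lemma conj_closed [simp]: "w \<in> carrier W \<Longrightarrow> t \<in> carrier W \<Longrightarrow> conj w t \<in> carrier W"
  by (simp add: conj_def)

lemma conj_one [simp]: "t \<in> carrier W \<Longrightarrow> conj \<one>\<^bsub>W\<^esub> t = t"
  by (simp add: conj_def)

lemma conj_mult:
  "w \<in> carrier W \<Longrightarrow> v \<in> carrier W \<Longrightarrow> t \<in> carrier W \<Longrightarrow> conj (w \<star> v) t = conj w (conj v t)"
  by (simp add: conj_def W.m_assoc W.inv_mult_group)

lemma conj_inv [simp]:
  "w \<in> carrier W \<Longrightarrow> t \<in> carrier W \<Longrightarrow> conj (inv\<^bsub>W\<^esub> w) (conj w t) = t"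
  "w \<in> carrier W \<Longrightarrow> t \<in> carrier W \<Longrightarrow> conj w (conj (inv\<^bsub>W\<^esub> w) t) = t"
  by (simp_all flip: conj_mult)

lemma conj_eq_iff:
  assumes "w \<in> carrier W" "t \<in> carrier W" "t' \<in> carrier W"
  shows "conj w t = t' \<longleftrightarrow> t = conj (inv\<^bsub>W\<^esub> w) t'"
  using assms conj_inv by metis

lemma conj_mult_eq: "w \<in> carrier W \<Longrightarrow> t \<in> carrier W \<Longrightarrow> conj w t \<star> w = w \<star> t"
  by (simp add: conj_def W.m_assoc)

lemma conj_self [simp]: "t \<in> carrier W \<Longrightarrow> conj t t = t"
  by (simp add: conj_def W.m_assoc)

lemma conj_gen: "i \<in> I \<Longrightarrow> conj (gen i) t = gen i \<star> t \<star> gen i"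
  by (simp add: conj_def)

lemma refl_iff: "t \<in> T \<longleftrightarrow> (\<exists>w\<in>carrier W. \<exists>i\<in>I. t = conj w (gen i))"
  unfolding reflections_def conj_def by auto

lemma refl_closed [simp]: "t \<in> T \<Longrightarrow> t \<in> carrier W"
  by (auto simp: refl_iff)

lemma gen_refl [simp]: "i \<in> I \<Longrightarrow> gen i \<in> T"
  unfolding refl_iff by (metis W.one_closed conj_one gen_closed)

lemma conj_refl [simp]: "w \<in> carrier W \<Longrightarrow> t \<in> T \<Longrightarrow> conj w t \<in> T"
  unfolding refl_iff by (metis W.m_closed conj_mult gen_closed)

lemma refl_cases:
  assumes "t \<in> T" obtains w i where "w \<in> carrier W" "i \<in> I" "t = conj w (gen i)"
  using assms unfolding refl_iff by blast

lemma refl_square [simp]: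
  assumes "t \<in> T" shows "t \<star> t = \<one>\<^bsub>W\<^esub>"
proof -
  obtain w i where w: "w \<in> carrier W" "i \<in> I" "t = conj w (gen i)" by (rule refl_cases[OF assms])
  show ?thesis unfolding w(3) conj_def using w(1,2) by (simp add: W.m_assoc)
qed

lemma refl_inv [simp]: "t \<in> T \<Longrightarrow> inv\<^bsub>W\<^esub> t = t"
  by (simp add: W.inv_equality)

subsection \<open>The sign cocycle\<close>

text \<open>The word \<open>u\<close> makes the positive root of the reflection \<open>t\<close> negative: its letters act from
  the right, and letter \<open>x\<close> flips the sign exactly when the current reflection is \<open>gen x\<close>.\<close>

primrec flips :: "'i list \<Rightarrow> 'i list set \<Rightarrow> bool" where
  "flips [] t = False"
| "flips (x # u) t = (flips u t \<noteq> (conj (ev u) t = gen x))"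

text \<open>The cocycle rule: \<open>v\<close> acts first and moves \<open>t\<close> to its
  conjugate before \<open>u\<close> meets it. Inequality of truth values is exclusive or, that is,
  multiplication of signs.\<close>

lemma flips_append:
  assumes "set u \<subseteq> I" "set v \<subseteq> I" "t \<in> carrier W"
  shows "flips (u @ v) t = (flips u (conj (ev v) t) \<noteq> flips v t)"
  using assms(1)
proof (induction u)
  case (Cons x u)
  then have "conj (ev (u @ v)) t = conj (ev u) (conj (ev v) t)"
    using assms by (simp flip: W_mult conj_mult)
  then show ?case using Cons by auto
qed simp

section \<open>Alternating words and invariance of the sign under the Coxeter relations\<close>

lemma set_alt: "set (alt n a b) \<subseteq> {a, b}"
  by (induction n arbitrary: a b) auto

lemma set_alt_subset: "a \<in> J \<Longrightarrow> b \<in> J \<Longrightarrow> set (alt n a b) \<subseteq> J"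
  using set_alt[of n a b] by auto

lemma length_alt [simp]: "length (alt n a b) = n"
  by (induction n arbitrary: a b) auto

lemma alt_add: "alt (n + k) a b = alt n a b @ (if even n then alt k a b else alt k b a)"
  by (induction n arbitrary: a b) auto

lemma alt_snoc: "alt (Suc n) a b = alt n a b @ [if even n then a else b]"
  using alt_add[of n 1 a b] by simp

lemma rev_alt: "rev (alt n a b) = (if even n then alt n b a else alt n a b)"
proof (induction n arbitrary: a b)
  case (Suc n)
  show ?case using alt_snoc[of n b a] alt_snoc[of n a b] by (simp add: Suc)
qed simp

lemma concat_replicate_alt: "concat (replicate n [i, j]) = alt (2 * n) i j"
  by (induction n) auto

lemma ev_alt_rel:
  assumes "i \<in> I" "j \<in> I" "set u \<subseteq> I"
  shows "ev (alt (2 * m i j) i j @ u) = ev u"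
  using cox_rel[of "[]" u i j] assms by (simp add: concat_replicate_alt)

lemma ev_conj:
  assumes "set u \<subseteq> I" "i \<in> I"
  shows "conj (ev u) (gen i) = ev (u @ [i] @ rev u)"
  using assms by (simp add: conj_def cox_gen_def inv_ev W_mult)

text \<open>The letter in position k meets the reflection represented by the palindrome of length 2k
  + 1, namely that letter conjugated by the k letters read before it. The sum counts how often
  \<open>t\<close> is met; only its parity matters.\<close>

lemma flips_rev_alt:
  assumes "a \<in> I" "b \<in> I" "t \<in> carrier W"
  shows "flips (rev (alt n b a)) t \<longleftrightarrow>
    odd (\<Sum>k<n. of_bool (t = ev (alt (2 * k + 1) b a)) :: nat)"
proof (induction n)
  case (Suc n)
  let ?u = "alt n b a" and ?x = "if even n then b else a"
  have u: "set ?u \<subseteq> I" "?x \<in> I" using assms set_alt_subset[of b I a n] by simp_all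
  have "conj (ev (rev ?u)) t = gen ?x \<longleftrightarrow> t = conj (ev ?u) (gen ?x)"
    using u assms conj_eq_iff[of "ev (rev ?u)" t "gen ?x"] by (simp add: inv_ev)
  moreover have "alt (2 * n + 1) b a = ?u @ [?x] @ rev ?u"
    using alt_add[of "Suc n" n b a] by (simp add: alt_snoc rev_alt mult_2 del: alt.simps)
  ultimately have "conj (ev (rev ?u)) t = gen ?x \<longleftrightarrow> t = ev (alt (2 * n + 1) b a)"
    using ev_conj[OF u] by simp
  then show ?case using Suc by (simp add: alt_snoc del: alt.simps)
qed simp

text \<open>The palindromes met by the relator repeat with period \<open>m i j\<close>, because the
  relator itself evaluates to 1. Over its 2 m letters each reflection is thus met an even number of
  times. This is what makes the sign depend on the group element only.\<close>

lemma flips_rel: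
  assumes "i \<in> I" "j \<in> I" "t \<in> carrier W"
  shows "\<not> flips (alt (2 * m i j) i j) t"
proof -
  let ?f = "\<lambda>k. of_bool (t = ev (alt (2 * k + 1) j i)) :: nat"
  have "ev (alt (2 * (m i j + k) + 1) j i) = ev (alt (2 * k + 1) j i)" for k
  proof -
    have "alt (2 * (m i j + k) + 1) j i = alt (2 * m i j) j i @ alt (2 * k + 1) j i"
      using alt_add[of "2 * m i j" "2 * k + 1" j i] by (simp add: algebra_simps)
    then show ?thesis
      using ev_alt_rel[of j i "alt (2 * k + 1) j i"] assms set_alt_subset[of j I i]
      by (simp add: m_sym del: alt.simps)
  qed
  then have "(\<Sum>k<m i j. ?f (m i j + k)) = (\<Sum>k<m i j. ?f k)" by simp
  moreover have "(\<Sum>k<n + p. f k) = (\<Sum>k<n. f k) + (\<Sum>k<p. f (n + k))"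
    for f :: "nat \<Rightarrow> nat" and n p by (induction p) simp_all
  from this[where f = ?f and n = "m i j" and p = "m i j"]
  have "(\<Sum>k<2 * m i j. ?f k) = (\<Sum>k<m i j. ?f k) + (\<Sum>k<m i j. ?f (m i j + k))"
    by (simp only: mult_2)
  ultimately have "even (\<Sum>k<2 * m i j. ?f k)" by (simp only: flip: mult_2) simp
  moreover have "rev (alt (2 * m i j) j i) = alt (2 * m i j) i j" by (simp add: rev_alt)
  ultimately show ?thesis using flips_rev_alt[of i j t "2 * m i j"] assms by simp
qed

lemma flips_cong:
  "cox_eq I m u v \<Longrightarrow> t \<in> carrier W \<Longrightarrow> flips u t = flips v t"
proof (induction rule: cox_eq.induct)
  case (rel u v i j)
  let ?r = "alt (2 * m i j) i j"
  have r: "set ?r \<subseteq> I" "set u \<subseteq> I" "set v \<subseteq> I"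
    using set_alt_subset[of i I j] rel by auto
  have "ev ?r = \<one>\<^bsub>W\<^esub>" using ev_alt_rel[of i j "[]"] rel by (simp add: W_one)
  then have "flips (?r @ v) t = flips v t" "ev (?r @ v) = ev v"
    using r rel by (simp_all add: flips_append flips_rel flip: W_mult)
  then show ?case
    using flips_append[of u "?r @ v" t] flips_append[of u v t] r rel
    by (simp add: concat_replicate_alt)
qed auto

text \<open>The chosen word is immaterial by \<open>flips_cong\<close>. By
  \<open>len_flip_iff\<close> the reflections flipped by \<open>w\<close> are its
  inversions.\<close>

definition flip :: "'i list set \<Rightarrow> 'i list set \<Rightarrow> bool" where
  "flip w = flips (SOME u. set u \<subseteq> I \<and> ev u = w)"

lemma flip_ev:
  assumes "set u \<subseteq> I" "t \<in> carrier W"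
  shows "flip (ev u) t = flips u t"
proof -
  define v where "v = (SOME v. set v \<subseteq> I \<and> ev v = ev u)"
  have "set v \<subseteq> I \<and> ev v = ev u" unfolding v_def by (rule someI[of _ u]) (use assms in simp)
  then have "flips v t = flips u t" using ev_eq_iff flips_cong assms by blast
  then show ?thesis by (simp add: flip_def v_def)
qed

lemma flip_mult:
  assumes "w \<in> carrier W" "v \<in> carrier W" "t \<in> carrier W"
  shows "flip (w \<star> v) t = (flip w (conj v t) \<noteq> flip v t)"
proof -
  obtain x y where "set x \<subseteq> I" "w = ev x" "set y \<subseteq> I" "v = ev y"
    using assms W_cases by metis
  then show ?thesis using assms by (simp add: flip_ev W_mult flips_append)
qed

lemma flip_one [simp]: "t \<in> carrier W \<Longrightarrow> \<not> flip \<one>\<^bsub>W\<^esub> t"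
  using flip_ev[of "[]"] by (simp add: W_one)

lemma flip_gen: "i \<in> I \<Longrightarrow> t \<in> carrier W \<Longrightarrow> flip (gen i) t \<longleftrightarrow> t = gen i"
  using flip_ev[of "[i]"] by (simp add: cox_gen_def flip: W_one)

lemma flip_inv:
  assumes "w \<in> carrier W" "t \<in> carrier W"
  shows "flip (inv\<^bsub>W\<^esub> w) (conj w t) = flip w t"
  using flip_mult[of "inv\<^bsub>W\<^esub> w" w t] assms by simp

text \<open>In t = w s w^-1 the contributions of w and of its inverse cancel, and the simple
  reflection s in the middle flips itself.\<close>

lemma flip_self:
  assumes "t \<in> T" shows "flip t t"
proof -
  obtain w i where w: "w \<in> carrier W" "i \<in> I" "t = conj w (gen i)" by (rule refl_cases[OF assms])
  then have "flip t t = flip (w \<star> gen i \<star> inv\<^bsub>W\<^esub> w) (conj w (gen i))"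
    by (simp add: conj_def)
  also have "\<dots> = (flip (w \<star> gen i) (gen i) \<noteq> flip w (gen i))"
    using w by (simp add: flip_mult flip_inv del: W.m_assoc)
  also have "\<dots>" using w by (simp add: flip_mult flip_gen)
  finally show ?thesis .
qed

subsection \<open>Length and exchange\<close>

text \<open>The strong exchange condition. If the sign changes along the word, some single letter
  \<open>x\<close> meets \<open>t\<close> as its own simple reflection; multiplying by
  \<open>t\<close> then cancels exactly that letter.\<close>

lemma flips_delete:
  assumes "set u \<subseteq> I" "t \<in> carrier W" "flips u t"
  obtains a x b where "u = a @ [x] @ b" "ev u \<star> t = ev (a @ b)" "t = conj (ev (rev b)) (gen x)"
proof -
  have "\<exists>a x b. u = a @ [x] @ b \<and> conj (ev b) t = gen x"
    using assms
  proof (induction u)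
    case (Cons y u)
    show ?case
    proof (cases "flips u t")
      case True
      then obtain a x b where "u = a @ [x] @ b \<and> conj (ev b) t = gen x" using Cons by auto
      then show ?thesis by (metis append_Cons)
    next
      case False
      then show ?thesis using Cons.prems by (metis append_Cons append_Nil flips.simps(2))
    qed
  qed simp
  then obtain a x b where u: "u = a @ [x] @ b" "conj (ev b) t = gen x" by blast
  then have I: "set a \<subseteq> I" "x \<in> I" "set b \<subseteq> I" using assms by auto
  have t: "t = conj (ev (rev b)) (gen x)" using conj_eq_iff[of "ev b" t "gen x"] u I assms inv_ev by simp
  have "ev u \<star> t = ev a \<star> (gen x \<star> (ev b \<star> t))"
    using I assms u by (simp add: gen_mult_ev W_mult flip: W.m_assoc)
  also have "ev b \<star> t = gen x \<star> ev b"
    using conj_mult_eq[of "ev b" t] u I assms by simp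
  also have "gen x \<star> (gen x \<star> ev b) = ev b"
    using I by (simp flip: W.m_assoc)
  finally show thesis using u I t that by (simp add: W_mult)
qed

definition len where "len w = (LEAST n. \<exists>u. set u \<subseteq> I \<and> ev u = w \<and> length u = n)"

lemma len_le: "set u \<subseteq> I \<Longrightarrow> len (ev u) \<le> length u"
  unfolding len_def by (rule Least_le) auto

lemma reduced_word:
  assumes "w \<in> carrier W" obtains u where "set u \<subseteq> I" "ev u = w" "length u = len w"
proof -
  have "\<exists>n u. set u \<subseteq> I \<and> ev u = w \<and> length u = n" using W_cases[OF assms] by metis
  from LeastI_ex[OF this] show thesis unfolding len_def[symmetric] using that by blast
qed

lemma len_flip:
  assumes "w \<in> carrier W" "t \<in> carrier W" "flip w t"
  shows "len (w \<star> t) < len w"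
proof -
  obtain u where u: "set u \<subseteq> I" "ev u = w" "length u = len w" using reduced_word assms by blast
  then have "flips u t" using assms flip_ev by auto
  then obtain a x b where "u = a @ [x] @ b" "ev u \<star> t = ev (a @ b)"
    using flips_delete u assms by metis
  then show ?thesis using len_le[of "a @ b"] u by auto
qed

text \<open>Since \<open>t\<close> flips itself, exactly one of \<open>w\<close> and
  \<open>w \<star> t\<close> flips \<open>t\<close>. Applying \<open>len_flip\<close> to that one
  yields both strict inequalities.\<close>

lemma len_flip_iff:
  assumes "w \<in> carrier W" "t \<in> T"
  shows "flip w t \<longleftrightarrow> len (w \<star> t) < len w"
    and "\<not> flip w t \<longleftrightarrow> len w < len (w \<star> t)"
proof -
  have "len w < len (w \<star> t)" if "\<not> flip w t"
  proof -
    have "flip (w \<star> t) t" using assms that by (simp add: flip_mult flip_self)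
    then show ?thesis using len_flip[of "w \<star> t" t] assms by (simp add: W.m_assoc)
  qed
  then show "flip w t \<longleftrightarrow> len (w \<star> t) < len w" "\<not> flip w t \<longleftrightarrow> len w < len (w \<star> t)"
    using len_flip[of w t] assms by force+
qed

lemma len_gen_le:
  assumes "w \<in> carrier W" "i \<in> I"
  shows "len (w \<star> gen i) \<le> len w + 1" "len (gen i \<star> w) \<le> len w + 1"
proof -
  obtain u where u: "set u \<subseteq> I" "ev u = w" "length u = len w" using reduced_word assms by blast
  then show "len (w \<star> gen i) \<le> len w + 1" "len (gen i \<star> w) \<le> len w + 1"
    using len_le[of "u @ [i]"] len_le[of "i # u"] assms by (auto simp: ev_mult_gen gen_mult_ev)
qed

text \<open>The sign separates the two: a generator flips itself, the identity flips
  nothing.\<close>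

lemma gen_neq_one: "i \<in> I \<Longrightarrow> gen i \<noteq> \<one>\<^bsub>W\<^esub>"
  using flip_gen[of i "gen i"] flip_one[of "gen i"] by auto

end

section \<open>The dual geometric representation\<close>

text \<open>With c = 2 cos t this is the Chebyshev recurrence; the coordinates of a vector under
  alternating products of two reflections run through it.\<close>

fun recseq :: "real \<Rightarrow> real \<Rightarrow> real \<Rightarrow> nat \<Rightarrow> real" where
  "recseq c x y 0 = x"
| "recseq c x y (Suc 0) = y"
| "recseq c x y (Suc (Suc n)) = c * recseq c x y (Suc n) - recseq c x y n"

text \<open>The closed form is multiplied by sin t so that it holds without excluding sin t =
  0.\<close>

lemma recseq_sin:
  "recseq (2 * cos t) x y n * sin t = y * sin (real n * t) - x * sin ((real n - 1) * t)"
proof (induction n rule: induct_nat_012)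
  case (ge2 n)
  have *: "sin ((a + 1) * t) = 2 * cos t * sin (a * t) - sin ((a - 1) * t)" for a
    by (simp add: algebra_simps sin_add sin_diff)
  have "recseq (2 * cos t) x y (Suc (Suc n)) * sin t =
     2 * cos t * (recseq (2 * cos t) x y (Suc n) * sin t) - recseq (2 * cos t) x y n * sin t"
    by (simp add: algebra_simps)
  also have "\<dots> = y * (2 * cos t * sin ((real n + 1) * t) - sin (real n * t))
      - x * (2 * cos t * sin (real n * t) - sin ((real n - 1) * t))"
    by (simp only: ge2) (simp add: algebra_simps)
  finally show ?case using *[of "real n + 1"] *[of "real n"] by (simp add: add_ac)
qed simp_all

lemma recseq_2: "recseq 2 x y n = x + real n * (y - x)"
  by (induction n rule: induct_nat_012) (simp_all add: algebra_simps)

context coxeter begin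

text \<open>Since \<open>m i i = 1\<close> and division by zero gives zero, this is the usual Cartan coefficient also
  on the diagonal (-2) and for \<open>m i j = 0\<close> (2).\<close>

definition cartan :: "'i \<Rightarrow> 'i \<Rightarrow> real" where "cartan i j = 2 * cos (pi / real (m i j))"

text \<open>A function f records the values of a linear functional on the simple roots, and s_i
  sends alpha_j to alpha_j + \<open>cartan i j\<close> alpha_i. Working with functionals avoids any
  finiteness condition on \<open>I\<close>.\<close>

definition rop :: "'i \<Rightarrow> ('i \<Rightarrow> real) \<Rightarrow> 'i \<Rightarrow> real" where
  "rop i f = (\<lambda>j. f j + cartan i j * f i)"

abbreviation rep where "rep u f \<equiv> foldr rop u f"

lemma cartan_diag: "i \<in> I \<Longrightarrow> cartan i i = -2"
  by (simp add: cartan_def m_diag)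

lemma cartan_sym: "i \<in> I \<Longrightarrow> j \<in> I \<Longrightarrow> cartan i j = cartan j i"
  by (simp add: cartan_def m_sym)

lemma m_ge_2: "i \<in> I \<Longrightarrow> j \<in> I \<Longrightarrow> i \<noteq> j \<Longrightarrow> m i j \<noteq> 0 \<Longrightarrow> m i j \<ge> 2"
  using m_eq_1[of i j] by linarith

text \<open>Split f into a part vanishing at i and j, which both reflections fix, and a combination
  of the rows \<open>cartan i\<close> and \<open>cartan j\<close>. On the two coefficients the
  alternating product follows the Chebyshev recurrence with angle pi / m, so after 2 m letters it
  has turned through 2 pi.\<close>

lemma rep_rel:
  assumes "i \<in> I" "j \<in> I"
  shows "rep (alt (2 * m i j) i j) f = f"
proof (cases "i = j")
  case True
  then show ?thesis
    using assms by (simp add: m_diag numeral_2_eq_2 rop_def cartan_diag)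
next
  case False
  show ?thesis
  proof (cases "m i j = 0")
    case m: False
    define t c where "t = pi / real (m i j)" and "c = cartan i j"
    have c: "c = 2 * cos t" by (simp add: c_def t_def cartan_def)
    have t: "0 < t" "t \<le> pi / 2"
      using m_ge_2[OF assms False m] by (simp_all add: t_def field_simps)
    then have sin: "sin t > 0" by (intro sin_gt_zero) auto
    have "c\<^sup>2 = 4 - 4 * (sin t)\<^sup>2"
      by (simp add: c power_mult_distrib cos_squared_eq)
    with sin have d: "4 - c\<^sup>2 \<noteq> 0" by simp
    \<comment> \<open>The solution of the 2 by 2 linear system \<open>h i = 0\<close>,
      \<open>h j = 0\<close>; its determinant 4 - c^2 equals 4 (sin t)^2.\<close>
    define x y where "x = - (2 * f i + c * f j) / (4 - c\<^sup>2)" and "y = - (c * f i + 2 * f j) / (4 - c\<^sup>2)"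
    define h where "h = (\<lambda>k. f k - x * cartan i k - y * cartan j k)"
    define g where "g = (\<lambda>a b k. h k + a * cartan i k + b * cartan j k)"
    have "cartan j i = c" using assms by (simp add: c_def cartan_sym)
    note cs = this c_def[symmetric] cartan_diag[OF assms(1)] cartan_diag[OF assms(2)]
    have "h i = (f i * (4 - c\<^sup>2) - (4 - c\<^sup>2) * f i) / (4 - c\<^sup>2)"
      unfolding h_def cs x_def y_def using d by (simp add: field_simps power2_eq_square)
    then have h: "h i = 0" by simp
    have "h j = (f j * (4 - c\<^sup>2) - (4 - c\<^sup>2) * f j) / (4 - c\<^sup>2)"
      unfolding h_def cs x_def y_def using d by (simp add: field_simps power2_eq_square)
    then have h': "h j = 0" by simp
    have gi: "rop i (g a b) = g (c * b - a) b" and gj: "rop j (g a b) = g a (c * a - b)" for a b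
      by (auto simp: rop_def g_def h h' cs algebra_simps)
    have "rep (alt (2 * n) i j) (g x y) = g (recseq c y x (2 * n + 1)) (recseq c y x (2 * n))" for n
      by (induction n) (simp_all add: gi gj algebra_simps)
    moreover have "recseq c y x (2 * m i j) * sin t = y * sin t"
      "recseq c y x (2 * m i j + 1) * sin t = x * sin t"
    proof -
      have p: "real (m i j) * t = pi" using m by (simp add: t_def)
      have 1: "real (2 * m i j) * t = 2 * pi" "(real (2 * m i j) - 1) * t = 2 * pi - t"
        "real (2 * m i j + 1) * t = 2 * pi + t" "(real (2 * m i j + 1) - 1) * t = 2 * pi"
        using p by (simp_all add: algebra_simps)
      show "recseq c y x (2 * m i j) * sin t = y * sin t"
        "recseq c y x (2 * m i j + 1) * sin t = x * sin t"
        unfolding c recseq_sin 1 by (simp_all add: sin_diff sin_add)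
    qed
    moreover have "g x y = f" by (simp add: g_def h_def)
    ultimately show ?thesis using sin by simp
  qed simp
qed

lemma rep_cong: "cox_eq I m u v \<Longrightarrow> rep u = rep v"
proof (induction rule: cox_eq.induct)
  case (rel u v i j)
  have "rep (u @ alt (2 * m i j) i j @ v) f = rep (u @ v) f" for f
    using rep_rel[OF rel(3,4)] by simp
  then show ?case by (auto simp: concat_replicate_alt)
qed auto

text \<open>The alternating words are separated by the vector with all coordinates 1, which lies in the
  fundamental chamber.\<close>

lemma alt_neq:
  assumes ab: "a \<in> I" "b \<in> I" "a \<noteq> b" and n: "0 < n" and eq: "ev (alt n a b) = ev (alt n b a)"
  shows "m a b \<noteq> 0 \<and> m a b \<le> n"
proof -
  define c where "c = cartan a b"
  \<comment> \<open>The start values -1 and 1 encode that both coordinates of the constant vector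
    are 1: its first coordinate is minus term 0 and its second is term 1.\<close>
  have V: "rep (alt n x y) (\<lambda>_. 1) x = - recseq c (-1) 1 n \<and>
      rep (alt n x y) (\<lambda>_. 1) y = recseq c (-1) 1 (Suc n)" if "{x, y} = {a, b}" for n x y
    using that
  proof (induction n arbitrary: x y)
    case (Suc n)
    have "x \<in> I" "cartan x y = c" using Suc.prems ab cartan_sym[of a b]
      by (auto simp: c_def doubleton_eq_iff)
    moreover have "{y, x} = {a, b}" using Suc.prems by auto
    ultimately show ?case using Suc.IH[of y x] by (auto simp: rop_def cartan_diag)
  qed auto
  have "cox_eq I m (alt n a b) (alt n b a)"
    using eq ev_eq_iff[of "alt n a b"] set_alt_subset[of a I b n] ab by blast
  then have "rep (alt n a b) (\<lambda>_. 1) a = rep (alt n b a) (\<lambda>_. 1) a"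
    by (simp only: rep_cong)
  moreover have "rep (alt n a b) (\<lambda>_. 1) a = - recseq c (-1) 1 n"
    using V[of a b n] by blast
  moreover have "rep (alt n b a) (\<lambda>_. 1) a = recseq c (-1) 1 (Suc n)"
    using V[of b a n] by blast
  ultimately have sum: "recseq c (-1) 1 n + recseq c (-1) 1 (Suc n) = 0"
    by linarith
  \<comment> \<open>For c = 2 term n is 2 n - 1, so the sum of consecutive terms is 4 n, which is
    positive.\<close>
  have m: "m a b \<noteq> 0"
  proof
    assume "m a b = 0"
    then have "c = 2" by (simp add: c_def cartan_def)
    then show False using sum n by (simp only: recseq_2) simp
  qed
  have False if "n < m a b"
  proof -
    define t where "t = pi / real (m a b)"
    have t: "0 < t" "t \<le> pi / 2"
      using m_ge_2[OF ab m] by (simp_all add: t_def field_simps)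
    \<comment> \<open>As 0 < n < m, the angle n t lies strictly between 0 and pi and the sum of the
      two terms cannot vanish.\<close>
    have "(recseq c (-1) 1 n + recseq c (-1) 1 (Suc n)) * sin t = (2 * cos t + 2) * sin (real n * t)"
      unfolding distrib_right c_def cartan_def t_def[symmetric] recseq_sin
      by (simp add: algebra_simps sin_add sin_diff)
    moreover have "cos t \<ge> 0" using t by (intro cos_ge_zero) auto
    moreover have "sin (real n * t) > 0"
    proof (rule sin_gt_zero)
      show "real n * t < pi" using that m by (simp add: t_def field_simps)
    qed (use n t in simp)
    ultimately have "(2 * cos t + 2) * sin (real n * t) = 0" "(2 * cos t + 2) * sin (real n * t) > 0"
      using sum by simp_all
    then show False by linarith
  qed
  with m show ?thesis by (meson not_less)
qed

section \<open>Rank two cosets\<close>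

text \<open>Minimality is tested against words over \<open>J\<close> only; the comparison with the
  length in the whole group comes from \<open>len_coset\<close>.\<close>

definition redw :: "'i set \<Rightarrow> 'i list \<Rightarrow> bool" where
  "redw J v \<longleftrightarrow> set v \<subseteq> J \<and> (\<forall>v'. set v' \<subseteq> J \<longrightarrow> ev v' = ev v \<longrightarrow> length v \<le> length v')"

lemma redw_min: "redw J v \<Longrightarrow> set v' \<subseteq> J \<Longrightarrow> ev v' = ev v \<Longrightarrow> length v \<le> length v'"
  by (simp add: redw_def)

lemma redw_exists:
  assumes "set v \<subseteq> J"
  obtains v' where "redw J v'" "ev v' = ev v" "length v' \<le> length v"
proof -
  let ?P = "\<lambda>v'. set v' \<subseteq> J \<and> ev v' = ev v"
  define v' where "v' = arg_min length ?P"
  have "?P v'" "\<And>x. ?P x \<Longrightarrow> length v' \<le> length x"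
    using arg_min_nat_lemma[of ?P v length] assms unfolding v'_def by blast+
  then show thesis using that[of v'] assms unfolding redw_def by auto
qed

lemma redw_factor:
  assumes "redw J (a @ b @ c)" "J \<subseteq> I"
  shows "redw J b"
  unfolding redw_def
proof safe
  fix x assume "x \<in> set b" then show "x \<in> J" using assms by (auto simp: redw_def)
next
  fix v' assume v': "set v' \<subseteq> J" "ev v' = ev b"
  have J: "set a \<subseteq> J" "set b \<subseteq> J" "set c \<subseteq> J" using assms by (auto simp: redw_def)
  with v' assms(2) have I: "set a \<subseteq> I" "set b \<subseteq> I" "set c \<subseteq> I" "set v' \<subseteq> I" by auto
  then have "ev (a @ v' @ c) = ev (a @ b @ c)" using v' by (simp flip: W_mult)
  moreover have "set (a @ v' @ c) \<subseteq> J" using J v' by simp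
  ultimately have "length (a @ b @ c) \<le> length (a @ v' @ c)" using assms unfolding redw_def by blast
  then show "length b \<le> length v'" by simp
qed

lemma redw_no_repeat:
  assumes "redw J (a @ [x, x] @ b)" "J \<subseteq> I"
  shows False
proof -
  have r: "redw J [x, x]" using redw_factor assms by blast
  then have "x \<in> I" using assms(2) by (auto simp: redw_def)
  then have "ev [] = ev [x, x]" using ev_square[of x "[]"] by simp
  then show False using redw_min[OF r, of "[]"] by simp
qed

lemma alternating_eq_alt:
  assumes "set u \<subseteq> {i, k}" "\<And>a b x. u \<noteq> a @ [x, x] @ b" "u \<noteq> [] \<Longrightarrow> hd u = i"
  shows "u = alt (length u) i k"
  using assms
proof (induction u arbitrary: i k)
  case (Cons x u)
  have "u = alt (length u) k i"
  proof (rule Cons.IH)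
    fix a b y show "u \<noteq> a @ [y, y] @ b" using Cons.prems(2)[of "x # a"] by auto
  next
    assume "u \<noteq> []"
    then have "hd u \<in> {i, k}" "hd u \<noteq> x"
      using Cons.prems(1) Cons.prems(2)[of "[]" x "tl u"] by (cases u; auto)+
    then show "hd u = k" using Cons.prems(3) by auto
  qed (use Cons.prems(1) in auto)
  then show ?case using Cons.prems(3) by simp
qed simp

lemma redw_alt:
  assumes "redw {i, k} u" "{i, k} \<subseteq> I" "u = [] \<or> hd u = i"
  shows "u = alt (length u) i k"
proof (rule alternating_eq_alt)
  show "set u \<subseteq> {i, k}" using assms(1) by (simp add: redw_def)
  show "u \<noteq> a @ [x, x] @ b" for a b x using redw_no_repeat assms(1,2) by blast
  show "hd u = i" if "u \<noteq> []" using that assms(3) by blast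
qed

text \<open>A longer reduced word would begin with an alternating word of length m + 1. The relator
  of length 2 m continues that word by only m - 1 letters, whose reversal is a shorter word for the
  same element.\<close>

lemma redw_length:
  assumes "redw {i, k} u" "i \<in> I" "k \<in> I" "i \<noteq> k" "m i k \<noteq> 0"
  shows "length u \<le> m i k"
proof (rule ccontr)
  assume "\<not> length u \<le> m i k"
  obtain a b where ab: "{a, b} = {i, k}" "u = alt (length u) a b"
  proof (cases "u = [] \<or> hd u = i")
    case True
    then show thesis using that[of i k] redw_alt[of i k u] assms(1-3) by blast
  next
    case False
    then have "hd u \<in> {i, k}" using assms(1) hd_in_set[of u] unfolding redw_def by blast
    then have "hd u = k" using False by simp
    then have "u = alt (length u) k i"
      by (intro redw_alt) (use assms in \<open>simp_all add: insert_commute\<close>)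
    then show thesis by (rule that[OF insert_commute])
  qed
  define n where "n = m a b"
  have n: "n = m i k" using ab(1) assms m_sym unfolding n_def by (auto simp: doubleton_eq_iff)
  have I: "a \<in> I" "b \<in> I" using ab(1) assms by (auto simp: doubleton_eq_iff)
  obtain l where l: "length u = Suc n + l"
    using \<open>\<not> length u \<le> m i k\<close> n by (metis add_Suc less_imp_Suc_add not_less)
  have "redw {i, k} ([] @ alt (Suc n) a b @ (if even (Suc n) then alt l a b else alt l b a))"
    using assms(1) ab(2) alt_add[of "Suc n" l a b] l by (simp only: append_Nil)
  then have red: "redw {i, k} (alt (Suc n) a b)" using redw_factor assms by blast
  obtain r where r: "alt (2 * n) a b = alt (Suc n) a b @ r" "length r = n - 1" "set r \<subseteq> {i, k}"
  proof
    define r where "r = (if even (Suc n) then alt (n - 1) a b else alt (n - 1) b a)"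
    have "2 * n = Suc n + (n - 1)" using n assms(5) by simp
    then show "alt (2 * n) a b = alt (Suc n) a b @ r" unfolding r_def by (metis alt_add)
    show "length r = n - 1" "set r \<subseteq> {i, k}"
      using set_alt[of "n - 1" a b] set_alt[of "n - 1" b a] ab(1) by (auto simp: r_def)
  qed
  have rI: "set r \<subseteq> I" using r(3) assms by auto
  have aI: "set (alt (Suc n) a b) \<subseteq> I" by (rule set_alt_subset[OF I])
  have "ev (alt (Suc n) a b) \<star> ev r = \<one>\<^bsub>W\<^esub>"
    using ev_alt_rel[of a b "[]"] I rI aI r(1) n_def by (simp add: W_mult W_one del: alt.simps)
  then have "ev (alt (Suc n) a b) = ev (rev r)"
    using W.inv_equality[of "ev (alt (Suc n) a b)" "ev r"] rI aI inv_ev[of r]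
    by (simp del: alt.simps)
  then have "length (alt (Suc n) a b) \<le> length (rev r)"
    using r(3) by (intro redw_min[OF red]) simp_all
  then show False using r(2) by simp
qed


lemma redw_cong:
  assumes "redw J v" "ev v = ev v'" "set v' \<subseteq> J" "length v' \<le> length v"
  shows "redw J v'"
  unfolding redw_def using assms(3,4) redw_min[OF assms(1)] assms(2) by force

text \<open>Lengths add along a coset whose shortest element is \<open>u\<close>. If the next letter
  decreased the length, exchange would delete a letter either from a reduced word of
  \<open>u\<close>, giving a shorter element of the coset, or from \<open>v\<close>, contradicting
  that the extended word is reduced.\<close>

lemma len_coset:
  assumes J: "J \<subseteq> I" and u: "u \<in> carrier W"
    and min: "\<And>z. set z \<subseteq> J \<Longrightarrow> len u \<le> len (u \<star> ev z)"
  shows "redw J v \<Longrightarrow> len (u \<star> ev v) = len u + length v"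
proof (induction v rule: rev_induct)
  case Nil
  then show ?case using u by (simp flip: W_one)
next
  case (snoc x v)
  have red: "redw J v" using redw_factor[of J "[]" v "[x]"] snoc.prems J by simp
  have vx: "set v \<subseteq> J" "x \<in> J" using snoc.prems by (auto simp: redw_def)
  then have I: "set v \<subseteq> I" "x \<in> I" using J by auto
  have uvx: "u \<star> ev (v @ [x]) = u \<star> ev v \<star> gen x"
    using I u by (simp add: W.m_assoc ev_mult_gen)
  obtain a where a: "set a \<subseteq> I" "ev a = u" "length a = len u" using reduced_word u by blast
  have "\<not> flip (u \<star> ev v) (gen x)"
  proof
    assume "flip (u \<star> ev v) (gen x)"
    then have "flips (a @ v) (gen x)"
      using a(1) I flip_ev[of "a @ v" "gen x"] by (simp flip: W_mult a(2))
    then consider "flips a (conj (ev v) (gen x))" | "flips v (gen x)"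
      using flips_append a I by auto
    then show False
    proof cases
      \<comment> \<open>Deleting a letter from the word of \<open>u\<close> amounts to multiplying
        by the reflection v x v^-1, which stays in the coset of \<open>u\<close>.\<close>
      case 1
      then obtain p y q where "a = p @ [y] @ q" "ev a \<star> conj (ev v) (gen x) = ev (p @ q)"
        using flips_delete[of a "conj (ev v) (gen x)"] a I by (metis conj_closed ev_in_W gen_closed)
      moreover have "conj (ev v) (gen x) = ev (v @ [x] @ rev v)" using ev_conj I by blast
      ultimately have "len (u \<star> ev (v @ [x] @ rev v)) < len u"
        using len_le[of "p @ q"] a by simp
      then show False using min[of "v @ [x] @ rev v"] vx by simp
    next
      case 2
      then obtain p y q where pq: "v = p @ [y] @ q" "ev v \<star> gen x = ev (p @ q)"
        using flips_delete[of v "gen x"] I by (metis gen_closed)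
      then have "ev (p @ q) = ev (v @ [x])" using I by (simp add: ev_mult_gen)
      then show False using redw_min[OF snoc.prems, of "p @ q"] pq vx by simp
    qed
  qed
  then have "len (u \<star> ev v) < len (u \<star> ev v \<star> gen x)"
    using len_flip_iff(2) I u by simp
  then show ?case
    using snoc.IH[OF red] len_gen_le(1)[of "u \<star> ev v" x] I u uvx by simp
qed

lemma gen_inj: "i \<in> I \<Longrightarrow> j \<in> I \<Longrightarrow> gen i = gen j \<Longrightarrow> i = j"
  using alt_neq[of i j 1] m_ge_2[of i j] by (fastforce simp: cox_gen_def)

text \<open>Deodhar's theorem: an element mapping one simple root to another is a product of longest-element
  moves in rank two parabolic subgroups.\<close>

theorem simple_transport:
  assumes "w \<in> carrier W" "i \<in> I" "j \<in> I" "conj w (gen i) = gen j" "\<not> flip w (gen i)"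
    and base: "\<And>i. i \<in> I \<Longrightarrow> P \<one>\<^bsub>W\<^esub> i i"
    and comp: "\<And>u v i a j. u \<in> carrier W \<Longrightarrow> v \<in> carrier W \<Longrightarrow> i \<in> I \<Longrightarrow> a \<in> I \<Longrightarrow> j \<in> I \<Longrightarrow>
      P u a j \<Longrightarrow> P v i a \<Longrightarrow> P (u \<star> v) i j"
    and braid: "\<And>a b. a \<in> I \<Longrightarrow> b \<in> I \<Longrightarrow> a \<noteq> b \<Longrightarrow> m a b \<noteq> 0 \<Longrightarrow>
      P (ev (alt (m a b - 1) b a)) (if even (m a b) then a else b) a"
  shows "P w i j"
  using assms(1-5)
proof (induction "len w" arbitrary: w i j rule: less_induct)
  case less
  note w = less.prems(1) and i = less.prems(2) and j = less.prems(3)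
  obtain x where x: "set x \<subseteq> I" "ev x = w" "length x = len w" using reduced_word w by blast
  show ?case
  proof (cases x rule: rev_cases)
    case Nil
    then have "w = \<one>\<^bsub>W\<^esub>" using x W_one by simp
    moreover have "i = j" using less.prems calculation gen_inj[OF i j] by simp
    ultimately show ?thesis using base[OF j] by simp
  next
    \<comment> \<open>The last letter \<open>k\<close> is a right descent of \<open>w\<close>,
      whereas \<open>i\<close> is not, since \<open>w\<close> keeps its root positive. Hence i and k
      differ, and they span the rank two subgroup to be split off.\<close>
    case (snoc x' k)
    have k: "k \<in> I" "set x' \<subseteq> I" using x snoc by auto
    have "w = ev x' \<star> gen k" using x snoc k by (simp add: ev_mult_gen)
    then have "w \<star> gen k = ev x'" using k by (simp add: W.m_assoc)
    then have wk: "len (w \<star> gen k) < len w"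
      using len_le[OF k(2)] x snoc by simp
    have wi: "len w < len (w \<star> gen i)" using less.prems len_flip_iff(2) by simp
    then have ik: "i \<noteq> k" using wk by auto
    let ?J = "{i, k}"
    have J: "?J \<subseteq> I" using i k by simp
    \<comment> \<open>\<open>z\<close> leads from \<open>w\<close> to the shortest element
      \<open>u\<close> of its coset modulo the subgroup generated by \<open>i\<close> and
      \<open>k\<close>.\<close>
    let ?z = "arg_min (\<lambda>z. len (w \<star> ev z)) (\<lambda>z. set z \<subseteq> ?J)"
    define z where "z = ?z"
    have z: "set z \<subseteq> ?J" "\<And>z'. set z' \<subseteq> ?J \<Longrightarrow> len (w \<star> ev z) \<le> len (w \<star> ev z')"
      using arg_min_nat_lemma[of "\<lambda>z. set z \<subseteq> ?J" "[]" "\<lambda>z. len (w \<star> ev z)"] unfolding z_def by auto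
    have JI: "set y \<subseteq> I" if "set y \<subseteq> ?J" for y using that J by blast
    define u where "u = w \<star> ev z"
    have u: "u \<in> carrier W" using w JI z(1) by (simp add: u_def)
    have L: "len (u \<star> ev v) = len u + length v" if "redw ?J v" for v
    proof (rule len_coset[OF J u _ that])
      fix y assume y: "set y \<subseteq> ?J"
      then have "u \<star> ev y = w \<star> ev (z @ y)"
        using w JI z(1) by (simp add: u_def W.m_assoc W_mult)
      then show "len u \<le> len (u \<star> ev y)" using z(1) z(2)[of "z @ y"] y by (simp add: u_def)
    qed
    have R: "redw ?J v" if v: "set v \<subseteq> ?J" "len u + length v \<le> len (u \<star> ev v)" for v
    proof -
      obtain v0 where v0: "redw ?J v0" "ev v0 = ev v" using redw_exists v by metis
      then have "length v \<le> length v0" using L[OF v0(1)] v by simp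
      then show ?thesis using redw_cong v0 v(1) by blast
    qed
    obtain v1 where v1: "redw ?J v1" "ev v1 = ev (rev z @ [k])"
    proof (rule redw_exists[of "rev z @ [k]" ?J])
      show "set (rev z @ [k]) \<subseteq> ?J" using z(1) by simp
    qed
    \<comment> \<open>A word for u^-1 w that ends in \<open>k\<close>. It is not empty, so
      \<open>u\<close> is strictly shorter than \<open>w\<close> and the induction can be applied to
      it.\<close>
    define v where "v = v1 @ [k]"
    have v: "set v \<subseteq> ?J" using v1 by (auto simp: redw_def v_def)
    have "ev v = ev (rev z @ [k]) \<star> gen k"
      using v1(1) JI[of v1] k by (simp add: v_def redw_def flip: v1(2) ev_mult_gen)
    also have "\<dots> = ev (rev z)" using k JI[OF z(1)] by (simp add: W.m_assoc flip: ev_mult_gen)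
    finally have uv: "u \<star> ev v = w"
      using w JI[OF z(1)] by (simp add: u_def W.m_assoc flip: inv_ev)
    have "u \<star> ev v1 = w \<star> gen k"
      using v1 JI[OF z(1)] w k by (simp add: u_def W.m_assoc flip: inv_ev ev_mult_gen)
    then have "len (w \<star> gen k) = len u + length v1" using L[OF v1(1)] by simp
    then have "redw ?J v" using R[OF v] wk uv by (simp add: v_def)
    then have lw: "len w = len u + length v" using L uv by auto
    have "u \<star> ev (v @ [i]) = w \<star> gen i"
      using u JI[OF v] i by (simp add: W.m_assoc flip: ev_mult_gen uv)
    then have vi: "redw ?J (v @ [i])" using R[of "v @ [i]"] v wi lw by simp
    define t where "t = conj (ev v) (gen i)"
    have t: "t = ev (v @ [i] @ rev v)" "t \<in> carrier W" using ev_conj JI[OF v] i by (simp_all add: t_def)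
    have "conj u t = gen j"
      using less.prems uv u JI[OF v] i conj_mult[of u "ev v" "gen i"] by (simp add: t_def)
    then have ut: "u \<star> t = gen j \<star> u" using conj_mult_eq[OF u t(2)] by simp
    obtain tw where tw: "redw ?J tw" "ev tw = t"
    proof (rule redw_exists[of "v @ [i] @ rev v" ?J])
      show "set (v @ [i] @ rev v) \<subseteq> ?J" using v by simp
    qed (use t in auto)
    \<comment> \<open>By additivity u t has length \<open>len u + length tw\<close>, but u t = s_j u
      is at most one longer than u. So \<open>t\<close> is a simple reflection of the rank two
      subgroup.\<close>
    have "length tw \<le> 1" using L[OF tw(1)] tw(2) ut len_gen_le(2)[OF u j] by simp
    moreover have "tw \<noteq> []"
    proof
      assume "tw = []"
      then have "t = \<one>\<^bsub>W\<^esub>" using tw W_one by simp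
      then have "gen i = conj (inv\<^bsub>W\<^esub> ev v) \<one>\<^bsub>W\<^esub>"
        using conj_eq_iff[of "ev v" "gen i" t] JI[OF v] i t_def by simp
      then show False using gen_neq_one[OF i] JI[OF v] by (simp add: conj_def)
    qed
    ultimately obtain y where y: "tw = [y]" by (cases tw) auto
    then have yJ: "y \<in> ?J" using tw by (auto simp: redw_def)
    then have yI: "y \<in> I" using J by blast
    have ty: "t = gen y" using tw y by (simp add: cox_gen_def)
    have yv: "ev (y # v) = ev (v @ [i])"
      using conj_mult_eq[of "ev v" "gen i"] JI[OF v] i yI ty
      by (simp add: t_def gen_mult_ev ev_mult_gen)
    have yv': "redw ?J (y # v)" by (rule redw_cong[OF vi]) (use yv v yJ in auto)
    obtain y2 where y2: "?J = {y, y2}" "y \<noteq> y2" using yJ ik by auto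
    then have y2I: "y2 \<in> I" using J by auto
    define n where "n = Suc (length v)"
    have "y # v = alt (length (y # v)) y y2"
      by (rule redw_alt) (use yv' y2 J in auto)
    then have a1: "y # v = alt n y y2" by (simp only: n_def length_Cons)
    then have a2: "v = alt (n - 1) y2 y" by (simp add: n_def)
    have "n - 1 \<noteq> 0" by (simp add: n_def v_def)
    then have "hd v = y2" using a2 by (cases "n - 1") auto
    then have "hd ((v1 @ [k]) @ [i]) = y2" by (subst hd_append2) (simp_all add: v_def)
    then have "hd (v @ [i]) = y2" by (simp only: v_def)
    then have "v @ [i] = alt (length (v @ [i])) y2 y"
      by (intro redw_alt) (use vi y2 J v_def in \<open>auto simp: insert_commute\<close>)
    then have a3: "v @ [i] = alt n y2 y" by (simp add: n_def)
    \<comment> \<open>\<open>y # v\<close> and \<open>v @ [i]\<close> are alternating words of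
      length n for the same element with different first letters: \<open>alt_neq\<close> bounds m
      above by n, \<open>redw_length\<close> bounds n above by m. So \<open>v\<close> is exactly the
      word in the \<open>braid\<close> hypothesis.\<close>
    have "m y y2 \<noteq> 0 \<and> m y y2 \<le> n"
      by (rule alt_neq) (use yv a1 a3 yI y2I y2 n_def in \<open>simp_all del: alt.simps\<close>)
    moreover have "length (y # v) \<le> m y y2"
      by (rule redw_length) (use yv' calculation yI y2I y2 in \<open>simp_all del: alt.simps\<close>)
    ultimately have mn: "m y y2 = n" "m y y2 \<noteq> 0" by (simp_all add: n_def)
    have "v @ [i] = v @ [if even (n - 1) then y2 else y]"
      using a2 a3 alt_snoc[of "n - 1" y2 y] by (simp add: n_def del: alt.simps)
    then have "i = (if even n then y else y2)" by (simp add: n_def split: if_splits)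
    then have "P (ev v) i y" using braid[OF yI y2I y2(2) mn(2)] a2 mn by simp
    moreover have "P u y j"
    proof (rule less.hyps)
      show "len u < len w" using lw by (simp add: v_def)
      show "conj u (gen y) = gen j" using \<open>conj u t = gen j\<close> ty by simp
      show "\<not> flip u (gen y)" using L[OF tw(1)] tw(2) y ty len_flip_iff(2)[OF u, of "gen y"] yI by simp
    qed (use u yI j in simp_all)
    ultimately show ?thesis using comp[of u "ev v" i y j] u JI[OF v] i yI j uv by simp
  qed
qed

end

section \<open>Rings, quotients and free algebras\<close>

context ring begin

lemma ideal_intro:
  assumes "S \<subseteq> carrier R" "\<zero> \<in> S" "\<And>a b. a \<in> S \<Longrightarrow> b \<in> S \<Longrightarrow> a \<oplus> b \<in> S"
    and "\<And>a. a \<in> S \<Longrightarrow> \<ominus> a \<in> S"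
    and "\<And>a x. a \<in> S \<Longrightarrow> x \<in> carrier R \<Longrightarrow> x \<otimes> a \<in> S"
    and "\<And>a x. a \<in> S \<Longrightarrow> x \<in> carrier R \<Longrightarrow> a \<otimes> x \<in> S"
  shows "ideal S R"
  by (intro idealI add.subgroupI ring_axioms) (use assms in \<open>auto simp: a_inv_def[symmetric]\<close>)

lemma additive_map:
  assumes "f \<in> carrier R \<rightarrow> carrier R"
    and "\<And>x y. x \<in> carrier R \<Longrightarrow> y \<in> carrier R \<Longrightarrow> f (x \<oplus> y) = f x \<oplus> f y"
  shows "f \<zero> = \<zero>" "x \<in> carrier R \<Longrightarrow> f (\<ominus> x) = \<ominus> f x"
proof -
  have c: "f x \<in> carrier R" if "x \<in> carrier R" for x using assms(1) that by auto
  have "f \<zero> \<oplus> f \<zero> = f \<zero>" using assms(2)[of \<zero> \<zero>] by simp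
  then show 0: "f \<zero> = \<zero>" using add.l_cancel_one[of "f \<zero>" "f \<zero>"] c[of \<zero>] by blast
  assume x: "x \<in> carrier R"
  have "f (\<ominus> x) \<oplus> f x = \<zero>" using assms(2)[OF a_inv_closed[OF x] x] l_neg[OF x] 0 by simp
  then show "f (\<ominus> x) = \<ominus> f x" using minus_equality[of "f (\<ominus> x)" "f x"] c x by simp
qed

end

text \<open>An involution that maps the ideal into itself maps it onto itself. Direct image
  therefore sends cosets to cosets, and the induced map on the quotient needs no choice of
  representatives.\<close>

lemma (in ideal) image_coset:
  assumes f: "f \<in> carrier R \<rightarrow> carrier R"
    and add: "\<And>x y. x \<in> carrier R \<Longrightarrow> y \<in> carrier R \<Longrightarrow> f (x \<oplus> y) = f x \<oplus> f y"
    and inv: "\<And>x. x \<in> carrier R \<Longrightarrow> f (f x) = x"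
    and I: "f ` I \<subseteq> I" and x: "x \<in> carrier R"
  shows "f ` (I +> x) = I +> f x"
proof -
  have "y \<in> f ` I" if "y \<in> I" for y
  proof (rule image_eqI)
    show "y = f (f y)" using inv a_subset that by auto
    show "f y \<in> I" using I that by blast
  qed
  then have "f ` I = I" using I by blast
  then have "(\<lambda>y. f y \<oplus> f x) ` I = (\<lambda>y. y \<oplus> f x) ` I"
    using image_image[of "\<lambda>y. y \<oplus> f x" f I] by simp
  moreover have "f ` (\<lambda>y. y \<oplus> x) ` I = (\<lambda>y. f y \<oplus> f x) ` I"
    unfolding image_image using add x a_subset by (intro image_cong) auto
  ultimately show ?thesis by (simp add: a_r_coset_def' UNION_singleton_eq_range)
qed

lemma (in ideal) quot_carrier: "carrier (R Quot I) = (\<lambda>x. I +> x) ` carrier R"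
  by (auto simp: FactRing_def A_RCOSETS_def')

lemma (in ideal) quot_ops:
  "x \<in> carrier R \<Longrightarrow> y \<in> carrier R \<Longrightarrow> (I +> x) \<otimes>\<^bsub>R Quot I\<^esub> (I +> y) = I +> (x \<otimes> y)"
  "x \<in> carrier R \<Longrightarrow> y \<in> carrier R \<Longrightarrow> (I +> x) \<oplus>\<^bsub>R Quot I\<^esub> (I +> y) = I +> (x \<oplus> y)"
  "\<one>\<^bsub>R Quot I\<^esub> = I +> \<one>" "\<zero>\<^bsub>R Quot I\<^esub> = I +> \<zero>"
  "x \<in> carrier R \<Longrightarrow> \<ominus>\<^bsub>R Quot I\<^esub> (I +> x) = I +> (\<ominus> x)"
  "x \<in> carrier R \<Longrightarrow> y \<in> carrier R \<Longrightarrow> (I +> x) \<ominus>\<^bsub>R Quot I\<^esub> (I +> y) = I +> (x \<ominus> y)"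
proof -
  interpret h: ring_hom_ring R "R Quot I" "(+>) I" by (rule rcos_ring_hom_ring)
  show "x \<in> carrier R \<Longrightarrow> y \<in> carrier R \<Longrightarrow> (I +> x) \<otimes>\<^bsub>R Quot I\<^esub> (I +> y) = I +> (x \<otimes> y)"
    "x \<in> carrier R \<Longrightarrow> y \<in> carrier R \<Longrightarrow> (I +> x) \<oplus>\<^bsub>R Quot I\<^esub> (I +> y) = I +> (x \<oplus> y)"
    "\<one>\<^bsub>R Quot I\<^esub> = I +> \<one>" "\<zero>\<^bsub>R Quot I\<^esub> = I +> \<zero>"
    "x \<in> carrier R \<Longrightarrow> \<ominus>\<^bsub>R Quot I\<^esub> (I +> x) = I +> (\<ominus> x)"
    "x \<in> carrier R \<Longrightarrow> y \<in> carrier R \<Longrightarrow> (I +> x) \<ominus>\<^bsub>R Quot I\<^esub> (I +> y) = I +> (x \<ominus> y)"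
    by (simp_all add: a_minus_def)
qed

lemma (in ideal) coset_eq_iff:
  assumes "x \<in> carrier R" "y \<in> carrier R"
  shows "I +> x = I +> y \<longleftrightarrow> x \<ominus> y \<in> I"
  using quotient_eq_iff_same_a_r_cos[OF ideal_axioms assms] by simp

lemma anti_involutionD:
  assumes "anti_involution R f"
  shows "x \<in> carrier R \<Longrightarrow> f x \<in> carrier R" "f \<one>\<^bsub>R\<^esub> = \<one>\<^bsub>R\<^esub>"
    "x \<in> carrier R \<Longrightarrow> y \<in> carrier R \<Longrightarrow> f (x \<oplus>\<^bsub>R\<^esub> y) = f x \<oplus>\<^bsub>R\<^esub> f y"
    "x \<in> carrier R \<Longrightarrow> y \<in> carrier R \<Longrightarrow> f (x \<otimes>\<^bsub>R\<^esub> y) = f y \<otimes>\<^bsub>R\<^esub> f x"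
    "x \<in> carrier R \<Longrightarrow> f (f x) = x"
  using assms unfolding anti_involution_def by auto

lemma ring_involutionD:
  assumes "ring_involution R f"
  shows "x \<in> carrier R \<Longrightarrow> f x \<in> carrier R" "f \<one>\<^bsub>R\<^esub> = \<one>\<^bsub>R\<^esub>"
    "x \<in> carrier R \<Longrightarrow> y \<in> carrier R \<Longrightarrow> f (x \<oplus>\<^bsub>R\<^esub> y) = f x \<oplus>\<^bsub>R\<^esub> f y"
    "x \<in> carrier R \<Longrightarrow> y \<in> carrier R \<Longrightarrow> f (x \<otimes>\<^bsub>R\<^esub> y) = f x \<otimes>\<^bsub>R\<^esub> f y"
    "x \<in> carrier R \<Longrightarrow> f (f x) = x"
  using assms unfolding ring_involution_def ring_iso_def by (auto simp: ring_hom_def)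

lemma ring_involutionI:
  assumes "\<And>x. x \<in> carrier R \<Longrightarrow> f x \<in> carrier R" "f \<one>\<^bsub>R\<^esub> = \<one>\<^bsub>R\<^esub>"
    "\<And>x y. x \<in> carrier R \<Longrightarrow> y \<in> carrier R \<Longrightarrow> f (x \<oplus>\<^bsub>R\<^esub> y) = f x \<oplus>\<^bsub>R\<^esub> f y"
    "\<And>x y. x \<in> carrier R \<Longrightarrow> y \<in> carrier R \<Longrightarrow> f (x \<otimes>\<^bsub>R\<^esub> y) = f x \<otimes>\<^bsub>R\<^esub> f y"
    "\<And>x. x \<in> carrier R \<Longrightarrow> f (f x) = x"
  shows "ring_involution R f"
proof -
  have "bij_betw f (carrier R) (carrier R)"
    by (rule bij_betw_byWitness[where f' = f]) (use assms in auto)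
  then show ?thesis using assms unfolding ring_involution_def ring_iso_def
    by (auto intro!: ring_hom_memI)
qed

lemma quot_anti_involution:
  assumes "ideal J R" "anti_involution R f" "f ` J \<subseteq> J"
  shows "anti_involution (R Quot J) ((`) f)"
    and "x \<in> carrier R \<Longrightarrow> f ` (J +>\<^bsub>R\<^esub> x) = J +>\<^bsub>R\<^esub> f x"
proof -
  interpret ideal J R by fact
  note f = anti_involutionD[OF assms(2)]
  have im: "f ` (J +>\<^bsub>R\<^esub> x) = J +>\<^bsub>R\<^esub> f x" if "x \<in> carrier R" for x
    by (rule image_coset) (use f assms that in auto)
  show "anti_involution (R Quot J) ((`) f)"
    unfolding anti_involution_def quot_carrier using f
    by (auto simp: quot_ops im)
  show "x \<in> carrier R \<Longrightarrow> f ` (J +>\<^bsub>R\<^esub> x) = J +>\<^bsub>R\<^esub> f x" by (rule im)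
qed

lemma quot_ring_involution:
  assumes "ideal J R" "ring_involution R f" "f ` J \<subseteq> J"
  shows "ring_involution (R Quot J) ((`) f)"
    and "x \<in> carrier R \<Longrightarrow> f ` (J +>\<^bsub>R\<^esub> x) = J +>\<^bsub>R\<^esub> f x"
proof -
  interpret ideal J R by fact
  note f = ring_involutionD[OF assms(2)]
  have im: "f ` (J +>\<^bsub>R\<^esub> x) = J +>\<^bsub>R\<^esub> f x" if "x \<in> carrier R" for x
    by (rule image_coset) (use f assms that in auto)
  show "ring_involution (R Quot J) ((`) f)"
    by (rule ring_involutionI; use f in \<open>clarsimp simp: quot_carrier quot_ops im\<close>)
  show "x \<in> carrier R \<Longrightarrow> f ` (J +>\<^bsub>R\<^esub> x) = J +>\<^bsub>R\<^esub> f x" by (rule im)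
qed

text \<open>The elements sent into the ideal form an ideal themselves, so generators suffice.
  Two-sidedness makes reversal of products harmless, which allows one statement for both kinds of
  symmetry.\<close>

lemma genideal_image:
  assumes "ring R" "S \<subseteq> carrier R" "f ` S \<subseteq> genideal R S"
    and "anti_involution R f \<or> ring_involution R f"
  shows "f ` genideal R S \<subseteq> genideal R S"
proof -
  interpret ring R by fact
  interpret J: ideal "genideal R S" R by (rule genideal_ideal[OF assms(2)])
  have f: "f \<in> carrier R \<rightarrow> carrier R"
    "\<And>x y. x \<in> carrier R \<Longrightarrow> y \<in> carrier R \<Longrightarrow> f (x \<oplus>\<^bsub>R\<^esub> y) = f x \<oplus>\<^bsub>R\<^esub> f y"
    using assms(4) anti_involutionD(1,3)[of R f] ring_involutionD(1,3)[of R f] by auto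
  note z = additive_map[OF f]
  have m: "f (x \<otimes>\<^bsub>R\<^esub> y) = f y \<otimes>\<^bsub>R\<^esub> f x \<or> f (x \<otimes>\<^bsub>R\<^esub> y) = f x \<otimes>\<^bsub>R\<^esub> f y"
    if "x \<in> carrier R" "y \<in> carrier R" for x y
    using assms(4) anti_involutionD(4)[OF _ that] ring_involutionD(4)[OF _ that] by blast
  have "ideal {x \<in> carrier R. f x \<in> genideal R S} R"
  proof (rule ideal_intro)
    fix a x assume a: "a \<in> {x \<in> carrier R. f x \<in> genideal R S}" and x: "x \<in> carrier R"
    then have "f a \<in> genideal R S" "f x \<in> carrier R" using f(1) by auto
    then have "f a \<otimes>\<^bsub>R\<^esub> f x \<in> genideal R S" "f x \<otimes>\<^bsub>R\<^esub> f a \<in> genideal R S"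
      using J.I_l_closed J.I_r_closed by auto
    then show "x \<otimes>\<^bsub>R\<^esub> a \<in> {x \<in> carrier R. f x \<in> genideal R S}"
      "a \<otimes>\<^bsub>R\<^esub> x \<in> {x \<in> carrier R. f x \<in> genideal R S}"
      using m[of a x] m[of x a] a x by auto
  qed (use f z in auto)
  moreover have "S \<subseteq> {x \<in> carrier R. f x \<in> genideal R S}" using assms by auto
  ultimately have "genideal R S \<subseteq> {x \<in> carrier R. f x \<in> genideal R S}" by (rule genideal_minimal)
  then show ?thesis by auto
qed

subsection \<open>Free algebras\<close>

lemma free_algebra_simps [simp]:
  "p \<in> carrier (free_algebra G) \<longleftrightarrow> (\<forall>w\<in>Poly_Mapping.keys p. set (letters w) \<subseteq> G)"
  "x \<otimes>\<^bsub>free_algebra G\<^esub> y = x * y" "x \<oplus>\<^bsub>free_algebra G\<^esub> y = x + y"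
  "\<one>\<^bsub>free_algebra G\<^esub> = 1" "\<zero>\<^bsub>free_algebra G\<^esub> = 0"
  by (simp_all add: free_algebra_def)

text \<open>Monomials are the basis elements of a free abelian group, which gives access to linear
  extension (\<open>frag_extend\<close>) and induction (\<open>frag_induction\<close>).\<close>

lemma mon_frag: "mon xs = frag_of (Word xs)"
  by (simp add: mon_def)

lemma mon_Nil: "mon [] = 1"
  by (simp add: mon_def flip: single_one zero_fword_def)

lemma mon_mult: "mon xs * mon ys = mon (xs @ ys)"
  by (simp add: mon_def mult_single plus_fword_def)

lemma frag_of_Word: "frag_of w = mon (letters w)"
  by (simp add: mon_frag)

lemma mon_in_carrier [simp]: "mon xs \<in> carrier (free_algebra G) \<longleftrightarrow> set xs \<subseteq> G"
  by (simp add: mon_frag)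

lemma ring_free_algebra: "ring (free_algebra G)"
proof (rule ringI)
  show "abelian_group (free_algebra G)"
  proof (rule abelian_groupI)
    fix x assume "x \<in> carrier (free_algebra G)"
    then show "\<exists>y\<in>carrier (free_algebra G). y \<oplus>\<^bsub>free_algebra G\<^esub> x = \<zero>\<^bsub>free_algebra G\<^esub>"
      by (intro bexI[of _ "- x"]) auto
  qed (use Poly_Mapping.keys_add in \<open>auto simp: add_ac dest!: subsetD[OF Poly_Mapping.keys_add]\<close>)
  show "Group.monoid (free_algebra G)"
    by (rule Group.monoidI)
      (fastforce simp: mult.assoc plus_fword_def zero_fword_def dest!: subsetD[OF keys_mult])+
qed (auto simp: algebra_simps)

lemma free_algebra_uminus:
  assumes "x \<in> carrier (free_algebra G)" shows "\<ominus>\<^bsub>free_algebra G\<^esub> x = - x"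
proof -
  interpret ring "free_algebra G" by (rule ring_free_algebra)
  show ?thesis by (rule minus_equality) (use assms in auto)
qed

lemma free_algebra_minus:
  assumes "x \<in> carrier (free_algebra G)" "y \<in> carrier (free_algebra G)"
  shows "x \<ominus>\<^bsub>free_algebra G\<^esub> y = x - y"
  using assms free_algebra_uminus[OF assms(2)] by (simp add: a_minus_def)

lemma free_algebra_induct [consumes 1, case_names zero mon diff]:
  assumes "p \<in> carrier (free_algebra G)" "P 0" "\<And>xs. set xs \<subseteq> G \<Longrightarrow> P (mon xs)"
    and "\<And>p q. P p \<Longrightarrow> P q \<Longrightarrow> P (p - q)"
  shows "P p"
  by (rule frag_induction[where S = "{w. set (letters w) \<subseteq> G}"])
    (use assms in \<open>auto simp: frag_of_Word\<close>)

definition alg_ext :: "('a \<Rightarrow> 'b falg) \<Rightarrow> 'a falg \<Rightarrow> 'b falg" where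
  "alg_ext h = frag_extend (\<lambda>w. prod_list (map h (letters w)))"

lemma alg_ext_mon: "alg_ext h (mon xs) = prod_list (map h xs)"
  and alg_ext_add: "alg_ext h (p + q) = alg_ext h p + alg_ext h q"
  and alg_ext_diff: "alg_ext h (p - q) = alg_ext h p - alg_ext h q"
  and alg_ext_zero: "alg_ext h 0 = 0"
  by (simp_all add: alg_ext_def mon_frag frag_extend_add frag_extend_diff)

lemma alg_ext_one: "alg_ext h 1 = 1"
  using alg_ext_mon[of h "[]"] by (simp add: mon_Nil)

lemma falg_induct [case_names zero mon diff]:
  assumes "P 0" "\<And>xs. P (mon xs)" "\<And>p q. P p \<Longrightarrow> P q \<Longrightarrow> P (p - q)"
  shows "P p"
  by (rule free_algebra_induct[of p UNIV]) (use assms in auto)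

lemma alg_ext_mult: "alg_ext h (p * q) = alg_ext h p * alg_ext h q"
proof (induction p rule: falg_induct)
  case (mon xs)
  show ?case
    by (induction q rule: falg_induct)
      (simp_all add: alg_ext_zero alg_ext_mon alg_ext_diff mon_mult right_diff_distrib)
qed (simp_all add: alg_ext_zero alg_ext_diff left_diff_distrib)

lemma alg_ext_closed:
  assumes "p \<in> carrier (free_algebra G)" "\<And>g. g \<in> G \<Longrightarrow> h g \<in> carrier (free_algebra G')"
  shows "alg_ext h p \<in> carrier (free_algebra G')"
proof -
  interpret ring "free_algebra G'" by (rule ring_free_algebra)
  show ?thesis using assms(1)
  proof (induction p rule: free_algebra_induct)
    case (mon xs)
    then show ?case unfolding alg_ext_mon
    proof (induction xs)
      case Nil
      show ?case using one_closed by (simp del: one_closed)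
    next
      case (Cons a xs)
      then show ?case using assms(2)[of a] m_closed[of "h a" "prod_list (map h xs)"]
        by (simp del: m_closed)
    qed
  next
    case (diff p q)
    then show ?case unfolding alg_ext_diff
      using minus_closed[of "alg_ext h p" "alg_ext h q"] free_algebra_minus by metis
  qed (simp add: alg_ext_zero)
qed

declare free_algebra_simps(1) [simp del]

lemma free_algebra_closed [simp]:
  fixes p q :: "'a falg"
  shows "0 \<in> carrier (free_algebra G)" "1 \<in> carrier (free_algebra G)"
    and "p \<in> carrier (free_algebra G) \<Longrightarrow> - p \<in> carrier (free_algebra G)"
    and "p \<in> carrier (free_algebra G) \<Longrightarrow> q \<in> carrier (free_algebra G) \<Longrightarrow> p + q \<in> carrier (free_algebra G)"
    and "p \<in> carrier (free_algebra G) \<Longrightarrow> q \<in> carrier (free_algebra G) \<Longrightarrow> p - q \<in> carrier (free_algebra G)"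
    and "p \<in> carrier (free_algebra G) \<Longrightarrow> q \<in> carrier (free_algebra G) \<Longrightarrow> p * q \<in> carrier (free_algebra G)"
proof -
  interpret ring "free_algebra G" by (rule ring_free_algebra)
  show "0 \<in> carrier (free_algebra G)" "1 \<in> carrier (free_algebra G)"
    using zero_closed one_closed by simp_all
  show m: "- p \<in> carrier (free_algebra G)" if "p \<in> carrier (free_algebra G)" for p
    using a_inv_closed[OF that] free_algebra_uminus[OF that] by simp
  show a: "p + q \<in> carrier (free_algebra G)"
    if "p \<in> carrier (free_algebra G)" "q \<in> carrier (free_algebra G)" for p q
    using a_closed[OF that] by simp
  show "p - q \<in> carrier (free_algebra G)"
    if "p \<in> carrier (free_algebra G)" "q \<in> carrier (free_algebra G)" for p q
    using a[OF that(1) m[OF that(2)]] by simp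
  show "p * q \<in> carrier (free_algebra G)"
    if "p \<in> carrier (free_algebra G)" "q \<in> carrier (free_algebra G)" for p q
    using m_closed[OF that] by simp
qed

section \<open>The Hecke-Hopf algebra and its reflection elements\<close>

context coxeter begin

abbreviation F where "F \<equiv> HF I"
abbreviation R where "R \<equiv> Hhat I m"
abbreviation Rmult (infixl \<open>\<bullet>\<close> 70) where "x \<bullet> y \<equiv> x \<otimes>\<^bsub>R\<^esub> y"
abbreviation Rplus (infixl \<open>\<^bold>+\<close> 65) where "x \<^bold>+ y \<equiv> x \<oplus>\<^bsub>R\<^esub> y"
abbreviation Rminus (infixl \<open>\<^bold>-\<close> 65) where "x \<^bold>- y \<equiv> x \<ominus>\<^bsub>R\<^esub> y"
abbreviation Ruminus (\<open>\<^bold>- _\<close> [81] 80) where "\<^bold>- x \<equiv> \<ominus>\<^bsub>R\<^esub> x"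
abbreviation Rzero (\<open>\<^bold>0\<close>) where "\<^bold>0 \<equiv> \<zero>\<^bsub>R\<^esub>"
abbreviation Rone (\<open>\<^bold>1\<close>) where "\<^bold>1 \<equiv> \<one>\<^bsub>R\<^esub>"
abbreviation J0 where "J0 \<equiv> hecke_hopf_ideal I m"
abbreviation hm where "hm \<equiv> Hmon I m"
abbreviation wh where "wh \<equiv> W_hat I m"
abbreviation sh where "sh \<equiv> s_hat I m"
abbreviation dh where "dh \<equiv> D_hat I m"
abbreviation hc where "hc p \<equiv> J0 +>\<^bsub>F\<^esub> p"

lemma set_SG_DG: "set (map SG u) \<subseteq> SG ` I \<union> DG ` I \<longleftrightarrow> set u \<subseteq> I"
  by auto

lemma F_ops [simp]:
  "x \<otimes>\<^bsub>F\<^esub> y = x * y" "x \<oplus>\<^bsub>F\<^esub> y = x + y" "\<one>\<^bsub>F\<^esub> = 1" "\<zero>\<^bsub>F\<^esub> = 0"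
  by (simp_all add: HF_def)

lemma F_closed [simp]:
  "0 \<in> carrier F" "1 \<in> carrier F"
  "p \<in> carrier F \<Longrightarrow> - p \<in> carrier F"
  "p \<in> carrier F \<Longrightarrow> q \<in> carrier F \<Longrightarrow> p + q \<in> carrier F"
  "p \<in> carrier F \<Longrightarrow> q \<in> carrier F \<Longrightarrow> p - q \<in> carrier F"
  "p \<in> carrier F \<Longrightarrow> q \<in> carrier F \<Longrightarrow> p * q \<in> carrier F"
  "mon xs \<in> carrier F \<longleftrightarrow> set xs \<subseteq> SG ` I \<union> DG ` I"
  by (simp_all add: HF_def)

lemma F_minus:
  "p \<in> carrier F \<Longrightarrow> \<ominus>\<^bsub>F\<^esub> p = - p"
  "p \<in> carrier F \<Longrightarrow> q \<in> carrier F \<Longrightarrow> p \<ominus>\<^bsub>F\<^esub> q = p - q"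
  by (simp_all add: HF_def free_algebra_uminus free_algebra_minus)

sublocale F: ring F unfolding HF_def by (rule ring_free_algebra)

lemma concat_replicate_SG: "concat (replicate k [SG i, SG j]) = map SG (alt (2 * k) i j)"
  by (induction k) auto

lemma set_SG_alt: "i \<in> I \<Longrightarrow> j \<in> I \<Longrightarrow> set (map SG (alt k i j)) \<subseteq> SG ` I \<union> DG ` I"
  unfolding set_SG_DG by (rule set_alt_subset)

lemma relations_closed: "hecke_hopf_relations I m \<subseteq> carrier F"
  unfolding hecke_hopf_relations_def concat_replicate_SG
  using set_SG_alt by (auto simp del: set_map)

sublocale J0: ideal J0 F
  unfolding hecke_hopf_ideal_def by (rule F.genideal_ideal[OF relations_closed])

sublocale H: ring R
  unfolding Hhat_def by (rule J0.quotient_is_ring)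

lemma R_carrier: "carrier R = hc ` carrier F"
  unfolding Hhat_def by (rule J0.quot_carrier)

lemma hc_closed [simp]: "p \<in> carrier F \<Longrightarrow> hc p \<in> carrier R"
  by (simp add: R_carrier)

lemma hc_ops:
  "p \<in> carrier F \<Longrightarrow> q \<in> carrier F \<Longrightarrow> hc p \<bullet> hc q = hc (p * q)"
  "p \<in> carrier F \<Longrightarrow> q \<in> carrier F \<Longrightarrow> hc p \<^bold>+ hc q = hc (p + q)"
  "p \<in> carrier F \<Longrightarrow> q \<in> carrier F \<Longrightarrow> hc p \<^bold>- hc q = hc (p - q)"
  "p \<in> carrier F \<Longrightarrow> \<^bold>- hc p = hc (- p)"
  "\<^bold>1 = hc 1" "\<^bold>0 = hc 0"
  unfolding Hhat_def
  using J0.quot_ops(1,2,6)[of p q] J0.quot_ops(5)[of p] J0.quot_ops(3,4) F_minus(1)[of p] F_minus(2)[of p q]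
  by simp_all

lemma hc_eq_iff: "p \<in> carrier F \<Longrightarrow> q \<in> carrier F \<Longrightarrow> hc p = hc q \<longleftrightarrow> p - q \<in> J0"
  using J0.coset_eq_iff[of p q] F_minus(2)[of p q] by simp

lemma hc_relation:
  assumes "p \<in> carrier F" "q \<in> carrier F" "p - q \<in> hecke_hopf_relations I m"
  shows "hc p = hc q"
proof -
  have "p - q \<in> J0"
    using assms(3) F.genideal_self[OF relations_closed] unfolding hecke_hopf_ideal_def by blast
  then show ?thesis using hc_eq_iff[OF assms(1,2)] by blast
qed

lemma hm_closed [simp]: "set xs \<subseteq> SG ` I \<union> DG ` I \<Longrightarrow> hm xs \<in> carrier R"
  by (simp add: Hmon_def)

lemma hm_mult:
  "set xs \<subseteq> SG ` I \<union> DG ` I \<Longrightarrow> set ys \<subseteq> SG ` I \<union> DG ` I \<Longrightarrow> hm xs \<bullet> hm ys = hm (xs @ ys)"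
  by (simp add: Hmon_def hc_ops mon_mult)

lemma hm_Nil: "hm [] = \<^bold>1"
  by (simp add: Hmon_def hc_ops mon_Nil)

lemma sh_closed [simp]: "i \<in> I \<Longrightarrow> sh i \<in> carrier R"
  and dh_closed [simp]: "i \<in> I \<Longrightarrow> dh i \<in> carrier R"
  by (simp_all add: s_hat_def D_hat_def)

lemma sh_square:
  assumes "i \<in> I" shows "sh i \<bullet> sh i = \<^bold>1"
proof -
  have "hc (mon [SG i, SG i]) = hc 1"
    by (rule hc_relation) (use assms in \<open>auto simp: hecke_hopf_relations_def\<close>)
  then show ?thesis using assms by (simp add: s_hat_def hm_mult) (simp add: Hmon_def hc_ops)
qed

lemma dh_idem:
  assumes "i \<in> I" shows "dh i \<bullet> dh i = dh i"
proof -
  have "hc (mon [DG i, DG i]) = hc (mon [DG i])"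
    by (rule hc_relation) (use assms in \<open>auto simp: hecke_hopf_relations_def\<close>)
  then show ?thesis using assms by (simp add: D_hat_def hm_mult) (simp add: Hmon_def)
qed

lemma sh_dh:
  assumes "i \<in> I"
  shows "sh i \<bullet> dh i \<^bold>+ dh i \<bullet> sh i = sh i \<^bold>- \<^bold>1"
proof -
  have "hc (mon [SG i, DG i] + mon [DG i, SG i]) = hc (mon [SG i] - 1)"
    by (rule hc_relation) (use assms in \<open>auto simp: hecke_hopf_relations_def\<close>)
  then show ?thesis using assms by (simp add: s_hat_def D_hat_def Hmon_def hc_ops mon_mult)
qed

lemma dh_braid:
  assumes "i \<in> I" "j \<in> I" "i \<noteq> j" "m i j \<noteq> 0"
  shows "dh i \<bullet> hm (map SG (alt (m i j - 1) j i)) =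
    hm (map SG (alt (m i j - 1) j i)) \<bullet> dh (if even (m i j) then i else j)"
proof -
  let ?a = "map SG (alt (m i j - 1) j i)" and ?k = "if even (m i j) then i else j"
  have a: "set ?a \<subseteq> SG ` I \<union> DG ` I" by (rule set_SG_alt) (use assms in auto)
  have "mon (DG i # ?a) - mon (?a @ [DG ?k]) \<in> hecke_hopf_relations I m"
    unfolding hecke_hopf_relations_def using assms by blast
  then have "hc (mon (DG i # ?a)) = hc (mon (?a @ [DG ?k]))"
    by (intro hc_relation) (use assms a in \<open>auto simp del: set_map\<close>)
  moreover have "hm [DG i] \<bullet> hm ?a = hm (DG i # ?a)" "hm ?a \<bullet> hm [DG ?k] = hm (?a @ [DG ?k])"
    using a assms hm_mult[of "[DG i]" ?a] hm_mult[of ?a "[DG ?k]"] by (simp_all del: set_map)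
  ultimately show ?thesis by (simp only: D_hat_def Hmon_def)
qed

subsection \<open>The group inside the algebra\<close>

lemma hm_SG_cong:
  "cox_eq I m u v \<Longrightarrow> hm (map SG u) = hm (map SG v)"
proof (induction rule: cox_eq.induct)
  case (rel u v i j)
  let ?r = "concat (replicate (m i j) [i, j])"
  have r: "set ?r \<subseteq> I" unfolding concat_replicate_alt using set_alt_subset rel by metis
  have "hc (mon (map SG ?r)) = hc 1"
  proof (rule hc_relation)
    have "map SG ?r = concat (replicate (m i j) [SG i, SG j])"
      by (simp only: concat_replicate_SG concat_replicate_alt[of "m i j" i j])
    then show "mon (map SG ?r) - 1 \<in> hecke_hopf_relations I m"
      unfolding hecke_hopf_relations_def using rel by auto
    show "mon (map SG ?r) \<in> carrier F" using r by (simp only: F_closed set_SG_DG)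
  qed simp
  then have 1: "hm (map SG ?r) = \<^bold>1" by (simp add: Hmon_def hc_ops)
  have c: "set (map SG u) \<subseteq> SG ` I \<union> DG ` I" "set (map SG v) \<subseteq> SG ` I \<union> DG ` I"
    "set (map SG ?r) \<subseteq> SG ` I \<union> DG ` I"
    using rel r by (simp_all only: set_SG_DG lists_iff)
  have "hm (map SG (u @ ?r @ v)) = hm (map SG u) \<bullet> (hm (map SG ?r) \<bullet> hm (map SG v))"
    using c by (simp add: hm_mult del: set_map)
  also have "\<dots> = hm (map SG (u @ v))"
    unfolding 1 using c by (simp add: hm_mult del: set_map)
  finally show ?case .
qed auto

lemma wh_ev:
  assumes "set u \<subseteq> I" shows "wh (ev u) = hm (map SG u)"
proof -
  have "u \<in> ev u" using assms by (simp add: cox_class_def lists_iff cox_eq.refl)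
  moreover have "hm (map SG v) = hm (map SG u)" if "v \<in> ev u" for v
    using that hm_SG_cong[of u v] by (simp add: cox_class_def)
  ultimately have "(\<lambda>v. hm (map SG v)) ` ev u = {hm (map SG u)}" by blast
  then show ?thesis by (simp add: W_hat_def)
qed

lemma hm_SG:
  assumes "set u \<subseteq> I"
  shows "hm (map SG u) \<in> carrier R"
    and "set v \<subseteq> I \<Longrightarrow> hm (map SG u) \<bullet> hm (map SG v) = hm (map SG (u @ v))"
proof -
  have u: "set (map SG u) \<subseteq> SG ` I \<union> DG ` I" using assms by (simp only: set_SG_DG)
  show "hm (map SG u) \<in> carrier R" by (rule hm_closed[OF u])
  assume "set v \<subseteq> I"
  then have "set (map SG v) \<subseteq> SG ` I \<union> DG ` I" by (simp only: set_SG_DG)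
  from hm_mult[OF u this] show "hm (map SG u) \<bullet> hm (map SG v) = hm (map SG (u @ v))" by simp
qed

lemma wh_closed [simp]:
  assumes "w \<in> carrier W" shows "wh w \<in> carrier R"
proof -
  obtain u where "set u \<subseteq> I" "w = ev u" using W_cases assms by blast
  then show ?thesis by (simp add: wh_ev hm_SG)
qed

lemma wh_mult:
  assumes "w \<in> carrier W" "v \<in> carrier W"
  shows "wh w \<bullet> wh v = wh (w \<star> v)"
proof -
  obtain x y where "set x \<subseteq> I" "w = ev x" "set y \<subseteq> I" "v = ev y" using W_cases assms by metis
  then show ?thesis by (simp add: wh_ev W_mult hm_SG)
qed

lemma wh_one [simp]: "wh \<one>\<^bsub>W\<^esub> = \<^bold>1"
  using wh_ev[of "[]"] by (simp add: W_one hm_Nil)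

lemma wh_gen: "i \<in> I \<Longrightarrow> wh (gen i) = sh i"
  using wh_ev[of "[i]"] by (simp add: cox_gen_def s_hat_def)

lemma wh_mult_assoc:
  "w \<in> carrier W \<Longrightarrow> v \<in> carrier W \<Longrightarrow> x \<in> carrier R \<Longrightarrow>
    wh w \<bullet> (wh v \<bullet> x) = wh (w \<star> v) \<bullet> x"
  by (simp add: wh_mult flip: H.m_assoc)

text \<open>By \<open>simple_transport\<close> it is enough to treat the rank two moves, and for
  those the claim is the braid-type defining relation. The sign condition says that the simple root
  itself, and not its negative, is reached.\<close>

lemma wh_dh_simple:
  assumes "w \<in> carrier W" "i \<in> I" "j \<in> I" "conj w (gen i) = gen j" "\<not> flip w (gen i)"
  shows "wh w \<bullet> dh i = dh j \<bullet> wh w"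
  using assms
proof (rule simple_transport)
  fix i assume "i \<in> I"
  then show "wh \<one>\<^bsub>W\<^esub> \<bullet> dh i = dh i \<bullet> wh \<one>\<^bsub>W\<^esub>" by simp
next
  fix u v i a j
  assume *: "u \<in> carrier W" "v \<in> carrier W" "i \<in> I" "a \<in> I" "j \<in> I"
    "wh u \<bullet> dh a = dh j \<bullet> wh u" "wh v \<bullet> dh i = dh a \<bullet> wh v"
  have "wh (u \<star> v) \<bullet> dh i = (wh u \<bullet> dh a) \<bullet> wh v"
    using *(1-5,7) by (simp add: H.m_assoc flip: wh_mult)
  also have "\<dots> = dh j \<bullet> wh (u \<star> v)"
    unfolding *(6) using *(1-5) by (simp add: H.m_assoc flip: wh_mult)
  finally show "wh (u \<star> v) \<bullet> dh i = dh j \<bullet> wh (u \<star> v)" .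
next
  fix a b assume "a \<in> I" "b \<in> I" "a \<noteq> b" "m a b \<noteq> 0"
  then show "wh (ev (alt (m a b - 1) b a)) \<bullet> dh (if even (m a b) then a else b) =
      dh a \<bullet> wh (ev (alt (m a b - 1) b a))"
    using dh_braid[of a b] set_alt_subset[of b I a] by (simp add: wh_ev)
qed

subsection \<open>The elements attached to reflections\<close>

text \<open>An explicit candidate for D_t: conjugate \<open>dh i\<close> by any \<open>w\<close>
  carrying the i-th simple root to the positive root of \<open>t\<close>. \<open>D_refl_eq\<close>
  identifies it with the family described by its two rules.\<close>

definition Dr :: "'i list set \<Rightarrow> 'i gen falg set" where
  "Dr t = (THE x. \<exists>w\<in>carrier W. \<exists>i\<in>I. t = conj w (gen i) \<and> \<not> flip w (gen i) \<and>
     x = wh w \<bullet> dh i \<bullet> wh (inv\<^bsub>W\<^esub> w))"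

text \<open>Two admissible choices w and v differ by w^-1 v, which carries one simple root to
  another one positively, so \<open>wh_dh_simple\<close> applies.\<close>

lemma Dr_conj:
  assumes w: "w \<in> carrier W" "i \<in> I" "\<not> flip w (gen i)"
  shows "Dr (conj w (gen i)) = wh w \<bullet> dh i \<bullet> wh (inv\<^bsub>W\<^esub> w)"
  unfolding Dr_def
proof (rule the_equality)
  fix x assume "\<exists>v\<in>carrier W. \<exists>j\<in>I. conj w (gen i) = conj v (gen j) \<and> \<not> flip v (gen j) \<and>
     x = wh v \<bullet> dh j \<bullet> wh (inv\<^bsub>W\<^esub> v)"
  then obtain v j where v: "v \<in> carrier W" "j \<in> I" "conj w (gen i) = conj v (gen j)" "\<not> flip v (gen j)"
    and x: "x = wh v \<bullet> dh j \<bullet> wh (inv\<^bsub>W\<^esub> v)" by blast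
  let ?u = "inv\<^bsub>W\<^esub> w \<star> v"
  have "conj ?u (gen j) = gen i" using v w by (simp add: conj_mult flip: v(3))
  moreover have "\<not> flip ?u (gen j)"
    using v w flip_inv[of w "gen i"] by (simp add: flip_mult flip: v(3))
  ultimately have u: "wh ?u \<bullet> dh j = dh i \<bullet> wh ?u"
    using wh_dh_simple[of ?u j i] v w by simp
  have "x = wh w \<bullet> (wh ?u \<bullet> dh j) \<bullet> wh (inv\<^bsub>W\<^esub> v)"
    using v w x by (simp add: wh_mult_assoc)
  also have "\<dots> = wh w \<bullet> dh i \<bullet> (wh ?u \<bullet> wh (inv\<^bsub>W\<^esub> v))"
    unfolding u using v w by (simp add: H.m_assoc)
  also have "wh ?u \<bullet> wh (inv\<^bsub>W\<^esub> v) = wh (inv\<^bsub>W\<^esub> w)"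
    using v w by (simp add: wh_mult W.m_assoc)
  finally show "x = wh w \<bullet> dh i \<bullet> wh (inv\<^bsub>W\<^esub> w)" .
qed (use w in blast)

text \<open>If \<open>w\<close> sends the simple root to the negative root of \<open>t\<close>, then
  \<open>w \<star> gen i\<close> sends it to the positive one.\<close>

lemma refl_pos_cases:
  assumes "t \<in> T"
  obtains w i where "w \<in> carrier W" "i \<in> I" "\<not> flip w (gen i)" "t = conj w (gen i)"
proof -
  obtain w i where w: "w \<in> carrier W" "i \<in> I" "t = conj w (gen i)" by (rule refl_cases[OF assms])
  show thesis
  proof (cases "flip w (gen i)")
    case True
    show thesis
    proof (rule that)
      show "\<not> flip (w \<star> gen i) (gen i)" using w True by (simp add: flip_mult flip_gen)
      show "t = conj (w \<star> gen i) (gen i)" using w by (simp add: conj_mult)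
    qed (use w in simp_all)
  qed (use w that in blast)
qed

lemma Dr_closed [simp]: "t \<in> T \<Longrightarrow> Dr t \<in> carrier R"
  by (erule refl_pos_cases) (simp add: Dr_conj)

lemma Dr_gen: "i \<in> I \<Longrightarrow> Dr (gen i) = dh i"
  using Dr_conj[of "\<one>\<^bsub>W\<^esub>" i] by simp

lemma Dr_idem [simp]:
  assumes "t \<in> T" shows "Dr t \<bullet> Dr t = Dr t"
proof -
  obtain w i where w: "w \<in> carrier W" "i \<in> I" "\<not> flip w (gen i)" "t = conj w (gen i)"
    by (rule refl_pos_cases[OF assms])
  have "Dr t \<bullet> Dr t = wh w \<bullet> (dh i \<bullet> dh i) \<bullet> wh (inv\<^bsub>W\<^esub> w)"
    unfolding w(4) Dr_conj[OF w(1-3)] using w(1,2) by (simp add: H.m_assoc wh_mult_assoc)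
  then show ?thesis using w by (simp add: dh_idem Dr_conj)
qed

lemma wh_Dr_pos:
  assumes "w \<in> carrier W" "t \<in> T" "\<not> flip w t"
  shows "wh w \<bullet> Dr t = Dr (conj w t) \<bullet> wh w"
proof -
  obtain v i where v: "v \<in> carrier W" "i \<in> I" "\<not> flip v (gen i)" "t = conj v (gen i)"
    by (rule refl_pos_cases[OF assms(2)])
  have "Dr (conj w t) = wh (w \<star> v) \<bullet> dh i \<bullet> wh (inv\<^bsub>W\<^esub> (w \<star> v))"
    using Dr_conj[of "w \<star> v" i] v assms by (simp add: conj_mult flip_mult)
  then have "Dr (conj w t) \<bullet> wh w = wh w \<bullet> (wh v \<bullet> dh i \<bullet> wh (inv\<^bsub>W\<^esub> v))"
    using v assms by (simp add: H.m_assoc wh_mult_assoc wh_mult W.m_assoc W.inv_mult_group)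
  then show ?thesis using v by (simp add: Dr_conj)
qed

lemma sh_dh_sh:
  assumes "i \<in> I"
  shows "sh i \<bullet> dh i \<bullet> sh i = \<^bold>1 \<^bold>- sh i \<^bold>- dh i"
proof -
  have c: "sh i \<in> carrier R" "dh i \<in> carrier R" using assms by simp_all
  have "sh i \<bullet> dh i = (sh i \<^bold>- \<^bold>1) \<^bold>- dh i \<bullet> sh i"
    using sh_dh[OF assms] c by (metis H.add.inv_solve_right H.m_closed H.minus_closed H.minus_eq H.one_closed)
  then have "sh i \<bullet> dh i \<bullet> sh i =
      sh i \<bullet> sh i \<^bold>- sh i \<^bold>- dh i \<bullet> (sh i \<bullet> sh i)"
    using c by (simp only:) algebra
  then show ?thesis using c assms by (simp add: sh_square)
qed

lemma wh_Dr_neg: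
  assumes "w \<in> carrier W" "t \<in> T" "flip w t"
  shows "wh w \<bullet> Dr t = (\<^bold>1 \<^bold>- Dr (conj w t)) \<bullet> wh w \<^bold>- wh (w \<star> t)"
proof -
  obtain v i where v: "v \<in> carrier W" "i \<in> I" "\<not> flip v (gen i)" "t = conj v (gen i)"
    by (rule refl_pos_cases[OF assms(2)])
  \<comment> \<open>The group element \<open>w \<star> v\<close> reaches the negative root of w t
    w^-1; the extra generator repairs the sign, at the price of expanding s_i D_i s_i by
    \<open>sh_dh_sh\<close>.\<close>
  let ?u = "w \<star> v \<star> gen i"
  note [simp] = H.m_assoc wh_mult_assoc wh_mult W.m_assoc W.inv_mult_group
  have f: "\<not> flip ?u (gen i)" "conj ?u (gen i) = conj w t" "?u \<in> carrier W"
    using v assms by (simp_all add: flip_mult flip_gen conj_mult flip: W.m_assoc)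
  have "Dr (conj w t) = wh ?u \<bullet> dh i \<bullet> wh (inv\<^bsub>W\<^esub> ?u)"
    using Dr_conj[OF f(3) v(2) f(1)] f(2) by simp
  then have "Dr (conj w t) \<bullet> wh w = wh (w \<star> v) \<bullet> (sh i \<bullet> dh i \<bullet> sh i) \<bullet> wh (inv\<^bsub>W\<^esub> v)"
    using v(1,2) assms(1) by (simp flip: wh_gen)
  also have "\<dots> = wh (w \<star> v) \<bullet> wh (inv\<^bsub>W\<^esub> v)
      \<^bold>- wh (w \<star> v) \<bullet> sh i \<bullet> wh (inv\<^bsub>W\<^esub> v)
      \<^bold>- wh (w \<star> v) \<bullet> dh i \<bullet> wh (inv\<^bsub>W\<^esub> v)"
  proof -
    have c: "wh (w \<star> v) \<in> carrier R" "sh i \<in> carrier R" "dh i \<in> carrier R" "wh (inv\<^bsub>W\<^esub> v) \<in> carrier R"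
      using v assms by simp_all
    then show ?thesis unfolding sh_dh_sh[OF v(2)] by algebra
  qed
  also have "wh (w \<star> v) \<bullet> wh (inv\<^bsub>W\<^esub> v) = wh w" using v assms by simp
  also have "wh (w \<star> v) \<bullet> sh i \<bullet> wh (inv\<^bsub>W\<^esub> v) = wh (w \<star> t)"
    using v(1,2) assms(1) unfolding v(4) conj_def by (simp flip: wh_gen)
  also have "wh (w \<star> v) \<bullet> dh i \<bullet> wh (inv\<^bsub>W\<^esub> v) = wh w \<bullet> Dr t"
    using v(1,2) assms(1) unfolding v(4) Dr_conj[OF v(1-3)] by simp
  finally have e: "Dr (conj w t) \<bullet> wh w = wh w \<^bold>- wh (w \<star> t) \<^bold>- wh w \<bullet> Dr t" .
  have "(\<^bold>1 \<^bold>- Dr (conj w t)) \<bullet> wh w \<^bold>- wh (w \<star> t) =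
     wh w \<^bold>- Dr (conj w t) \<bullet> wh w \<^bold>- wh (w \<star> t)"
    using assms by (simp add: H.minus_eq H.l_distr H.l_minus)
  also have "\<dots> = wh w \<bullet> Dr t"
  proof -
    have c: "wh w \<in> carrier R" "wh (w \<star> t) \<in> carrier R" "wh w \<bullet> Dr t \<in> carrier R"
      using assms by simp_all
    then show ?thesis unfolding e by algebra
  qed
  finally show ?thesis by simp
qed

text \<open>For uniqueness, conjugate one letter x at a time: either the second rule applies, or the
  reflection is \<open>gen x\<close>, which conjugation by x fixes and the first rule prescribes.
  Existence is \<open>wh_Dr_pos\<close>, since \<open>gen i\<close> flips no reflection other than
  itself.\<close>

lemma D_refl_eq:
  assumes "t \<in> T" shows "D_refl I m t = Dr t"
proof -
  define Q where "Q D \<longleftrightarrow> D \<in> T \<rightarrow>\<^sub>E carrier R \<and> (\<forall>i\<in>I. D (gen i) = dh i)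
     \<and> (\<forall>i\<in>I. \<forall>s \<in> T - {gen i}.
          D (gen i \<star> s \<star> gen i) = sh i \<bullet> D s \<bullet> sh i)" for D
  have eq: "D (conj w (gen i)) = Dr (conj w (gen i))" if Q: "Q D" and "w \<in> carrier W" "i \<in> I" for D w i
    using that(2)
  proof (induction w rule: W_induct)
    case one
    then show ?case using Q that by (simp add: Q_def Dr_gen)
  next
    case (gen x w)
    let ?t = "conj w (cox_gen I m i)"
    show ?case
    proof (cases "?t = cox_gen I m x")
      case True
      then show ?thesis using gen Q that by (simp add: conj_mult Q_def Dr_gen)
    next
      case False
      have T: "?t \<in> T" using gen that by simp
      have "D (conj (cox_gen I m x) ?t) = sh x \<bullet> D ?t \<bullet> sh x"
        using Q False T gen by (simp add: Q_def conj_gen)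
      also have "\<dots> = Dr (conj (cox_gen I m x) ?t) \<bullet> sh x \<bullet> sh x"
        using wh_Dr_pos[of "cox_gen I m x" ?t] False T gen by (simp add: flip_gen wh_gen)
      finally show ?thesis using gen that T by (simp add: H.m_assoc sh_square conj_mult)
    qed
  qed
  have uniq: "D t = Dr t" if q: "Q D" and t: "t \<in> T" for D t
  proof -
    obtain w i where "w \<in> carrier W" "i \<in> I" "t = conj w (gen i)" by (rule refl_cases[OF t])
    then show ?thesis using eq[OF q] by simp
  qed
  have "Q (restrict Dr T)"
    unfolding Q_def
  proof (intro conjI ballI)
    fix i s assume i: "i \<in> I" and s: "s \<in> T - {gen i}"
    then have "Dr (conj (gen i) s) = Dr (conj (gen i) s) \<bullet> sh i \<bullet> sh i"
      by (simp add: H.m_assoc sh_square)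
    also have "\<dots> = sh i \<bullet> Dr s \<bullet> sh i"
      using wh_Dr_pos[of "gen i" s] i s by (simp add: flip_gen wh_gen)
    finally show "restrict Dr T (gen i \<star> s \<star> gen i) = sh i \<bullet> restrict Dr T s \<bullet> sh i"
      using i s conj_refl[of "gen i" s] by (simp add: conj_gen)
  qed (auto simp: Dr_gen)
  moreover have "D = restrict Dr T" if "Q D" for D
  proof
    fix x show "D x = restrict Dr T x"
      using uniq[OF that] that by (cases "x \<in> T") (auto simp: Q_def PiE_def extensional_def)
  qed
  ultimately have "(THE D. Q D) = restrict Dr T" by (rule the_equality)
  then have "D_refl I m = restrict Dr T" by (simp only: D_refl_def Q_def)
  then show ?thesis using assms by simp
qed

end

section \<open>A faithful module\<close>

type_synonym 'j refl_basis = "'j list set list \<times> 'j list set"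
type_synonym 'j refl_module = "'j refl_basis \<Rightarrow>\<^sub>0 int"

context coxeter begin

text \<open>A basis element \<open>(l, v)\<close> stands for the normal form \<open>D\<^sub>t\<^sub>1 \<cdots> D\<^sub>t\<^sub>k v\<close> with \<open>l = [t\<^sub>1, \<dots>, t\<^sub>k]\<close>
  having no equal neighbours.\<close>

definition ins :: "'i list set \<Rightarrow> 'i list set list \<Rightarrow> 'i list set list" where
  "ins t l = (if l \<noteq> [] \<and> hd l = t then l else t # l)"

definition Dop :: "'i list set \<Rightarrow> 'i refl_module \<Rightarrow> 'i refl_module" where
  "Dop t = frag_extend (\<lambda>(l, v). frag_of (ins t l, v))"

text \<open>The commutation rules \<open>wh_Dr_pos\<close> and \<open>wh_Dr_neg\<close> read as a
  recursion that moves \<open>w\<close> to the right through the list. The correction term changes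
  the group element but shortens the list.\<close>

fun wact :: "'i list set list \<Rightarrow> 'i list set \<Rightarrow> 'i list set \<Rightarrow> 'i refl_module" where
  "wact [] w v = frag_of ([], w \<star> v)"
| "wact (t # l) w v =
    (if flip w t then wact l w v - Dop (conj w t) (wact l w v) - wact l (w \<star> t) v
     else Dop (conj w t) (wact l w v))"

definition Sop :: "'i list set \<Rightarrow> 'i refl_module \<Rightarrow> 'i refl_module" where
  "Sop w = frag_extend (\<lambda>(l, v). wact l w v)"

definition basis :: "'i refl_basis set" where
  "basis = {(l, v). set l \<subseteq> T \<and> distinct_adj l \<and> v \<in> carrier W}"

definition MT :: "'i refl_module set" where "MT = {y. Poly_Mapping.keys y \<subseteq> basis}"

lemma Dop_simps [simp]: "Dop t (frag_of (l, v)) = frag_of (ins t l, v)" "Dop t 0 = 0"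
  "Dop t (x - y) = Dop t x - Dop t y" "Dop t (x + y) = Dop t x + Dop t y"
  by (simp_all add: Dop_def frag_extend_diff frag_extend_add)

lemma Sop_simps [simp]: "Sop w (frag_of (l, v)) = wact l w v" "Sop w 0 = 0"
  "Sop w (x - y) = Sop w x - Sop w y" "Sop w (x + y) = Sop w x + Sop w y"
  by (simp_all add: Sop_def frag_extend_diff frag_extend_add)

lemma MT_simps [simp]: "0 \<in> MT" "frag_of b \<in> MT \<longleftrightarrow> b \<in> basis"
  "x \<in> MT \<Longrightarrow> y \<in> MT \<Longrightarrow> x - y \<in> MT"
  by (auto simp: MT_def dest: subsetD[OF keys_diff])

lemma MT_induct [consumes 1, case_names zero basis diff]:
  assumes "y \<in> MT" "P 0" "\<And>l v. (l, v) \<in> basis \<Longrightarrow> P (frag_of (l, v))"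
    and "\<And>x y. P x \<Longrightarrow> P y \<Longrightarrow> P (x - y)"
  shows "P y"
  by (rule frag_induction[where S = basis]) (use assms in \<open>auto simp: MT_def\<close>)

lemma ins_basis: "t \<in> T \<Longrightarrow> (l, v) \<in> basis \<Longrightarrow> (ins t l, v) \<in> basis"
  by (cases l) (auto simp: basis_def ins_def)

lemma basis_Cons: "(t # l, v) \<in> basis \<Longrightarrow> t \<in> T \<and> (l, v) \<in> basis \<and> ins t l = t # l"
  by (cases l) (auto simp: basis_def ins_def)

lemma Dop_idem: "Dop t (Dop t y) = Dop t y"
proof (rule frag_induction[where S = UNIV and P = "\<lambda>y. Dop t (Dop t y) = Dop t y"])
  fix x :: "'i refl_basis"
  show "Dop t (Dop t (frag_of x)) = Dop t (frag_of x)" by (cases x) (auto simp: ins_def)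
qed auto

lemma Dop_MT [simp]: "y \<in> MT \<Longrightarrow> t \<in> T \<Longrightarrow> Dop t y \<in> MT"
  by (induction y rule: MT_induct) (auto simp: ins_basis)

lemma wact_MT: "(l, v) \<in> basis \<Longrightarrow> w \<in> carrier W \<Longrightarrow> wact l w v \<in> MT"
proof (induction l arbitrary: w)
  case Nil
  then show ?case by (simp add: basis_def)
next
  case (Cons t l)
  then show ?case using basis_Cons[of t l v] by simp
qed

lemma Sop_MT [simp]: "y \<in> MT \<Longrightarrow> w \<in> carrier W \<Longrightarrow> Sop w y \<in> MT"
  by (induction y rule: MT_induct) (auto simp: wact_MT)

lemma flip_mult_self: "w \<in> carrier W \<Longrightarrow> t \<in> T \<Longrightarrow> flip (w \<star> t) t = (\<not> flip w t)"
  by (simp add: flip_mult flip_self)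

text \<open>Only a list already beginning with \<open>t\<close> needs care, where \<open>ins\<close>
  drops a letter. If \<open>w\<close> flips \<open>t\<close>, the terms agree because
  \<open>w \<star> t\<close> does not flip \<open>t\<close> and conjugates it to the same
  reflection.\<close>

lemma Sop_Dop:
  assumes "w \<in> carrier W" "t \<in> T" "y \<in> MT"
  shows "Sop w (Dop t y) =
    (if flip w t then Sop w y - Dop (conj w t) (Sop w y) - Sop (w \<star> t) y
     else Dop (conj w t) (Sop w y))"
  using assms(3)
proof (induction y rule: MT_induct)
  case (basis l v)
  show ?case
  proof (cases "ins t l = t # l")
    case False
    then obtain z where l: "l = t # z" by (cases l) (auto simp: ins_def split: if_splits)
    have "conj (w \<star> t) t = conj w t" using assms by (simp add: conj_mult)
    then show ?thesis
      using assms flip_mult_self[of w t] by (simp add: l ins_def Dop_idem W.m_assoc)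
  qed simp
qed auto

text \<open>Induction on the list, with the signs composed by \<open>flip_mult\<close>. When both
  factors flip, the correction terms cancel because moving \<open>w2\<close> past the conjugated
  reflection gives back \<open>w2 \<star> t\<close>.\<close>

lemma Sop_mult:
  assumes "y \<in> MT" "w1 \<in> carrier W" "w2 \<in> carrier W"
  shows "Sop w1 (Sop w2 y) = Sop (w1 \<star> w2) y"
  using assms
proof (induction y arbitrary: w1 w2 rule: MT_induct)
  case (basis l v)
  then show ?case
  proof (induction l arbitrary: w1 w2)
    case Nil
    then show ?case by (simp add: basis_def W.m_assoc)
  next
    case (Cons t l)
    let ?y = "frag_of (l, v)" and ?t = "conj w2 t"
    have b: "t \<in> T" "(l, v) \<in> basis" "frag_of (t # l, v) = Dop t ?y"
      using basis_Cons[OF Cons.prems(1)] by auto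
    have IH: "Sop u1 (Sop u2 ?y) = Sop (u1 \<star> u2) ?y" if "u1 \<in> carrier W" "u2 \<in> carrier W" for u1 u2
      by (rule Cons.IH) (use b that in auto)
    have c: "?t \<in> T" "?y \<in> MT" using b Cons.prems by simp_all
    have "w1 \<star> ?t \<star> w2 = w1 \<star> w2 \<star> t"
      using b Cons.prems conj_mult_eq[of w2 t] by (simp add: W.m_assoc)
    then show ?case unfolding b(3)
      using b c Cons.prems
      by (simp add: Sop_Dop IH flip_mult conj_mult W.m_assoc del: Sop_simps(1) Dop_simps(1))
  qed
qed auto

lemma Sop_one: "y \<in> MT \<Longrightarrow> Sop \<one>\<^bsub>W\<^esub> y = y"
proof (induction y rule: MT_induct)
  case (basis l v)
  then show ?case
  proof (induction l)
    case Nil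
    then show ?case by (simp add: basis_def)
  next
    case (Cons t l)
    then show ?case using basis_Cons[OF Cons.prems] by simp
  qed
qed auto

section \<open>The free algebra acting on the module, and the defining relations there\<close>

primrec gop :: "'i gen \<Rightarrow> 'i refl_module \<Rightarrow> 'i refl_module" where
  "gop (SG i) = Sop (gen i)"
| "gop (DG i) = Dop (gen i)"

definition evM :: "'i gen falg \<Rightarrow> 'i refl_module \<Rightarrow> 'i refl_module" where
  "evM p y = frag_extend (\<lambda>w. foldr gop (letters w) y) p"

lemma foldr_gop: "foldr gop xs 0 = 0" "foldr gop xs (x - y) = foldr gop xs x - foldr gop xs y"
proof (induction xs)
  case (Cons g xs)
  { case 1 show ?case using Cons by (cases g) auto }
  { case 2 show ?case using Cons by (cases g) auto }
qed auto

lemma evM_simps: "evM (mon xs) y = foldr gop xs y" "evM (p + q) y = evM p y + evM q y"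
  "evM (p - q) y = evM p y - evM q y" "evM 0 y = 0" "evM p 0 = 0" "evM 1 y = y" "evM (- p) y = - evM p y"
proof -
  show "evM (mon xs) y = foldr gop xs y" for xs by (simp add: evM_def mon_frag)
  from this[of "[]"] show "evM 1 y = y" by (simp add: mon_Nil)
  show "evM p 0 = 0" by (simp add: evM_def foldr_gop frag_extend_eq_0)
qed (simp_all add: evM_def frag_extend_add frag_extend_diff frag_extend_minus)

lemma evM_mult: "evM (p * q) y = evM p (evM q y)"
proof (induction p rule: falg_induct)
  case (mon xs)
  show ?case
    by (induction q rule: falg_induct)
      (simp_all add: evM_simps foldr_gop mon_mult right_diff_distrib)
qed (simp_all add: evM_simps left_diff_distrib)

lemma evM_MT [simp]:
  assumes "p \<in> carrier F" "y \<in> MT" shows "evM p y \<in> MT"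
proof -
  have "p \<in> carrier (free_algebra (SG ` I \<union> DG ` I))" using assms(1) by (simp add: HF_def)
  then show ?thesis
  proof (induction p rule: free_algebra_induct)
    case (mon xs)
    then show ?case unfolding evM_simps
      by (induction xs) (use assms(2) in auto)
  qed (simp_all add: evM_simps)
qed

lemma foldr_gop_SG:
  "set u \<subseteq> I \<Longrightarrow> y \<in> MT \<Longrightarrow> foldr gop (map SG u) y = Sop (ev u) y"
  by (induction u) (simp_all add: Sop_one Sop_mult gen_mult_ev flip: W_one)

lemma set_alt_I: "a \<in> I \<Longrightarrow> b \<in> I \<Longrightarrow> set (alt n a b) \<subseteq> I"
  by (rule set_alt_subset)

lemma ev_alt_braid:
  assumes "a \<in> I" "b \<in> I"
  shows "ev (alt (2 * n) a b) = \<one>\<^bsub>W\<^esub> \<longleftrightarrow> ev (alt n a b) = ev (alt n b a)"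
proof -
  have I: "set (alt n a b) \<subseteq> I" "set (alt n b a) \<subseteq> I" using set_alt_I assms by blast+
  have "alt (2 * n) a b = alt n a b @ rev (alt n b a)" by (simp add: mult_2 alt_add rev_alt)
  then have "ev (alt (2 * n) a b) = ev (alt n a b) \<star> inv\<^bsub>W\<^esub> ev (alt n b a)"
    using I by (simp add: inv_ev W_mult)
  then show ?thesis using I by (simp add: W.inv_solve_right')
qed

text \<open>The braid word with its last letter removed carries one simple root of the pair to
  another one, positively. This is what the module needs to satisfy the braid-type relation.\<close>

lemma braid_conj:
  assumes "a \<in> I" "b \<in> I" "a \<noteq> b" "m a b \<noteq> 0"
  defines "c \<equiv> if even (m a b) then a else b" and "w \<equiv> ev (alt (m a b - 1) b a)"
  shows "conj w (gen c) = gen a" "\<not> flip w (gen c)" "w \<in> carrier W" "c \<in> I"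
proof -
  define n where "n = m a b - 1"
  have n: "m a b = Suc n" using assms(4) by (simp add: n_def)
  have I: "set (alt k a b) \<subseteq> I" "set (alt k b a) \<subseteq> I" for k
    using set_alt_I assms(1,2) by blast+
  have w': "w = ev (alt n b a)" by (simp only: w_def n_def)
  show c: "c \<in> I" using assms(1,2) by (simp add: c_def)
  show w: "w \<in> carrier W" using I by (simp add: w_def)
  have "alt (Suc n) b a = alt n b a @ [c]" by (simp add: alt_snoc c_def n del: alt.simps)
  moreover have "ev (alt (Suc n) a b) = ev (alt (Suc n) b a)"
    using ev_alt_braid[of a b "Suc n"] ev_alt_rel[of a b "[]"] assms n by (simp add: W_one del: alt.simps)
  ultimately have "w \<star> gen c = gen a \<star> w"
    using I[of n] assms(1) c by (simp add: w' gen_mult_ev ev_mult_gen)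
  then have "conj w (gen c) = gen a \<star> w \<star> inv\<^bsub>W\<^esub> w" by (simp only: conj_def)
  then show "conj w (gen c) = gen a" using w assms(1) by (simp add: W.m_assoc)
  define d where "d = (if even (m a b) then b else a)"
  have cd: "{c, d} = {a, b}" "c \<noteq> d" "d \<in> I" "m c d = m a b"
    using assms m_sym by (auto simp: d_def c_def)
  have e: "alt n b a = rev (alt n d c)" by (simp add: rev_alt c_def d_def n)
  have "flip w (gen c) = flips (alt n b a) (gen c)" using I c by (simp add: w' flip_ev)
  also have "\<dots> = odd (\<Sum>k<n. of_bool (gen c = ev (alt (2 * k + 1) d c)) :: nat)"
    unfolding e by (rule flips_rev_alt) (use c cd in simp_all)
  also have "(\<Sum>k<n. of_bool (gen c = ev (alt (2 * k + 1) d c)) :: nat) = 0"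
  proof (rule sum.neutral, rule ballI)
    fix k assume k: "k \<in> {..<n}"
    \<comment> \<open>A flip would identify two alternating words of length k + 1, and
      \<open>alt_neq\<close> would give m \<le> k + 1; but k + 1 is at most n = m - 1.\<close>
    have "gen c \<noteq> ev (alt (2 * k + 1) d c)"
    proof
      assume "gen c = ev (alt (2 * k + 1) d c)"
      then have "\<one>\<^bsub>W\<^esub> = gen c \<star> ev (alt (2 * k + 1) d c)" using c by (metis gen_square)
      also have "\<dots> = ev (alt (2 * (k + 1)) c d)"
        using c cd set_alt_subset[of d I c "2 * k + 1"] by (simp add: gen_mult_ev)
      finally have "ev (alt (k + 1) c d) = ev (alt (k + 1) d c)"
        using ev_alt_braid[of c d "k + 1"] c cd by simp
      then have "m c d \<le> k + 1" using alt_neq[of c d "k + 1"] c cd by simp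
      then show False using k n cd by simp
    qed
    then show "of_bool (gen c = ev (alt (2 * k + 1) d c)) = (0::nat)" by simp
  qed
  finally show "\<not> flip w (gen c)" by simp
qed

text \<open>The annihilator of the module is a two-sided ideal, so it is enough that it contains the
  five families of relations.\<close>

lemma evM_ideal:
  assumes "p \<in> J0" "y \<in> MT" shows "evM p y = 0"
proof -
  let ?K = "{p \<in> carrier F. \<forall>y\<in>MT. evM p y = 0}"
  have "ideal ?K F"
    by (rule F.ideal_intro) (auto simp: evM_simps evM_mult F_minus)
  moreover have "hecke_hopf_relations I m \<subseteq> ?K"
  proof
    fix r assume r: "r \<in> hecke_hopf_relations I m"
    then have "r \<in> carrier F" using relations_closed by blast
    moreover have "evM r y = 0" if y: "y \<in> MT" for y
    proof -
      have 1: "evM (mon [SG i, SG i] - 1) y = 0" if "i \<in> I" for i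
        using that y by (simp add: evM_simps Sop_mult Sop_one)
      have 2: "evM (mon [DG i, DG i] - mon [DG i]) y = 0" if "i \<in> I" for i
        using that y by (simp add: evM_simps Dop_idem)
      have 3: "evM (mon [SG i, DG i] + mon [DG i, SG i] - (mon [SG i] - 1)) y = 0" if "i \<in> I" for i
        using that y by (simp add: evM_simps Sop_Dop flip_gen Sop_one)
      have 4: "evM (mon (concat (replicate (m i j) [SG i, SG j])) - 1) y = 0" if "i \<in> I" "j \<in> I" for i j
      proof -
        have "ev (alt (2 * m i j) i j) = \<one>\<^bsub>W\<^esub>" using ev_alt_rel[of i j "[]"] that by (simp add: W_one)
        then show ?thesis
          using that y foldr_gop_SG[of "alt (2 * m i j) i j" y] set_alt_subset[of i I j]
          by (simp add: concat_replicate_SG evM_simps Sop_one)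
      qed
      have 5: "evM (mon (DG i # map SG (alt (m i j - 1) j i))
        - mon (map SG (alt (m i j - 1) j i) @ [DG (if even (m i j) then i else j)])) y = 0"
        if "i \<in> I" "j \<in> I" "i \<noteq> j" "m i j \<noteq> 0" for i j
      proof -
        let ?a = "alt (m i j - 1) j i" and ?k = "if even (m i j) then i else j"
        note b = braid_conj[OF that]
        have a: "set ?a \<subseteq> I" using set_alt_subset[of j I i] that by blast
        have "evM (mon (DG i # map SG ?a)) y = Dop (gen i) (Sop (ev ?a) y)"
          using foldr_gop_SG[OF a y] by (simp add: evM_simps)
        moreover have "evM (mon (map SG ?a @ [DG ?k])) y = Sop (ev ?a) (Dop (gen ?k) y)"
          using foldr_gop_SG[OF a, of "Dop (gen ?k) y"] y b(4) by (simp add: evM_simps)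
        moreover have "Sop (ev ?a) (Dop (gen ?k) y) = Dop (gen i) (Sop (ev ?a) y)"
          using Sop_Dop[OF b(3), of "gen ?k" y] y b by simp
        ultimately show ?thesis by (simp only: evM_simps diff_self)
      qed
      show ?thesis using r 1 2 3 4 5 unfolding hecke_hopf_relations_def by blast
    qed
    ultimately show "r \<in> ?K" by blast
  qed
  ultimately have "J0 \<subseteq> ?K" unfolding hecke_hopf_ideal_def by (rule F.genideal_minimal)
  then show ?thesis using assms by blast
qed

subsection \<open>The action of the algebra on the module\<close>

text \<open>A total choice: even outside the carrier it returns an element of the free algebra,
  which spares \<open>op\<close> and \<open>lift\<close> side conditions.\<close>

definition frep :: "'i gen falg set \<Rightarrow> 'i gen falg" where
  "frep x = (SOME p. p \<in> carrier F \<and> (x \<in> carrier R \<longrightarrow> hc p = x))"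

lemma frep: "frep x \<in> carrier F" "x \<in> carrier R \<Longrightarrow> hc (frep x) = x"
proof -
  have "\<exists>p. p \<in> carrier F \<and> (x \<in> carrier R \<longrightarrow> hc p = x)"
  proof (cases "x \<in> carrier R")
    case True
    then obtain p where "p \<in> carrier F" "x = hc p" unfolding R_carrier by (rule imageE)
    then show ?thesis by auto
  qed (auto intro: exI[of _ 0])
  then have "frep x \<in> carrier F \<and> (x \<in> carrier R \<longrightarrow> hc (frep x) = x)"
    unfolding frep_def by (rule someI_ex)
  then show "frep x \<in> carrier F" "x \<in> carrier R \<Longrightarrow> hc (frep x) = x" by simp_all
qed

definition op :: "'i gen falg set \<Rightarrow> 'i refl_module \<Rightarrow> 'i refl_module" where
  "op x = evM (frep x)"

lemma op_hc:
  assumes "p \<in> carrier F" "y \<in> MT" shows "op (hc p) y = evM p y"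
proof -
  have "frep (hc p) - p \<in> J0" using assms hc_eq_iff[OF frep(1) assms(1)] frep(2)[of "hc p"] by simp
  from evM_ideal[OF this assms(2)] show ?thesis by (simp add: op_def evM_simps)
qed

lemma op_MT [simp]: "y \<in> MT \<Longrightarrow> op x y \<in> MT"
  by (simp add: op_def frep)

lemma op_ops:
  assumes "x \<in> carrier R" "x' \<in> carrier R" "y \<in> MT"
  shows "op (x \<bullet> x') y = op x (op x' y)" "op (x \<^bold>+ x') y = op x y + op x' y"
proof -
  obtain p q where p: "p \<in> carrier F" "x = hc p" "q \<in> carrier F" "x' = hc q"
    using assms frep by metis
  then show "op (x \<bullet> x') y = op x (op x' y)" "op (x \<^bold>+ x') y = op x y + op x' y"
    using assms by (simp_all add: hc_ops op_hc evM_simps evM_mult)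
qed

lemma op_one: "y \<in> MT \<Longrightarrow> op \<^bold>1 y = y"
  by (simp add: hc_ops op_hc evM_simps)

lemma op_uminus:
  assumes "x \<in> carrier R" "y \<in> MT" shows "op (\<^bold>- x) y = - op x y"
proof -
  obtain p where "p \<in> carrier F" "x = hc p" using assms frep by metis
  then show ?thesis using assms by (simp add: hc_ops op_hc evM_simps)
qed

lemma op_wh: "w \<in> carrier W \<Longrightarrow> y \<in> MT \<Longrightarrow> op (wh w) y = Sop w y"
proof (erule W_cases)
  fix u assume u: "set u \<subseteq> I" "w = ev u" and y: "y \<in> MT"
  have "mon (map SG u) \<in> carrier F" using u by (simp only: F_closed set_SG_DG)
  then show "op (wh w) y = Sop w y"
    using u y by (simp add: wh_ev Hmon_def op_hc evM_simps foldr_gop_SG)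
qed

lemma op_Dr:
  assumes "t \<in> T" "y \<in> MT" shows "op (Dr t) y = Dop t y"
proof -
  obtain w i where w: "w \<in> carrier W" "i \<in> I" "\<not> flip w (gen i)" "t = conj w (gen i)"
    by (rule refl_pos_cases[OF assms(1)])
  have "op (dh i) y' = Dop (gen i) y'" if "y' \<in> MT" for y'
    using that w by (simp add: D_hat_def Hmon_def op_hc evM_simps)
  then have "op (Dr t) y = Sop w (Dop (gen i) (Sop (inv\<^bsub>W\<^esub> w) y))"
    unfolding w(4) Dr_conj[OF w(1-3)] using w(1,2) assms(2) by (simp add: op_ops op_wh)
  also have "\<dots> = Dop t y"
    using w assms(2) by (simp add: Sop_Dop Sop_mult Sop_one)
  finally show ?thesis .
qed

text \<open>Linear extension from the module to the algebra. Cosets form no type with an addition of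
  its own, so the extension is carried out on representatives in the free algebra and then
  projected.\<close>

definition lift :: "('i refl_basis \<Rightarrow> 'i gen falg set) \<Rightarrow> 'i refl_module \<Rightarrow> 'i gen falg set" where
  "lift g y = hc (frag_extend (\<lambda>b. frep (g b)) y)"

lemma lift_frag: "frag_extend (\<lambda>b. frep (g b)) y \<in> carrier F"
  by (rule frag_induction[where S = UNIV and P = "\<lambda>y. frag_extend (\<lambda>b. frep (g b)) y \<in> carrier F"])
    (auto simp: frep frag_extend_diff)

lemma lift_closed [simp]: "lift g y \<in> carrier R"
  by (simp add: lift_def lift_frag)

lemma lift_simps:
  "lift g 0 = \<^bold>0" "lift g (x + y) = lift g x \<^bold>+ lift g y"
  "lift g (x - y) = lift g x \<^bold>- lift g y" "lift g (- y) = \<^bold>- lift g y"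
  by (simp_all add: lift_def lift_frag hc_ops frag_extend_add frag_extend_diff frag_extend_minus)

lemma lift_of: "g b \<in> carrier R \<Longrightarrow> lift g (frag_of b) = g b"
  by (simp add: lift_def frep)

end

section \<open>The subalgebra generated by the reflection elements\<close>

context coxeter begin

lemma Dhat_eq: "Dhat I m V = generate_ring R (Dr ` (T \<inter> V))"
  unfolding Dhat_def using D_refl_eq by (metis (no_types, lifting) IntD1 image_cong)

lemma Dr_image_closed: "Dr ` (T \<inter> V) \<subseteq> carrier R"
  by auto

lemma Dhat_carrier: "x \<in> Dhat I m V \<Longrightarrow> x \<in> carrier R"
  unfolding Dhat_eq by (rule H.generate_ring_in_carrier[OF Dr_image_closed])

lemma Dhat_closed [simp]:
  "\<^bold>1 \<in> Dhat I m V" "\<^bold>0 \<in> Dhat I m V"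
  "t \<in> T \<Longrightarrow> t \<in> V \<Longrightarrow> Dr t \<in> Dhat I m V"
  "x \<in> Dhat I m V \<Longrightarrow> \<^bold>- x \<in> Dhat I m V"
  "x \<in> Dhat I m V \<Longrightarrow> y \<in> Dhat I m V \<Longrightarrow> x \<^bold>+ y \<in> Dhat I m V"
  "x \<in> Dhat I m V \<Longrightarrow> y \<in> Dhat I m V \<Longrightarrow> x \<^bold>- y \<in> Dhat I m V"
  "x \<in> Dhat I m V \<Longrightarrow> y \<in> Dhat I m V \<Longrightarrow> x \<bullet> y \<in> Dhat I m V"
  unfolding Dhat_eq a_minus_def
  by (auto intro: generate_ring.intros H.zero_in_generate)

lemma Dhat_induct [consumes 1, case_names one Dr uminus plus mult]:
  assumes "x \<in> Dhat I m V" "P \<^bold>1" "\<And>t. t \<in> T \<Longrightarrow> t \<in> V \<Longrightarrow> P (Dr t)"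
    and "\<And>x. x \<in> Dhat I m V \<Longrightarrow> P x \<Longrightarrow> P (\<^bold>- x)"
    and "\<And>x y. x \<in> Dhat I m V \<Longrightarrow> y \<in> Dhat I m V \<Longrightarrow> P x \<Longrightarrow> P y \<Longrightarrow> P (x \<^bold>+ y)"
    and "\<And>x y. x \<in> Dhat I m V \<Longrightarrow> y \<in> Dhat I m V \<Longrightarrow> P x \<Longrightarrow> P y \<Longrightarrow> P (x \<bullet> y)"
  shows "P x"
  using assms(1) unfolding Dhat_eq
proof (induction x rule: generate_ring.induct)
  case (incl h)
  then show ?case using assms(3) by blast
qed (use assms Dhat_eq in auto)

abbreviation DD where "DD \<equiv> Dhat I m (carrier W)"

lemma Dhat_mono: "x \<in> Dhat I m V \<Longrightarrow> x \<in> DD"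
  by (induction x rule: Dhat_induct) auto

definition e0 :: "'i refl_module" where "e0 = frag_of ([], \<one>\<^bsub>W\<^esub>)"

lemma e0_MT [simp]: "e0 \<in> MT"
  by (simp add: e0_def basis_def)

text \<open>Keeps the part of a vector whose group component is the identity and interprets each
  list by \<open>f\<close>. The action, the derivations and the coefficient of the identity are all
  instances.\<close>

definition lf :: "('i list set list \<Rightarrow> 'i gen falg set) \<Rightarrow> 'i refl_module \<Rightarrow> 'i gen falg set" where
  "lf f = lift (\<lambda>(l, v). if v = \<one>\<^bsub>W\<^esub> \<and> set l \<subseteq> T then f l else \<^bold>0)"

lemma lf_closed [simp]: "lf f y \<in> carrier R"
  by (simp add: lf_def)

lemma lf_simps:
  "lf f 0 = \<^bold>0" "lf f (x + y) = lf f x \<^bold>+ lf f y"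
  "lf f (x - y) = lf f x \<^bold>- lf f y" "lf f (- y) = \<^bold>- lf f y"
  by (simp_all add: lf_def lift_simps)

lemma lf_basis:
  assumes "(l, v) \<in> basis" "\<And>l. set l \<subseteq> T \<Longrightarrow> f l \<in> carrier R"
  shows "lf f (frag_of (l, v)) = (if v = \<one>\<^bsub>W\<^esub> then f l else \<^bold>0)"
  using assms unfolding lf_def by (subst lift_of) (auto simp: basis_def)

text \<open>The hypothesis \<open>idem\<close> makes the recursion insensitive to \<^term>\<open>ins\<close> dropping a repeated letter.\<close>

lemma lf_Dop:
  assumes t: "t \<in> T" and y: "y \<in> MT"
    and c: "\<And>l. set l \<subseteq> T \<Longrightarrow> f l \<in> carrier R" "\<And>l. set l \<subseteq> T \<Longrightarrow> g l \<in> carrier R"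
    and a: "a \<in> carrier R" "b \<in> carrier R"
    and rec: "\<And>l. set l \<subseteq> T \<Longrightarrow> f (t # l) = a \<bullet> g l \<^bold>+ b \<bullet> f l"
    and idem: "\<And>l. set l \<subseteq> T \<Longrightarrow> a \<bullet> g (t # l) \<^bold>+ b \<bullet> f (t # l) = f (t # l)"
  shows "lf f (Dop t y) = a \<bullet> lf g y \<^bold>+ b \<bullet> lf f y"
  using y
proof (induction y rule: MT_induct)
  case zero
  show ?case using a by (simp add: lf_simps)
next
  case (basis l v)
  have l: "set l \<subseteq> T" using basis by (simp add: basis_def)
  show ?case
  proof (cases "ins t l = t # l")
    case True
    then show ?thesis using basis l a rec[OF l] c t ins_basis[OF t basis]
      by (simp add: lf_basis)
  next
    case False
    then obtain z where z: "l = t # z" by (cases l) (auto simp: ins_def split: if_splits)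
    then show ?thesis using basis l a c t idem[of z] by (simp add: lf_basis ins_def)
  qed
next
  case (diff x y)
  have cl: "lf f x \<in> carrier R" "lf f y \<in> carrier R" "lf g x \<in> carrier R" "lf g y \<in> carrier R" by simp_all
  show ?case unfolding Dop_simps lf_simps diff.IH using a cl by algebra
qed

subsection \<open>The coefficient of the identity\<close>

definition Dl :: "'i list set list \<Rightarrow> 'i gen falg set" where
  "Dl l = foldr (\<lambda>t x. Dr t \<bullet> x) l \<^bold>1"

lemma Dl_closed: "set l \<subseteq> T \<Longrightarrow> Dl l \<in> carrier R"
  by (induction l) (auto simp: Dl_def)

definition kap where "kap = lf Dl"

lemma kap_closed [simp]: "kap y \<in> carrier R"
  by (simp add: kap_def)

lemma kap_Dop:
  assumes "t \<in> T" "y \<in> MT" shows "kap (Dop t y) = Dr t \<bullet> kap y"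
proof -
  have r: "Dl (t # l) = Dr t \<bullet> Dl l" for l by (simp add: Dl_def)
  have i: "Dr t \<bullet> Dl (t # l) = Dl (t # l)" if "set l \<subseteq> T" for l
    using assms Dl_closed[OF that] by (simp add: r flip: H.m_assoc)
  have "kap (Dop t y) = \<^bold>0 \<bullet> lf (\<lambda>_. \<^bold>0) y \<^bold>+ Dr t \<bullet> kap y"
    unfolding kap_def by (rule lf_Dop) (use assms Dl_closed r i in simp_all)
  then show ?thesis using assms by simp
qed

text \<open>Multiplication by a \<open>Dr t\<close> on the left only touches the list and never the
  group component, hence linearity over \<open>DD\<close>.\<close>

lemma kap_op:
  "a \<in> DD \<Longrightarrow> y \<in> MT \<Longrightarrow> kap (op a y) = a \<bullet> kap y"
proof (induction a arbitrary: y rule: Dhat_induct)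
  case (uminus x)
  then show ?case by (simp add: op_uminus kap_def lf_simps H.l_minus Dhat_carrier)
next
  case (plus x x')
  then show ?case by (simp add: op_ops kap_def lf_simps H.l_distr Dhat_carrier)
next
  case (mult x x')
  then show ?case by (simp add: op_ops H.m_assoc Dhat_carrier)
qed (simp_all add: op_one op_Dr kap_Dop)

definition cf where "cf x = kap (op x e0)"

lemma kap_e0: "kap (frag_of ([], v)) = (if v = \<one>\<^bsub>W\<^esub> then \<^bold>1 else \<^bold>0)" if "v \<in> carrier W" for v
proof -
  have "Dl [] = \<^bold>1" by (simp add: Dl_def)
  then show ?thesis using that unfolding kap_def by (subst lf_basis) (auto simp: basis_def Dl_closed)
qed

lemma cf_closed [simp]: "cf x \<in> carrier R"
  by (simp add: cf_def)

text \<open>Uniqueness of the normal form in the shape used below: \<open>cf\<close> projects a sum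
  of terms a w onto its coefficient at the identity.\<close>

lemma cf_mult_wh:
  assumes "a \<in> DD" "w \<in> carrier W"
  shows "cf (a \<bullet> wh w) = (if w = \<one>\<^bsub>W\<^esub> then a else \<^bold>0)"
proof -
  have "Sop w e0 = frag_of ([], w)" using assms by (simp add: e0_def)
  then have "cf (a \<bullet> wh w) = a \<bullet> kap (frag_of ([], w))"
    using assms by (simp add: cf_def op_ops op_wh kap_op Dhat_carrier basis_def)
  then show ?thesis using assms by (simp add: kap_e0 Dhat_carrier)
qed

lemma cf_Dhat: "a \<in> DD \<Longrightarrow> cf a = a"
  using cf_mult_wh[of a "\<one>\<^bsub>W\<^esub>"] by (simp add: Dhat_carrier)

lemma cf_ops:
  "x \<in> carrier R \<Longrightarrow> y \<in> carrier R \<Longrightarrow> cf (x \<^bold>+ y) = cf x \<^bold>+ cf y"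
  "x \<in> carrier R \<Longrightarrow> cf (\<^bold>- x) = \<^bold>- cf x" "cf \<^bold>0 = \<^bold>0"
proof -
  show "x \<in> carrier R \<Longrightarrow> y \<in> carrier R \<Longrightarrow> cf (x \<^bold>+ y) = cf x \<^bold>+ cf y"
    "x \<in> carrier R \<Longrightarrow> cf (\<^bold>- x) = \<^bold>- cf x"
    by (simp_all add: cf_def op_ops op_uminus kap_def lf_simps)
  show "cf \<^bold>0 = \<^bold>0" by (simp add: cf_Dhat)
qed

subsection \<open>The action of the Coxeter group\<close>

definition Er :: "'i list set \<Rightarrow> 'i list set \<Rightarrow> 'i gen falg set" where
  "Er w t = (if flip w t then \<^bold>1 \<^bold>- Dr (conj w t) else Dr (conj w t))"

lemma Er_Dhat [simp]: "w \<in> carrier W \<Longrightarrow> t \<in> T \<Longrightarrow> Er w t \<in> DD"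
  by (simp add: Er_def)

lemma Er_closed [simp]: "w \<in> carrier W \<Longrightarrow> t \<in> T \<Longrightarrow> Er w t \<in> carrier R"
  by (simp add: Er_def)

lemma Er_idem:
  assumes "w \<in> carrier W" "t \<in> T" shows "Er w t \<bullet> Er w t = Er w t"
proof -
  have "(\<^bold>1 \<^bold>- d) \<bullet> (\<^bold>1 \<^bold>- d) = \<^bold>1 \<^bold>- d"
    if d: "d \<in> carrier R" "d \<bullet> d = d" for d
  proof -
    have "(\<^bold>1 \<^bold>- d) \<bullet> (\<^bold>1 \<^bold>- d) = \<^bold>1 \<^bold>- d \<^bold>- (d \<^bold>- d \<bullet> d)"
      using d(1) by (simp add: H.minus_eq H.l_distr H.r_distr H.l_minus H.r_minus H.minus_add H.a_ac)
    then show ?thesis using d by (simp add: H.minus_eq H.r_neg)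
  qed
  then show ?thesis using assms by (simp add: Er_def)
qed

definition El where "El w l = foldr (\<lambda>t x. Er w t \<bullet> x) l \<^bold>1"

lemma El_closed: "w \<in> carrier W \<Longrightarrow> set l \<subseteq> T \<Longrightarrow> El w l \<in> carrier R"
  by (induction l) (auto simp: El_def)

text \<open>The letters D_t in the normal form of \<open>x\<close> are replaced by
  \<open>Er w t\<close>. As these values are again idempotent, the substitution respects the only
  relation among the letters.\<close>

definition aw :: "'i list set \<Rightarrow> 'i gen falg set \<Rightarrow> 'i gen falg set" where
  "aw w x = lf (El w) (op x e0)"

lemma aw_closed [simp]: "aw w x \<in> carrier R"
  by (simp add: aw_def)

lemma lf_El_Dop:
  assumes w: "w \<in> carrier W" and "t \<in> T" "y \<in> MT"
  shows "lf (El w) (Dop t y) = Er w t \<bullet> lf (El w) y"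
proof -
  have r: "El w (t # l) = Er w t \<bullet> El w l" for l by (simp add: El_def)
  have i: "Er w t \<bullet> El w (t # l) = El w (t # l)" if "set l \<subseteq> T" for l
    using assms El_closed[OF w that] by (simp add: r Er_idem flip: H.m_assoc)
  have "lf (El w) (Dop t y) = \<^bold>0 \<bullet> lf (\<lambda>_. \<^bold>0) y \<^bold>+ Er w t \<bullet> lf (El w) y"
    by (rule lf_Dop) (use assms El_closed r i in simp_all)
  then show ?thesis using assms by simp
qed

lemma lf_e0: "f [] \<in> carrier R \<Longrightarrow> lf f e0 = f []"
  unfolding lf_def e0_def by (subst lift_of) simp_all

lemma lf_El_e0: "lf (El w) e0 = \<^bold>1"
  by (subst lf_e0) (simp_all add: El_def)

text \<open>Stated for a general vector so that the induction passes through products; the vector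
  \<open>op y e0\<close> turns it into multiplicativity of \<open>aw w\<close>.\<close>

lemma lf_El_op:
  assumes "a \<in> DD" "w \<in> carrier W" "y \<in> MT"
  shows "lf (El w) (op a y) = aw w a \<bullet> lf (El w) y"
  using assms
proof (induction a arbitrary: y rule: Dhat_induct)
  case one
  then show ?case by (simp add: aw_def op_one lf_El_e0)
next
  case (Dr t)
  then show ?case by (simp add: aw_def op_Dr lf_El_Dop lf_El_e0)
next
  case (uminus x)
  then show ?case
    by (simp add: aw_def[of w "\<^bold>- x"] op_uminus lf_simps lf_El_e0 H.l_minus Dhat_carrier)
next
  case (plus x x')
  then show ?case
    by (simp add: aw_def[of w "x \<^bold>+ x'"] op_ops lf_simps lf_El_e0 H.l_distr Dhat_carrier)
next
  case (mult x x')
  have "lf (El w) (op (x \<bullet> x') y) = aw w x \<bullet> (aw w x' \<bullet> lf (El w) y)" if "y \<in> MT" for y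
    using mult that by (simp add: op_ops Dhat_carrier)
  from this[OF mult.prems(2)] this[OF e0_MT] show ?case
    by (simp add: aw_def[of w "x \<bullet> x'"] lf_El_e0 H.m_assoc)
qed

lemma aw_simps:
  assumes "w \<in> carrier W"
  shows "aw w \<^bold>1 = \<^bold>1" "aw w \<^bold>0 = \<^bold>0"
    and "t \<in> T \<Longrightarrow> aw w (Dr t) = Er w t"
    and "x \<in> DD \<Longrightarrow> aw w (\<^bold>- x) = \<^bold>- aw w x"
    and "x \<in> DD \<Longrightarrow> y \<in> DD \<Longrightarrow> aw w (x \<^bold>+ y) = aw w x \<^bold>+ aw w y"
    and "x \<in> DD \<Longrightarrow> y \<in> DD \<Longrightarrow> aw w (x \<^bold>- y) = aw w x \<^bold>- aw w y"
    and "x \<in> DD \<Longrightarrow> y \<in> DD \<Longrightarrow> aw w (x \<bullet> y) = aw w x \<bullet> aw w y"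
proof -
  show 1: "aw w \<^bold>1 = \<^bold>1" by (simp add: aw_def op_one lf_El_e0)
  show "t \<in> T \<Longrightarrow> aw w (Dr t) = Er w t" using assms by (simp add: aw_def op_Dr lf_El_Dop lf_El_e0)
  show n: "aw w (\<^bold>- x) = \<^bold>- aw w x" if "x \<in> DD" for x
    using that by (simp add: aw_def op_uminus lf_simps Dhat_carrier)
  show p: "aw w (x \<^bold>+ y) = aw w x \<^bold>+ aw w y" if "x \<in> DD" "y \<in> DD" for x y
    using that by (simp add: aw_def op_ops lf_simps Dhat_carrier)
  show "aw w (x \<^bold>- y) = aw w x \<^bold>- aw w y" if "x \<in> DD" "y \<in> DD" for x y
    using that by (simp add: a_minus_def n p)
  have "aw w (\<^bold>1 \<^bold>+ \<^bold>- \<^bold>1) = \<^bold>0" by (subst p) (simp_all add: n 1 H.r_neg)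
  then show "aw w \<^bold>0 = \<^bold>0" by (simp add: H.r_neg)
  show "aw w (x \<bullet> y) = aw w x \<bullet> aw w y" if "x \<in> DD" "y \<in> DD" for x y
    using that lf_El_op[of x w "op y e0"] assms by (simp add: aw_def op_ops Dhat_carrier)
qed

lemma aw_Dhat [simp]: "x \<in> DD \<Longrightarrow> w \<in> carrier W \<Longrightarrow> aw w x \<in> DD"
  by (induction x rule: Dhat_induct) (simp_all add: aw_simps)

text \<open>Generators suffice. There signs compose by the cocycle rule, and two flips give 1 - (1 -
  D) = D.\<close>

lemma aw_mult:
  "x \<in> DD \<Longrightarrow> w \<in> carrier W \<Longrightarrow> v \<in> carrier W \<Longrightarrow> aw w (aw v x) = aw (w \<star> v) x"
proof (induction x rule: Dhat_induct)
  case (Dr t)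
  have "\<^bold>1 \<^bold>- (\<^bold>1 \<^bold>- a) = a" if "a \<in> carrier R" for a
    using that by algebra
  then show ?case using Dr by (simp add: aw_simps Er_def flip_mult conj_mult)
qed (simp_all add: aw_simps)

lemma aw_one: "x \<in> DD \<Longrightarrow> aw \<one>\<^bsub>W\<^esub> x = x"
  by (induction x rule: Dhat_induct) (simp_all add: aw_simps Er_def)

lemma aw_inv:
  assumes "x \<in> DD" "w \<in> carrier W"
  shows "aw w (aw (inv\<^bsub>W\<^esub> w) x) = x" "aw (inv\<^bsub>W\<^esub> w) (aw w x) = x"
  using assms by (simp_all add: aw_mult aw_one)

subsection \<open>The twisted derivations\<close>

text \<open>The twisted product rule unrolled along a word: d_s(D_t x) is x, counted only for s = t,
  plus s(D_t) d_s(x).\<close>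

primrec dlist :: "'i list set \<Rightarrow> 'i list set list \<Rightarrow> 'i gen falg set" where
  "dlist s [] = \<^bold>0"
| "dlist s (t # l) = (if s = t then \<^bold>1 else \<^bold>0) \<bullet> Dl l \<^bold>+ Er s t \<bullet> dlist s l"

lemma dlist_closed: "s \<in> T \<Longrightarrow> set l \<subseteq> T \<Longrightarrow> dlist s l \<in> carrier R"
  by (induction l) (auto simp: Dl_closed)

definition ds :: "'i list set \<Rightarrow> 'i gen falg set \<Rightarrow> 'i gen falg set" where
  "ds s x = lf (dlist s) (op x e0)"

lemma lf_dlist_Dop:
  assumes "s \<in> T" "t \<in> T" "y \<in> MT"
  shows "lf (dlist s) (Dop t y) =
    (if s = t then \<^bold>1 else \<^bold>0) \<bullet> kap y \<^bold>+ Er s t \<bullet> lf (dlist s) y"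
  unfolding kap_def
proof (rule lf_Dop)
  fix l assume l: "set l \<subseteq> T"
  have c: "Dr t \<in> carrier R" "Dl l \<in> carrier R" "dlist s l \<in> carrier R" "Er s t \<in> carrier R"
    using assms Dl_closed dlist_closed l by simp_all
  have r: "Dl (t # l) = Dr t \<bullet> Dl l" by (simp add: Dl_def)
  have e: "Er s t \<bullet> (Er s t \<bullet> dlist s l) = Er s t \<bullet> dlist s l"
    using c assms by (simp add: Er_idem flip: H.m_assoc)
  \<comment> \<open>Compatibility with D_t D_t = D_t. For s = t it rests on s(D_t) = 1 - D_t: the
    pieces of \<open>Dl l\<close> weighted by D_t and by 1 - D_t add up to
    \<open>Dl l\<close>.\<close>
  show "(if s = t then \<^bold>1 else \<^bold>0) \<bullet> Dl (t # l) \<^bold>+ Er s t \<bullet> dlist s (t # l) = dlist s (t # l)"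
  proof (cases "s = t")
    case True
    then have E: "Er s t = \<^bold>1 \<^bold>- Dr t" using assms by (simp add: Er_def flip_self)
    have "Dr t \<bullet> Dl l \<^bold>+ Er s t \<bullet> (Dl l \<^bold>+ Er s t \<bullet> dlist s l) =
        Dr t \<bullet> Dl l \<^bold>+ (Er s t \<bullet> Dl l \<^bold>+ Er s t \<bullet> dlist s l)"
      using c e by (simp add: H.r_distr)
    also have "\<dots> = Dl l \<^bold>+ Er s t \<bullet> dlist s l" unfolding E using c(1-3) by algebra
    finally show ?thesis using True c r by simp
  next
    case False
    then show ?thesis using c e r by simp
  qed
qed (use assms Dl_closed dlist_closed in simp_all)

lemma lf_dlist_e0: "lf (dlist s) e0 = \<^bold>0"
  by (subst lf_e0) simp_all

text \<open>The twisted product rule with a module vector as second factor: \<open>kap y\<close>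
  stands for that factor and \<open>lf (dlist s) y\<close> for its derivative. The induction over
  \<open>a\<close> needs this generality.\<close>

lemma lf_dlist_op:
  assumes "a \<in> DD" "s \<in> T" "y \<in> MT"
  shows "lf (dlist s) (op a y) = ds s a \<bullet> kap y \<^bold>+ aw s a \<bullet> lf (dlist s) y"
  using assms
proof (induction a arbitrary: y rule: Dhat_induct)
  case one
  then show ?case by (simp add: ds_def op_one lf_dlist_e0 aw_simps)
next
  case (Dr t)
  have "kap e0 = \<^bold>1" by (simp add: e0_def kap_e0)
  then show ?case using Dr by (simp add: ds_def op_Dr lf_dlist_Dop lf_dlist_e0 aw_simps)
next
  case (uminus x)
  have c: "ds s x \<in> carrier R" "aw s x \<in> carrier R" "kap y \<in> carrier R" "lf (dlist s) y \<in> carrier R"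
    by (simp_all add: ds_def aw_def)
  have "ds s (\<^bold>- x) = \<^bold>- ds s x" "lf (dlist s) (op (\<^bold>- x) y) = \<^bold>- lf (dlist s) (op x y)"
    using uminus.hyps uminus.prems by (simp_all add: ds_def op_uminus lf_simps Dhat_carrier)
  then show ?case using uminus c by (simp add: aw_simps H.l_minus H.minus_add)
next
  case (plus x x')
  have c: "ds s x \<in> carrier R" "aw s x \<in> carrier R" "ds s x' \<in> carrier R" "aw s x' \<in> carrier R"
    "kap y \<in> carrier R" "lf (dlist s) y \<in> carrier R"
    by (simp_all add: ds_def aw_def)
  have "ds s (x \<^bold>+ x') = ds s x \<^bold>+ ds s x'"
    "lf (dlist s) (op (x \<^bold>+ x') y) = lf (dlist s) (op x y) \<^bold>+ lf (dlist s) (op x' y)"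
    using plus.hyps plus.prems by (simp_all add: ds_def op_ops lf_simps Dhat_carrier)
  then show ?case using plus c by (simp add: aw_simps H.l_distr H.a_ac)
next
  case (mult x x')
  have c: "ds s x \<in> carrier R" "aw s x \<in> carrier R" "ds s x' \<in> carrier R" "aw s x' \<in> carrier R"
    "x' \<in> carrier R"
    using mult.hyps by (simp_all add: ds_def Dhat_carrier)
  have *: "lf (dlist s) (op (x \<bullet> x') y) = ds s x \<bullet> (x' \<bullet> kap y) \<^bold>+
      aw s x \<bullet> (ds s x' \<bullet> kap y \<^bold>+ aw s x' \<bullet> lf (dlist s) y)" if "y \<in> MT" for y
    using mult that by (simp add: op_ops kap_op Dhat_carrier)
  have k: "kap e0 = \<^bold>1" by (simp add: e0_def kap_e0)
  have d: "ds s (x \<bullet> x') = ds s x \<bullet> x' \<^bold>+ aw s x \<bullet> ds s x'"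
    unfolding ds_def[of s "x \<bullet> x'"] *[OF e0_MT] k lf_dlist_e0 using c by simp
  have a: "aw s (x \<bullet> x') = aw s x \<bullet> aw s x'" using mult by (simp add: aw_simps)
  have "kap y \<in> carrier R" "lf (dlist s) y \<in> carrier R" by simp_all
  then show ?case unfolding *[OF mult.prems(2)] d a
    using c by (simp add: H.l_distr H.r_distr H.m_assoc H.a_assoc)
qed

lemma ds_closed [simp]: "ds s x \<in> carrier R"
  by (simp add: ds_def)

lemma ds_simps:
  assumes "s \<in> T"
  shows "ds s \<^bold>1 = \<^bold>0" "ds s \<^bold>0 = \<^bold>0"
    and "t \<in> T \<Longrightarrow> ds s (Dr t) = (if s = t then \<^bold>1 else \<^bold>0)"
    and "x \<in> DD \<Longrightarrow> ds s (\<^bold>- x) = \<^bold>- ds s x"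
    and "x \<in> DD \<Longrightarrow> y \<in> DD \<Longrightarrow> ds s (x \<^bold>+ y) = ds s x \<^bold>+ ds s y"
    and "x \<in> DD \<Longrightarrow> y \<in> DD \<Longrightarrow> ds s (x \<^bold>- y) = ds s x \<^bold>- ds s y"
    and "x \<in> DD \<Longrightarrow> y \<in> DD \<Longrightarrow> ds s (x \<bullet> y) = ds s x \<bullet> y \<^bold>+ aw s x \<bullet> ds s y"
proof -
  have k: "kap e0 = \<^bold>1" by (simp add: e0_def kap_e0)
  show 1: "ds s \<^bold>1 = \<^bold>0" by (simp add: ds_def op_one lf_dlist_e0)
  show "t \<in> T \<Longrightarrow> ds s (Dr t) = (if s = t then \<^bold>1 else \<^bold>0)"
    using assms by (simp add: ds_def op_Dr lf_dlist_Dop lf_dlist_e0 k)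
  show n: "ds s (\<^bold>- x) = \<^bold>- ds s x" if "x \<in> DD" for x
    using that by (simp add: ds_def op_uminus lf_simps Dhat_carrier)
  show p: "ds s (x \<^bold>+ y) = ds s x \<^bold>+ ds s y" if "x \<in> DD" "y \<in> DD" for x y
    using that by (simp add: ds_def op_ops lf_simps Dhat_carrier)
  show "ds s (x \<^bold>- y) = ds s x \<^bold>- ds s y" if "x \<in> DD" "y \<in> DD" for x y
    using that by (simp add: a_minus_def n p)
  have "ds s (\<^bold>1 \<^bold>+ \<^bold>- \<^bold>1) = \<^bold>0" by (subst p) (simp_all add: n 1)
  then show "ds s \<^bold>0 = \<^bold>0" by (simp add: H.r_neg)
  show "ds s (x \<bullet> y) = ds s x \<bullet> y \<^bold>+ aw s x \<bullet> ds s y" if "x \<in> DD" "y \<in> DD" for x y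
    using that lf_dlist_op[of x s "op y e0"] kap_op[of y e0] assms
    by (simp add: ds_def[of s "x \<bullet> y"] ds_def[of s y, symmetric] k op_ops Dhat_carrier)
qed

lemma ds_Dhat [simp]: "x \<in> DD \<Longrightarrow> s \<in> T \<Longrightarrow> ds s x \<in> DD"
  by (induction x rule: Dhat_induct) (simp_all add: ds_simps)

text \<open>Pushing s_i through a product one factor at a time reproduces the twisted product rule,
  so the generators decide.\<close>

lemma sh_Dhat:
  assumes "x \<in> DD" "i \<in> I"
  shows "sh i \<bullet> x = aw (gen i) x \<bullet> sh i \<^bold>- ds (gen i) x"
  using assms
proof (induction x rule: Dhat_induct)
  case one
  then show ?case by (simp add: aw_simps ds_simps H.minus_eq)
next
  case (Dr t)
  show ?case
  proof (cases "t = gen i")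
    case True
    then show ?thesis using Dr wh_Dr_neg[of "gen i" "gen i"]
      by (simp add: aw_simps ds_simps Er_def flip_gen wh_gen)
  next
    case False
    then show ?thesis using Dr wh_Dr_pos[of "gen i" t]
      by (simp add: aw_simps ds_simps Er_def flip_gen wh_gen H.minus_eq)
  qed
next
  case (uminus x)
  have c: "sh i \<in> carrier R" "x \<in> carrier R" "aw (gen i) x \<in> carrier R" "ds (gen i) x \<in> carrier R"
    using uminus by (simp_all add: Dhat_carrier)
  have "sh i \<bullet> (\<^bold>- x) = \<^bold>- (sh i \<bullet> x)" using c by algebra
  also have "\<dots> = (\<^bold>- aw (gen i) x) \<bullet> sh i \<^bold>- (\<^bold>- ds (gen i) x)"
    unfolding uminus.IH[OF uminus.prems] using c by algebra
  finally show ?case using uminus by (simp add: aw_simps ds_simps)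
next
  case (plus x y)
  have c: "sh i \<in> carrier R" "x \<in> carrier R" "aw (gen i) x \<in> carrier R" "ds (gen i) x \<in> carrier R"
    "y \<in> carrier R" "aw (gen i) y \<in> carrier R" "ds (gen i) y \<in> carrier R"
    using plus by (simp_all add: Dhat_carrier)
  have "sh i \<bullet> (x \<^bold>+ y) = sh i \<bullet> x \<^bold>+ sh i \<bullet> y" using c by algebra
  also have "\<dots> = (aw (gen i) x \<^bold>+ aw (gen i) y) \<bullet> sh i \<^bold>- (ds (gen i) x \<^bold>+ ds (gen i) y)"
    unfolding plus.IH(1)[OF plus.prems] plus.IH(2)[OF plus.prems] using c by algebra
  finally show ?case using plus by (simp add: aw_simps ds_simps)
next
  case (mult x y)
  have c: "sh i \<in> carrier R" "x \<in> carrier R" "aw (gen i) x \<in> carrier R" "ds (gen i) x \<in> carrier R"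
    "y \<in> carrier R" "aw (gen i) y \<in> carrier R" "ds (gen i) y \<in> carrier R"
    using mult by (simp_all add: Dhat_carrier)
  have "sh i \<bullet> (x \<bullet> y) = (sh i \<bullet> x) \<bullet> y" using c by algebra
  also have "\<dots> = aw (gen i) x \<bullet> (sh i \<bullet> y) \<^bold>- ds (gen i) x \<bullet> y"
    unfolding mult.IH(1)[OF mult.prems] using c by algebra
  also have "\<dots> = aw (gen i) x \<bullet> aw (gen i) y \<bullet> sh i \<^bold>-
      (ds (gen i) x \<bullet> y \<^bold>+ aw (gen i) x \<bullet> ds (gen i) y)"
    unfolding mult.IH(2)[OF mult.prems] using c by algebra
  finally show ?case using mult by (simp add: aw_simps ds_simps)
qed

text \<open>Up to sign both sides are derivations with the same twist, hence determined on
  generators. The sign appears because a flipping \<open>w\<close> gives 1 - D_s in place of D_s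
  inside d_s.\<close>

lemma ds_conj:
  assumes "x \<in> DD" "w \<in> carrier W" "s \<in> T"
  shows "ds (conj w s) x = (if flip w s then \<^bold>- aw w (ds s (aw (inv\<^bsub>W\<^esub> w) x)) else aw w (ds s (aw (inv\<^bsub>W\<^esub> w) x)))"
    (is "_ = ?d x")
  using assms(1)
proof (induction x rule: Dhat_induct)
  case (Dr t)
  have "(conj w s = t) = (s = conj (inv\<^bsub>W\<^esub> w) t)" using assms Dr conj_eq_iff by simp
  moreover have "flip (inv\<^bsub>W\<^esub> w) t = flip w s" if "conj w s = t"
    using that flip_inv[of w s] assms by auto
  ultimately show ?case using assms Dr
    by (auto simp: ds_simps aw_simps Er_def H.minus_eq)
next
  case (uminus x)
  then show ?case using assms by (simp add: ds_simps aw_simps)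
next
  case (plus x y)
  then show ?case using assms by (simp add: ds_simps aw_simps Dhat_carrier H.minus_add)
next
  case (mult x y)
  let ?v = "inv\<^bsub>W\<^esub> w"
  have c: "x \<in> carrier R" "y \<in> carrier R" "aw (conj w s) x \<in> carrier R"
    "aw w (ds s (aw ?v x)) \<in> carrier R" "aw w (ds s (aw ?v y)) \<in> carrier R"
    using assms mult by (simp_all add: Dhat_carrier)
  have "aw w (aw s (aw ?v x)) = aw (conj w s) x"
    using assms mult by (simp add: aw_mult conj_def W.m_assoc)
  then have e: "aw w (ds s (aw ?v (x \<bullet> y))) =
      aw w (ds s (aw ?v x)) \<bullet> y \<^bold>+ aw (conj w s) x \<bullet> aw w (ds s (aw ?v y))"
    using assms mult by (simp add: ds_simps aw_simps aw_inv)
  have "ds (conj w s) (x \<bullet> y) = ?d x \<bullet> y \<^bold>+ aw (conj w s) x \<bullet> ?d y"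
    using mult assms by (simp add: ds_simps)
  also have "\<dots> = ?d (x \<bullet> y)"
    unfolding e using c by (simp add: H.l_minus H.r_minus H.minus_add)
  finally show ?case .
qed (use assms in \<open>simp add: ds_simps aw_simps\<close>)

end

section \<open>Conjugation-stable elements\<close>

context coxeter begin

lemma generate_gens:
  assumes "J \<subseteq> I" "v \<in> generate W (gen ` J)"
  obtains u where "set u \<subseteq> J" "v = ev u"
proof -
  have "\<exists>u. set u \<subseteq> J \<and> v = ev u"
    using assms(2)
  proof (induction v rule: generate.induct)
    case one
    then show ?case by (intro exI[of _ "[]"]) (simp add: W_one)
  next
    case (incl h)
    then obtain j where "j \<in> J" "h = gen j" by blast
    then show ?case by (intro exI[of _ "[j]"]) (simp add: cox_gen_def)
  next
    case (inv h)
    then obtain j where "j \<in> J" "h = gen j" by blast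
    then show ?case using assms(1) by (intro exI[of _ "[j]"]) (auto simp: cox_gen_def inv_ev)
  next
    case (eng h1 h2)
    then obtain u v where "set u \<subseteq> J" "h1 = ev u" "set v \<subseteq> J" "h2 = ev v" by blast
    then show ?case using assms(1) by (intro exI[of _ "u @ v"]) (auto simp: W_mult)
  qed
  then show thesis using that by blast
qed

lemma ev_generate:
  assumes "J \<subseteq> I" "set u \<subseteq> J" shows "ev u \<in> generate W (gen ` J)"
  using assms(2)
proof (induction u)
  case Nil
  show ?case using generate.one[of W] by (simp add: W_one)
next
  case (Cons j u)
  then have "gen j \<star> ev u \<in> generate W (gen ` J)" by (auto intro: generate.intros)
  moreover have "j \<in> I" "set u \<subseteq> I" using Cons.prems assms(1) by auto
  ultimately show ?case by (simp add: gen_mult_ev)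
qed

lemma generate_all: "generate W (gen ` I) = carrier W"
proof
  show "generate W (gen ` I) \<subseteq> carrier W" by (rule W.generate_incl) auto
  show "carrier W \<subseteq> generate W (gen ` I)" using ev_generate[of I] W_cases by (metis subsetI order_refl)
qed

section \<open>Elements killed by all twisted derivations\<close>

definition Zd where "Zd = {x \<in> DD. \<forall>s\<in>T. ds s x = \<^bold>0}"

lemma Zd_DD: "x \<in> Zd \<Longrightarrow> x \<in> DD" "x \<in> Zd \<Longrightarrow> x \<in> carrier R"
  by (simp_all add: Zd_def) (blast intro: Dhat_carrier)

lemma aw_Zd [simp]:
  assumes "x \<in> Zd" "w \<in> carrier W" shows "aw w x \<in> Zd"
proof -
  have "ds s (aw w x) = \<^bold>0" if "s \<in> T" for s
  proof -
    have "s = conj w (conj (inv\<^bsub>W\<^esub> w) s)" using assms that by simp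
    then show ?thesis
      using ds_conj[of "aw w x" w "conj (inv\<^bsub>W\<^esub> w) s"] assms that
      by (simp add: Zd_def aw_inv aw_simps)
  qed
  then show ?thesis using assms by (simp add: Zd_def)
qed

text \<open>With all derivations zero, \<open>sh_Dhat\<close> loses its second term, and the letters
  of \<open>w\<close> pass one after the other.\<close>

lemma Zd_conj:
  assumes "x \<in> Zd" "w \<in> carrier W"
  shows "wh w \<bullet> x = aw w x \<bullet> wh w"
  using assms(2)
proof (induction w rule: W_induct)
  case one
  then show ?case using Zd_DD[OF assms(1)] by (simp add: aw_one)
next
  case (gen i w)
  let ?s = "cox_gen I m i"
  have z: "aw w x \<in> DD" "ds ?s (aw w x) = \<^bold>0" "x \<in> DD"
    using aw_Zd[OF assms(1) gen.hyps(2)] gen.hyps(1) assms(1) by (auto simp: Zd_def)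
  then have s: "sh i \<bullet> aw w x = aw ?s (aw w x) \<bullet> sh i"
    using sh_Dhat[of "aw w x" i] gen.hyps(1) by (simp add: H.minus_eq)
  have "wh (?s \<star> w) \<bullet> x = sh i \<bullet> (wh w \<bullet> x)"
    using gen.hyps z by (simp add: wh_gen H.m_assoc Dhat_carrier flip: wh_mult)
  also have "\<dots> = (sh i \<bullet> aw w x) \<bullet> wh w"
    unfolding gen.IH using gen.hyps by (simp add: H.m_assoc)
  also have "\<dots> = aw (?s \<star> w) x \<bullet> wh (?s \<star> w)"
    unfolding s using gen.hyps z by (simp add: wh_gen H.m_assoc aw_mult flip: wh_mult)
  finally show ?case .
qed

lemma K_alg_iff:
  "x \<in> K_alg I m V \<longleftrightarrow> (\<forall>w\<in>V. \<exists>y\<in>Dhat I m V. x = wh w \<bullet> y \<bullet> wh (inv\<^bsub>W\<^esub> w))"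
  unfolding K_alg_def by auto

text \<open>Conjugation by a generator s of V keeps the element in \<open>DD\<close>; since s x s =
  s(x) - d_s(x) s, uniqueness of the normal form forces d_s(x) = 0. The other reflections of V are
  conjugates of such generators. Used for J = I and for two-element J.\<close>

lemma K_alg_Zd:
  assumes "J \<subseteq> I" "V = generate W (gen ` J)" "x \<in> K_alg I m V"
  shows "x \<in> Zd" "x \<in> Dhat I m V"
proof -
  have V: "subgroup V W" unfolding assms(2) by (rule W.generate_is_subgroup) (use assms(1) in auto)
  have VW: "v \<in> carrier W" if "v \<in> V" for v using that subgroup.subset[OF V] by blast
  have K_Dhat: "y \<in> Dhat I m V" if y: "y \<in> K_alg I m V" for y
  proof -
    obtain z where "z \<in> Dhat I m V" "y = wh \<one>\<^bsub>W\<^esub> \<bullet> z \<bullet> wh (inv\<^bsub>W\<^esub> \<one>\<^bsub>W\<^esub>)"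
      using y subgroup.one_closed[OF V] unfolding K_alg_iff by blast
    then show ?thesis by (simp add: Dhat_carrier)
  qed
  then show "x \<in> Dhat I m V" using assms(3) by blast
  have K_conj: "wh v \<bullet> y \<bullet> wh (inv\<^bsub>W\<^esub> v) \<in> K_alg I m V" if y: "y \<in> K_alg I m V" and v: "v \<in> V" for y v
    unfolding K_alg_iff
  proof
    fix w assume w: "w \<in> V"
    let ?u = "inv\<^bsub>W\<^esub> v \<star> w"
    have "?u \<in> V" using v w subgroup.m_closed[OF V] subgroup.m_inv_closed[OF V] by blast
    then obtain z where z: "z \<in> Dhat I m V" "y = wh ?u \<bullet> z \<bullet> wh (inv\<^bsub>W\<^esub> ?u)"
      using y unfolding K_alg_iff by blast
    have "wh v \<bullet> y \<bullet> wh (inv\<^bsub>W\<^esub> v) = wh w \<bullet> z \<bullet> wh (inv\<^bsub>W\<^esub> w)"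
      unfolding z(2) using VW[OF v] VW[OF w] z(1)
      by (simp add: H.m_assoc wh_mult_assoc wh_mult W.m_assoc W.inv_mult_group Dhat_carrier)
    then show "\<exists>z\<in>Dhat I m V. wh v \<bullet> y \<bullet> wh (inv\<^bsub>W\<^esub> v) = wh w \<bullet> z \<bullet> wh (inv\<^bsub>W\<^esub> w)"
      using z(1) by blast
  qed
  have genV: "gen i \<in> V" if "i \<in> J" for i unfolding assms(2) using that by (simp add: generate.incl)
  have step: "ds (gen i) y = \<^bold>0 \<and> aw (gen i) y \<in> K_alg I m V"
    if y: "y \<in> K_alg I m V" and i: "i \<in> J" for y i
  proof -
    have iI: "i \<in> I" using i assms(1) by blast
    have yD: "y \<in> DD" using K_Dhat[OF y] by (rule Dhat_mono)
    let ?z = "sh i \<bullet> y \<bullet> sh i" and ?d = "ds (gen i) y"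
    have zK: "?z \<in> K_alg I m V" using K_conj[OF y genV[OF i]] iI by (simp add: wh_gen)
    then have zD: "?z \<in> DD" using K_Dhat Dhat_mono by blast
    have c: "?d \<in> carrier R" "aw (gen i) y \<in> carrier R" "sh i \<in> carrier R" "?z \<in> carrier R"
      using zD iI by (simp_all add: Dhat_carrier)
    have "?z = (aw (gen i) y \<bullet> sh i \<^bold>- ?d) \<bullet> sh i" using sh_Dhat[OF yD iI] by simp
    also have "\<dots> = aw (gen i) y \<bullet> (sh i \<bullet> sh i) \<^bold>- ?d \<bullet> sh i"
      using c by algebra
    finally have e: "?z = aw (gen i) y \<^bold>- ?d \<bullet> sh i" using c iI by (simp add: sh_square)
    have gw: "gen i \<noteq> \<one>\<^bsub>W\<^esub>" by (rule gen_neq_one[OF iI])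
    \<comment> \<open>Reads off the coefficient at the identity: the summand along s contributes
      nothing, and \<open>?z\<close> lies in \<open>DD\<close>, so \<open>?z\<close> equals its own
      coefficient.\<close>
    have "cf ?z = aw (gen i) y"
      unfolding e using c yD iI gw cf_mult_wh[of ?d "gen i"]
      by (simp add: H.minus_eq cf_ops cf_Dhat wh_gen)
    then have z: "?z = aw (gen i) y" using cf_Dhat[OF zD] by simp
    then have "aw (gen i) y \<^bold>- ?d \<bullet> sh i = aw (gen i) y" using e by simp
    then have "?d \<bullet> sh i = \<^bold>0" using c
      by (metis H.m_closed H.minus_eq H.r_zero H.add.l_cancel H.a_inv_closed H.zero_closed H.minus_minus H.minus_zero)
    then have "?d \<bullet> (sh i \<bullet> sh i) = \<^bold>0" using c by (simp flip: H.m_assoc)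
    then have "?d = \<^bold>0" using c iI by (simp add: sh_square)
    then show ?thesis using zK z by simp
  qed
  have xD: "x \<in> DD" using assms(3) K_Dhat Dhat_mono by blast
  have awK: "aw (ev u) x \<in> K_alg I m V" if "set u \<subseteq> J" for u
    using that
  proof (induction u)
    case Nil
    then show ?case using assms(3) xD by (simp add: aw_one flip: W_one)
  next
    case (Cons i u)
    have I: "i \<in> I" "set u \<subseteq> I" using Cons.prems assms(1) by auto
    have "aw (gen i) (aw (ev u) x) \<in> K_alg I m V" using step Cons by simp
    then show ?case using I xD by (simp add: aw_mult gen_mult_ev)
  qed
  have "ds s x = \<^bold>0" if s: "s \<in> T" for s
  proof (cases "s \<in> V")
    case True
    then obtain u where u: "set u \<subseteq> J" "s = ev u" using generate_gens assms by metis
    have uI: "set u \<subseteq> I" using u assms(1) by blast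
    \<comment> \<open>Exchange applied to a word of \<open>s\<close> over \<open>J\<close> shows
      that \<open>s\<close> is a simple reflection from \<open>J\<close> conjugated by a word over
      \<open>J\<close>, so \<open>awK\<close> and \<open>step\<close> reach it.\<close>
    have "flips u s" using flip_self[OF s] flip_ev[OF uI] s u by simp
    then obtain a i b where ab: "u = a @ [i] @ b" "s = conj (ev (rev b)) (gen i)"
      using flips_delete[OF uI] s by (metis refl_closed)
    have I: "i \<in> J" "i \<in> I" "set b \<subseteq> J" "set b \<subseteq> I" using ab u uI by auto
    have "ds (gen i) (aw (ev b) x) = \<^bold>0" using awK[of b] step I by blast
    then show ?thesis
      using ds_conj[OF xD, of "ev (rev b)" "gen i"] I ab by (simp add: inv_ev aw_simps)
  next
    case False
    \<comment> \<open>Every generator \<open>Dr t\<close> of \<open>Dhat I m V\<close> has t in V,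
      hence t differs from s.\<close>
    have "ds s y = \<^bold>0" if "y \<in> Dhat I m V" for y
      using that
    proof (induction y rule: Dhat_induct)
      case (Dr t)
      then show ?case using False s by (auto simp: ds_simps)
    next
      case (uminus x)
      then show ?case using s Dhat_mono by (simp add: ds_simps)
    next
      case (plus x y)
      then show ?case using s Dhat_mono by (simp add: ds_simps)
    next
      case (mult x y)
      then show ?case using s Dhat_mono by (simp add: ds_simps Dhat_carrier)
    qed (use s in \<open>simp add: ds_simps\<close>)
    then show ?thesis using assms(3) K_Dhat by blast
  qed
  then show "x \<in> Zd" using xD by (simp add: Zd_def)
qed

section \<open>Ideals generated by stable elements\<close>

definition asub :: "'i gen falg set set \<Rightarrow> bool" where
  "asub S \<longleftrightarrow> \<^bold>0 \<in> S \<and> (\<forall>x\<in>S. \<^bold>- x \<in> S) \<and> (\<forall>x\<in>S. \<forall>y\<in>S. x \<^bold>+ y \<in> S)"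

definition aspan :: "'i gen falg set set \<Rightarrow> 'i gen falg set set" where
  "aspan B = \<Inter>{S. B \<subseteq> S \<and> asub S}"

lemma aspan_intros:
  "\<^bold>0 \<in> aspan B" "x \<in> B \<Longrightarrow> x \<in> aspan B" "x \<in> aspan B \<Longrightarrow> \<^bold>- x \<in> aspan B"
  "x \<in> aspan B \<Longrightarrow> y \<in> aspan B \<Longrightarrow> x \<^bold>+ y \<in> aspan B"
  unfolding aspan_def asub_def by blast+

lemma aspan_incl: "B \<subseteq> aspan B"
  by (intro subsetI aspan_intros(2))

lemma aspan_subset:
  assumes "B \<subseteq> S" "\<^bold>0 \<in> S" "\<And>x. x \<in> S \<Longrightarrow> \<^bold>- x \<in> S" "\<And>x y. x \<in> S \<Longrightarrow> y \<in> S \<Longrightarrow> x \<^bold>+ y \<in> S"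
  shows "aspan B \<subseteq> S"
proof -
  have "asub S" using assms by (simp add: asub_def)
  then show ?thesis using assms(1) unfolding aspan_def by blast
qed

lemma aspan_map:
  assumes "x \<in> aspan B" "B \<subseteq> S" "aspan B \<subseteq> S"
    and "f \<^bold>0 = \<^bold>0" "\<And>x. x \<in> S \<Longrightarrow> f (\<^bold>- x) = \<^bold>- f x"
    and "\<And>x y. x \<in> S \<Longrightarrow> y \<in> S \<Longrightarrow> f (x \<^bold>+ y) = f x \<^bold>+ f y"
    and "\<And>x. x \<in> B \<Longrightarrow> f x \<in> aspan B'"
  shows "f x \<in> aspan B'"
proof -
  have "aspan B \<subseteq> {x \<in> aspan B. f x \<in> aspan B'}"
  proof (rule aspan_subset)
    fix x y assume "x \<in> {x \<in> aspan B. f x \<in> aspan B'}" "y \<in> {x \<in> aspan B. f x \<in> aspan B'}"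
    moreover from this have "x \<in> S" "y \<in> S" using assms(3) by auto
    ultimately show "x \<^bold>+ y \<in> {x \<in> aspan B. f x \<in> aspan B'}" "\<^bold>- x \<in> {x \<in> aspan B. f x \<in> aspan B'}"
      using assms(5,6) aspan_intros(3,4) by simp_all
  qed (use assms aspan_intros in auto)
  then show ?thesis using assms(1) by blast
qed

lemma R_induct [consumes 1, case_names one sh dh minus mult]:
  assumes "x \<in> carrier R" "P \<^bold>1" "\<And>i. i \<in> I \<Longrightarrow> P (sh i)" "\<And>i. i \<in> I \<Longrightarrow> P (dh i)"
    and "\<And>x y. x \<in> carrier R \<Longrightarrow> y \<in> carrier R \<Longrightarrow> P x \<Longrightarrow> P y \<Longrightarrow> P (x \<^bold>- y)"
    and "\<And>x y. x \<in> carrier R \<Longrightarrow> y \<in> carrier R \<Longrightarrow> P x \<Longrightarrow> P y \<Longrightarrow> P (x \<bullet> y)"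
  shows "P x"
proof -
  obtain p where p: "p \<in> carrier F" "x = hc p" using assms(1) frep by metis
  have "p \<in> carrier (free_algebra (SG ` I \<union> DG ` I))" using p by (simp add: HF_def)
  then have "p \<in> carrier F \<and> P (hc p)"
  proof (induction p rule: free_algebra_induct)
    case zero
    have "P (\<^bold>1 \<^bold>- \<^bold>1)" by (rule assms(5)) (simp_all add: assms(2))
    then show ?case by (simp add: H.minus_eq H.r_neg hc_ops)
  next
    case (mon xs)
    then show ?case
    proof (induction xs)
      case Nil
      then show ?case using assms(2) by (simp add: mon_Nil hc_ops)
    next
      case (Cons g xs)
      have "P (hc (mon [g]))" "hc (mon [g]) \<in> carrier R"
        using Cons.prems assms(3,4) by (auto simp: s_hat_def D_hat_def Hmon_def)
      then have "P (hc (mon [g]) \<bullet> hc (mon xs))" using Cons assms(6) by simp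
      then show ?case using Cons.prems by (simp add: hc_ops mon_mult)
    qed
  next
    case (diff p q)
    then have "P (hc p \<^bold>- hc q)" by (intro assms(5)) simp_all
    then show ?case using diff by (simp add: hc_ops)
  qed
  then show ?thesis using p by simp
qed

text \<open>The two-sided ideal of \<open>DD\<close> generated by all W-translates of
  \<open>G\<close>. Multiplied by group elements on the right it becomes \<open>JW\<close>, which
  will contain the ideal generated by \<open>G\<close> in the whole algebra.\<close>

definition JD where
  "JD G = aspan {a \<bullet> aw w k \<bullet> b | a w k b. a \<in> DD \<and> b \<in> DD \<and> w \<in> carrier W \<and> k \<in> G}"

definition JW where
  "JW G = aspan {b \<bullet> wh u | b u. b \<in> JD G \<and> u \<in> carrier W}"

context
  fixes G assumes G: "G \<subseteq> Zd"
begin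

lemma G_Zd: "k \<in> G \<Longrightarrow> k \<in> Zd" "k \<in> G \<Longrightarrow> k \<in> DD"
  using G by (auto simp: Zd_def)

lemma JD_DD: "JD G \<subseteq> DD"
  unfolding JD_def by (rule aspan_subset) (auto simp: G_Zd)

lemma JD_carrier: "x \<in> JD G \<Longrightarrow> x \<in> carrier R"
  using JD_DD Dhat_carrier by blast

lemma JD_ops: "x \<in> JD G \<Longrightarrow> \<^bold>- x \<in> JD G" "x \<in> JD G \<Longrightarrow> y \<in> JD G \<Longrightarrow> x \<^bold>+ y \<in> JD G"
  "\<^bold>0 \<in> JD G"
  unfolding JD_def by (auto intro: aspan_intros)

lemma JD_gen: "a \<in> DD \<Longrightarrow> b \<in> DD \<Longrightarrow> w \<in> carrier W \<Longrightarrow> k \<in> G \<Longrightarrow> a \<bullet> aw w k \<bullet> b \<in> JD G"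
  unfolding JD_def by (rule aspan_intros(2)) blast

lemma JD_map:
  assumes "x \<in> JD G" "f \<^bold>0 = \<^bold>0"
    and "\<And>x. x \<in> DD \<Longrightarrow> f (\<^bold>- x) = \<^bold>- f x"
    and "\<And>x y. x \<in> DD \<Longrightarrow> y \<in> DD \<Longrightarrow> f (x \<^bold>+ y) = f x \<^bold>+ f y"
    and gen: "\<And>a w k b. a \<in> DD \<Longrightarrow> b \<in> DD \<Longrightarrow> w \<in> carrier W \<Longrightarrow> k \<in> G \<Longrightarrow> f (a \<bullet> aw w k \<bullet> b) \<in> JD G"
  shows "f x \<in> JD G"
  unfolding JD_def
proof (rule aspan_map[OF assms(1)[unfolded JD_def], where S = DD])
  show "aspan {a \<bullet> aw w k \<bullet> b | a w k b. a \<in> DD \<and> b \<in> DD \<and> w \<in> carrier W \<and> k \<in> G} \<subseteq> DD"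
    using JD_DD by (simp only: JD_def)
qed (use assms gen[unfolded JD_def] G_Zd in auto)

lemma JD_left: "x \<in> JD G \<Longrightarrow> c \<in> DD \<Longrightarrow> c \<bullet> x \<in> JD G"
proof (rule JD_map[of x "\<lambda>x. c \<bullet> x"])
  fix a w k b assume "c \<in> DD" "a \<in> DD" "b \<in> DD" "w \<in> carrier W" "k \<in> G"
  then show "c \<bullet> (a \<bullet> aw w k \<bullet> b) \<in> JD G"
    using JD_gen[of "c \<bullet> a" b w k] by (simp add: H.m_assoc Dhat_carrier)
qed (simp_all add: Dhat_carrier H.r_minus H.r_distr)

lemma JD_right: "x \<in> JD G \<Longrightarrow> c \<in> DD \<Longrightarrow> x \<bullet> c \<in> JD G"
proof (rule JD_map[of x "\<lambda>x. x \<bullet> c"])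
  fix a w k b assume "c \<in> DD" "a \<in> DD" "b \<in> DD" "w \<in> carrier W" "k \<in> G"
  then show "a \<bullet> aw w k \<bullet> b \<bullet> c \<in> JD G"
    using JD_gen[of a "b \<bullet> c" w k] by (simp add: H.m_assoc Dhat_carrier)
qed (simp_all add: Dhat_carrier H.l_minus H.l_distr)

lemma JD_aw: "x \<in> JD G \<Longrightarrow> v \<in> carrier W \<Longrightarrow> aw v x \<in> JD G"
proof (rule JD_map[of x "aw v"])
  fix a w k b assume "v \<in> carrier W" "a \<in> DD" "b \<in> DD" "w \<in> carrier W" "k \<in> G"
  then show "aw v (a \<bullet> aw w k \<bullet> b) \<in> JD G"
    using JD_gen[of "aw v a" "aw v b" "v \<star> w" k] G_Zd by (simp add: aw_simps aw_mult)
qed (simp_all add: aw_simps)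

text \<open>The middle factor has derivative zero, so each of the two remaining terms of the product
  rule still contains a translate of \<open>k\<close>.\<close>

lemma JD_ds: "x \<in> JD G \<Longrightarrow> s \<in> T \<Longrightarrow> ds s x \<in> JD G"
proof (rule JD_map[of x "ds s"])
  fix a w k b assume *: "s \<in> T" "a \<in> DD" "b \<in> DD" "w \<in> carrier W" "k \<in> G"
  have z: "aw w k \<in> DD" "ds s (aw w k) = \<^bold>0" "k \<in> DD"
    using aw_Zd[of k w] G_Zd * by (auto simp: Zd_def)
  have "ds s (a \<bullet> aw w k \<bullet> b) = ds s a \<bullet> aw w k \<bullet> b \<^bold>+ aw s a \<bullet> aw (s \<star> w) k \<bullet> ds s b"
    using * z by (simp add: ds_simps aw_simps aw_mult Dhat_carrier)
  also have "\<dots> \<in> JD G" using * z by (intro JD_ops JD_gen) simp_all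
  finally show "ds s (a \<bullet> aw w k \<bullet> b) \<in> JD G" .
qed (simp_all add: ds_simps)

lemma JW_carrier: "JW G \<subseteq> carrier R"
  unfolding JW_def using JD_DD by (intro aspan_subset) (auto intro!: H.m_closed dest!: Dhat_carrier)

lemma JW_c: "x \<in> JW G \<Longrightarrow> x \<in> carrier R"
  using JW_carrier by blast

lemma JW_gen: "b \<in> JD G \<Longrightarrow> u \<in> carrier W \<Longrightarrow> b \<bullet> wh u \<in> JW G"
  unfolding JW_def by (rule aspan_intros(2)) blast

lemma JW_ops: "x \<in> JW G \<Longrightarrow> \<^bold>- x \<in> JW G" "x \<in> JW G \<Longrightarrow> y \<in> JW G \<Longrightarrow> x \<^bold>+ y \<in> JW G"
  "x \<in> JW G \<Longrightarrow> y \<in> JW G \<Longrightarrow> x \<^bold>- y \<in> JW G" "\<^bold>0 \<in> JW G"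
  unfolding JW_def a_minus_def by (auto intro: aspan_intros)

lemma JW_map:
  assumes "x \<in> JW G" "f \<^bold>0 = \<^bold>0"
    and "\<And>x. x \<in> carrier R \<Longrightarrow> f (\<^bold>- x) = \<^bold>- f x"
    and "\<And>x y. x \<in> carrier R \<Longrightarrow> y \<in> carrier R \<Longrightarrow> f (x \<^bold>+ y) = f x \<^bold>+ f y"
    and gen: "\<And>b u. b \<in> JD G \<Longrightarrow> u \<in> carrier W \<Longrightarrow> f (b \<bullet> wh u) \<in> JW G"
  shows "f x \<in> JW G"
  unfolding JW_def
proof (rule aspan_map[OF assms(1)[unfolded JW_def], where S = "carrier R"])
  show "aspan {b \<bullet> wh u | b u. b \<in> JD G \<and> u \<in> carrier W} \<subseteq> carrier R"
    using JW_carrier by (simp only: JW_def)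
  then show "{b \<bullet> wh u | b u. b \<in> JD G \<and> u \<in> carrier W} \<subseteq> carrier R"
    by (rule order_trans[OF aspan_incl])
  fix y assume "y \<in> {b \<bullet> wh u | b u. b \<in> JD G \<and> u \<in> carrier W}"
  then obtain b u where "y = b \<bullet> wh u" "b \<in> JD G" "u \<in> carrier W" by blast
  then show "f y \<in> aspan {b \<bullet> wh u | b u. b \<in> JD G \<and> u \<in> carrier W}"
    using gen by (simp only: JW_def)
qed (use assms in simp_all)

text \<open>Moving s_i past an element b of \<open>JD G\<close> produces s_i(b) and d_i(b);
  stability of \<open>JD G\<close> under both is exactly what is used.\<close>

lemma JW_left: "c \<in> carrier R \<Longrightarrow> x \<in> JW G \<Longrightarrow> c \<bullet> x \<in> JW G"
proof (induction c arbitrary: x rule: R_induct)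
  case one
  then show ?case by (simp add: JW_c)
next
  case (sh i)
  show ?case
  proof (rule JW_map[OF sh(2)])
    fix b u assume b: "b \<in> JD G" and u: "u \<in> carrier W"
    have bD: "b \<in> DD" using b JD_DD by blast
    have "sh i \<bullet> (b \<bullet> wh u) = (aw (gen i) b \<bullet> sh i \<^bold>- ds (gen i) b) \<bullet> wh u"
      using u sh(1) bD by (simp add: Dhat_carrier flip: H.m_assoc sh_Dhat)
    also have "\<dots> = aw (gen i) b \<bullet> wh (gen i \<star> u) \<^bold>- ds (gen i) b \<bullet> wh u"
      using u sh(1) by (simp add: H.minus_eq H.l_distr H.l_minus H.m_assoc wh_gen flip: wh_mult)
    also have "\<dots> \<in> JW G" using b u sh(1) by (intro JW_ops JW_gen JD_aw JD_ds) simp_all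
    finally show "sh i \<bullet> (b \<bullet> wh u) \<in> JW G" .
  qed (use sh in \<open>simp_all add: H.r_minus H.r_distr\<close>)
next
  case (dh i)
  show ?case
  proof (rule JW_map[OF dh(2)])
    fix b u assume b: "b \<in> JD G" and u: "u \<in> carrier W"
    have "dh i \<in> DD" using Dr_gen[OF dh(1)] dh(1) Dhat_closed(3)[of "gen i" "carrier W"] by simp
    then have "dh i \<bullet> b \<bullet> wh u \<in> JW G" using b u by (intro JW_gen JD_left)
    then show "dh i \<bullet> (b \<bullet> wh u) \<in> JW G"
      using b u dh(1) by (simp add: H.m_assoc JD_carrier)
  qed (use dh in \<open>simp_all add: H.r_minus H.r_distr\<close>)
next
  case (minus c d)
  then have "c \<bullet> x \<^bold>- d \<bullet> x \<in> JW G" by (intro JW_ops) simp_all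
  then show ?case using minus by (simp add: H.minus_eq H.l_distr H.l_minus JW_c)
next
  case (mult c d)
  then show ?case by (simp add: H.m_assoc JW_c)
qed

text \<open>Moving D_i leftwards past \<open>u\<close> turns it into an element of
  \<open>DD\<close>, possibly with a correction in the group; right multiples of \<open>JD G\<close>
  absorb it.\<close>

lemma JW_right: "c \<in> carrier R \<Longrightarrow> x \<in> JW G \<Longrightarrow> x \<bullet> c \<in> JW G"
proof (induction c arbitrary: x rule: R_induct)
  case one
  then show ?case by (simp add: JW_c)
next
  case (sh i)
  show ?case
  proof (rule JW_map[OF sh(2)])
    fix b u assume b: "b \<in> JD G" and u: "u \<in> carrier W"
    have "b \<bullet> wh (u \<star> gen i) \<in> JW G" using b u sh(1) by (intro JW_gen) simp_all
    then show "b \<bullet> wh u \<bullet> sh i \<in> JW G"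
      using b u sh(1) by (simp add: H.m_assoc JD_carrier wh_gen flip: wh_mult)
  qed (use sh in \<open>simp_all add: H.l_minus H.l_distr\<close>)
next
  case (dh i)
  show ?case
  proof (rule JW_map[OF dh(2)])
    fix b u assume b: "b \<in> JD G" and u: "u \<in> carrier W"
    have bc: "b \<in> carrier R" using b JD_DD Dhat_carrier by blast
    let ?t = "conj u (gen i)"
    have t: "?t \<in> T" using u dh(1) by simp
    have "b \<bullet> (wh u \<bullet> Dr (gen i)) \<in> JW G"
    proof (cases "flip u (gen i)")
      case True
      have "b \<bullet> (wh u \<bullet> Dr (gen i)) = b \<bullet> (\<^bold>1 \<^bold>- Dr ?t) \<bullet> wh u \<^bold>- b \<bullet> wh (u \<star> gen i)"
        using wh_Dr_neg[OF u _ True] dh(1) bc u t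
        by (simp add: H.minus_eq H.r_distr H.l_distr H.r_minus H.l_minus H.m_assoc)
      also have "\<dots> \<in> JW G" using b u t dh(1) by (intro JW_ops JW_gen JD_right) simp_all
      finally show ?thesis .
    next
      case False
      have "b \<bullet> (wh u \<bullet> Dr (gen i)) = b \<bullet> Dr ?t \<bullet> wh u"
        using wh_Dr_pos[OF u _ False] dh(1) bc u t by (simp add: H.m_assoc)
      also have "\<dots> \<in> JW G" using b u t by (intro JW_gen JD_right) simp_all
      finally show ?thesis .
    qed
    then show "b \<bullet> wh u \<bullet> dh i \<in> JW G" using bc u dh(1) by (simp add: H.m_assoc Dr_gen)
  qed (use dh in \<open>simp_all add: H.l_minus H.l_distr\<close>)
next
  case (minus c d)
  then have "x \<bullet> c \<^bold>- x \<bullet> d \<in> JW G" by (intro JW_ops) simp_all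
  then show ?case using minus by (simp add: H.minus_eq H.r_distr H.r_minus JW_c)
next
  case (mult c d)
  then show ?case by (simp add: JW_c flip: H.m_assoc)
qed

lemma G_carrier: "G \<subseteq> carrier R"
  using G_Zd Dhat_carrier by blast

lemma genideal_JW: "genideal R G \<subseteq> JW G"
proof (rule H.genideal_minimal)
  show "ideal (JW G) R"
    by (rule H.ideal_intro) (rule JW_carrier JW_ops JW_left JW_right; assumption)+
  show "G \<subseteq> JW G"
  proof
    fix k assume k: "k \<in> G"
    then have "\<^bold>1 \<bullet> aw \<one>\<^bsub>W\<^esub> k \<bullet> \<^bold>1 \<bullet> wh \<one>\<^bsub>W\<^esub> \<in> JW G" by (intro JW_gen JD_gen) simp_all
    then show "k \<in> JW G" using G_Zd(2)[OF k] Zd_DD(2)[OF G_Zd(1)[OF k]] by (simp add: aw_one)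
  qed
qed

text \<open>The projection \<open>cf\<close> maps \<open>JW G\<close> into \<open>JD G\<close> and
  fixes \<open>DD\<close>, so an element of \<open>DD\<close> in the large ideal already lies in the
  small one.\<close>

lemma genideal_Dhat:
  assumes "x \<in> genideal R G" "x \<in> DD" shows "x \<in> JD G"
proof -
  have "cf x \<in> JD G"
    unfolding JD_def
  proof (rule aspan_map[where f = cf and S = "carrier R"])
    show "x \<in> aspan {b \<bullet> wh u | b u. b \<in> JD G \<and> u \<in> carrier W}"
      using assms genideal_JW by (auto simp: JW_def)
    show "aspan {b \<bullet> wh u | b u. b \<in> JD G \<and> u \<in> carrier W} \<subseteq> carrier R"
      using JW_carrier by (simp only: JW_def)
    then show "{b \<bullet> wh u | b u. b \<in> JD G \<and> u \<in> carrier W} \<subseteq> carrier R"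
      by (rule order_trans[OF aspan_incl])
    fix y assume "y \<in> {b \<bullet> wh u | b u. b \<in> JD G \<and> u \<in> carrier W}"
    then obtain b u where "y = b \<bullet> wh u" "b \<in> JD G" "u \<in> carrier W" by blast
    moreover have "b \<in> DD" using calculation JD_DD by blast
    ultimately have "cf y \<in> JD G" using JD_ops(3) by (simp add: cf_mult_wh)
    then show "cf y \<in> aspan {a \<bullet> aw w k \<bullet> b | a w k b. a \<in> DD \<and> b \<in> DD \<and> w \<in> carrier W \<and> k \<in> G}"
      by (simp only: JD_def)
  qed (simp_all add: cf_ops)
  then show ?thesis using assms by (simp add: cf_Dhat)
qed

text \<open>On stable elements w(k) = w k w^-1, so translates remain in the ideal.\<close>

lemma JD_genideal: "JD G \<subseteq> genideal R G"
proof -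
  interpret J: ideal "genideal R G" R by (rule H.genideal_ideal[OF G_carrier])
  show ?thesis unfolding JD_def
  proof (rule aspan_subset)
    show "{a \<bullet> aw w k \<bullet> b | a w k b. a \<in> DD \<and> b \<in> DD \<and> w \<in> carrier W \<and> k \<in> G} \<subseteq> genideal R G"
    proof clarify
      fix a w k b assume *: "a \<in> DD" "b \<in> DD" "w \<in> carrier W" "k \<in> G"
      have k: "k \<in> genideal R G" using * H.genideal_self[OF G_carrier] by blast
      have "wh w \<bullet> k \<bullet> wh (inv\<^bsub>W\<^esub> w) = aw w k"
        using Zd_conj[of k w] * G_Zd by (simp add: H.m_assoc wh_mult)
      then have "aw w k \<in> genideal R G"
        using k * J.I_l_closed J.I_r_closed by (metis W.inv_closed wh_closed)
      then show "a \<bullet> aw w k \<bullet> b \<in> genideal R G"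
        using * by (intro J.I_r_closed J.I_l_closed) (simp_all add: Dhat_carrier)
    qed
  qed simp_all
qed

lemma genideal_aw: "x \<in> genideal R G \<Longrightarrow> x \<in> DD \<Longrightarrow> w \<in> carrier W \<Longrightarrow> aw w x \<in> genideal R G"
  and genideal_ds: "x \<in> genideal R G \<Longrightarrow> x \<in> DD \<Longrightarrow> s \<in> T \<Longrightarrow> ds s x \<in> genideal R G"
  using JD_aw JD_ds genideal_Dhat JD_genideal by blast+

end

end

section \<open>Symmetries of the quotients of the reflection subalgebra\<close>

context coxeter begin

lemma Dquot_symmetries:
  assumes G: "G \<subseteq> Zd"
  defines "J \<equiv> genideal R G"
  defines "A \<equiv> (R Quot J)\<lparr>carrier := (\<lambda>x. J +>\<^bsub>R\<^esub> x) ` DD\<rparr>"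
  shows "\<exists>act. group_action W (carrier A) act \<and>
      (\<forall>w\<in>carrier W. act w \<in> ring_iso A A) \<and>
      (\<forall>i\<in>I. \<forall>s\<in>T. act (gen i) (J +>\<^bsub>R\<^esub> Dr s) =
         (if s = gen i then \<one>\<^bsub>A\<^esub> \<ominus>\<^bsub>A\<^esub> (J +>\<^bsub>R\<^esub> Dr (gen i))
          else J +>\<^bsub>R\<^esub> Dr (gen i \<star> s \<star> gen i))) \<and>
      (\<forall>s\<in>T. \<exists>d. twisted_derivation A (act s) d \<and>
         (\<forall>s'\<in>T. d (J +>\<^bsub>R\<^esub> Dr s') = (if s = s' then \<one>\<^bsub>A\<^esub> else \<zero>\<^bsub>A\<^esub>)))"
proof -
  interpret J: ideal J R unfolding J_def by (rule H.genideal_ideal[OF G_carrier[OF G]])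
  define q where "q x = J +>\<^bsub>R\<^esub> x" for x
  have cA: "carrier A = q ` DD" by (simp add: A_def q_def image_def)
  have DDc: "x \<in> carrier R" if "x \<in> DD" for x using that by (rule Dhat_carrier)
  have A_ops: "q x \<otimes>\<^bsub>A\<^esub> q y = q (x \<bullet> y)" "q x \<oplus>\<^bsub>A\<^esub> q y = q (x \<^bold>+ y)" if "x \<in> DD" "y \<in> DD" for x y
    using that DDc by (simp_all add: A_def q_def J.quot_ops)
  have A_one: "\<one>\<^bsub>A\<^esub> = q \<^bold>1" "\<zero>\<^bsub>A\<^esub> = q \<^bold>0" by (simp_all add: A_def q_def J.quot_ops)
  have "ring A"
  proof -
    have "ring (R\<lparr>carrier := DD\<rparr>)"
      unfolding Dhat_eq by (rule H.generate_ring_is_ring[OF Dr_image_closed])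
    moreover have "q \<in> ring_hom (R\<lparr>carrier := DD\<rparr>) (R Quot J)"
      by (rule ring_hom_memI) (use DDc in \<open>simp_all add: q_def J.quot_ops J.quot_carrier\<close>)
    ultimately interpret h: ring_hom_ring "R\<lparr>carrier := DD\<rparr>" "R Quot J" q
      by (intro ring_hom_ringI2 J.quotient_is_ring)
    show ?thesis using h.img_is_ring cA by (simp add: A_def)
  qed
  then interpret A: ring A .
  have A_minus: "q x \<ominus>\<^bsub>A\<^esub> q y = q (x \<^bold>- y)" if "x \<in> DD" "y \<in> DD" for x y
  proof -
    have "q (\<^bold>- y) \<oplus>\<^bsub>A\<^esub> q y = \<zero>\<^bsub>A\<^esub>"
      using that DDc by (subst A_ops) (simp_all add: A_one H.l_neg)
    then have "\<ominus>\<^bsub>A\<^esub> q y = q (\<^bold>- y)" by (rule A.minus_equality) (use that cA in auto)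
    then show ?thesis using that by (simp add: a_minus_def A_ops)
  qed
  \<comment> \<open>Descent of a map of \<open>DD\<close> to the quotient through a chosen preimage;
    it shadows the earlier constant of this name. The restriction to the carrier is there because
    elements of \<open>BijGroup\<close> are extensional.\<close>
  define lf where "lf f = (\<lambda>Y\<in>carrier A. q (f (SOME x. x \<in> DD \<and> q x = Y)))" for f :: "'i gen falg set \<Rightarrow> 'i gen falg set"
  have lf_q: "lf f (q x) = q (f x)"
    if f: "\<And>x. x \<in> DD \<Longrightarrow> f x \<in> DD" "\<And>x y. x \<in> DD \<Longrightarrow> y \<in> DD \<Longrightarrow> f (x \<^bold>- y) = f x \<^bold>- f y"
      "\<And>x. x \<in> J \<Longrightarrow> x \<in> DD \<Longrightarrow> f x \<in> J" and x: "x \<in> DD" for f x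
  proof -
    define z where "z = (SOME z. z \<in> DD \<and> q z = q x)"
    have z: "z \<in> DD \<and> q z = q x" unfolding z_def by (rule someI[of _ x]) (use x in simp)
    then have "z \<^bold>- x \<in> J" using x DDc J.coset_eq_iff unfolding q_def by blast
    then have "f z \<^bold>- f x \<in> J" using f(2)[of z x] f(3)[of "z \<^bold>- x"] z x by simp
    then have "q (f z) = q (f x)" using f(1) z x DDc J.coset_eq_iff unfolding q_def by blast
    moreover have "q x \<in> carrier A" using x cA by blast
    ultimately show ?thesis by (simp add: lf_def z_def)
  qed
  have aw_q: "lf (aw w) (q x) = q (aw w x)" if "w \<in> carrier W" "x \<in> DD" for w x
    by (rule lf_q) (use that genideal_aw[OF G] in \<open>simp_all add: aw_simps J_def\<close>)
  have ds_q: "lf (ds s) (q x) = q (ds s x)" if "s \<in> T" "x \<in> DD" for s x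
    by (rule lf_q) (use that genideal_ds[OF G] in \<open>simp_all add: ds_simps J_def\<close>)
  let ?act = "\<lambda>w. lf (aw w)"
  have inv: "?act w (?act (inv\<^bsub>W\<^esub> w) Y) = Y" "?act (inv\<^bsub>W\<^esub> w) (?act w Y) = Y" "?act w Y \<in> carrier A"
    if "w \<in> carrier W" "Y \<in> carrier A" for w Y
    using that unfolding cA by (auto simp: aw_q aw_inv)
  have bij: "bij_betw (?act w) (carrier A) (carrier A)" if "w \<in> carrier W" for w
    by (rule bij_betw_byWitness[where f' = "?act (inv\<^bsub>W\<^esub> w)"]) (use that inv in auto)
  have Bij: "?act w \<in> Bij (carrier A)" if "w \<in> carrier W" for w
    using bij[OF that] by (simp add: Bij_def lf_def)
  have "group_action W (carrier A) ?act"
  proof (intro group_action.intro group_hom.intro group_hom_axioms.intro W_group group_BijGroup homI)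
    show "?act w \<in> carrier (BijGroup (carrier A))" if "w \<in> carrier W" for w
      using Bij[OF that] by (simp add: BijGroup_def)
    show "?act (w \<star> v) = ?act w \<otimes>\<^bsub>BijGroup (carrier A)\<^esub> ?act v"
      if wv: "w \<in> carrier W" "v \<in> carrier W" for w v
    proof -
      have "?act (w \<star> v) = compose (carrier A) (?act w) (?act v)"
      proof (rule extensionalityI[where A = "carrier A"])
        fix Y assume "Y \<in> carrier A"
        then show "?act (w \<star> v) Y = compose (carrier A) (?act w) (?act v) Y"
          using wv unfolding compose_def cA by (auto simp: aw_q aw_mult)
      qed (simp_all add: lf_def compose_def)
      then show ?thesis using Bij wv by (simp add: BijGroup_def)
    qed
  qed
  moreover have "?act w \<in> ring_iso A A" if w: "w \<in> carrier W" for w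
  proof (rule ring_iso_memI)
    fix x y assume "x \<in> carrier A" "y \<in> carrier A"
    then obtain a b where "a \<in> DD" "x = q a" "b \<in> DD" "y = q b" unfolding cA by blast
    then show "?act w x \<in> carrier A" "?act w (x \<otimes>\<^bsub>A\<^esub> y) = ?act w x \<otimes>\<^bsub>A\<^esub> ?act w y"
      "?act w (x \<oplus>\<^bsub>A\<^esub> y) = ?act w x \<oplus>\<^bsub>A\<^esub> ?act w y"
      using w unfolding cA by (simp_all add: A_ops aw_q aw_simps)
  qed (use w bij in \<open>simp_all add: A_one aw_q aw_simps\<close>)
  moreover have "?act (gen i) (q (Dr s)) =
      (if s = gen i then \<one>\<^bsub>A\<^esub> \<ominus>\<^bsub>A\<^esub> q (Dr (gen i)) else q (Dr (gen i \<star> s \<star> gen i)))"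
    if "i \<in> I" "s \<in> T" for i s
    using that by (simp add: aw_q aw_simps Er_def flip_gen A_one A_minus conj_gen[symmetric])
  moreover have "twisted_derivation A (?act s) (lf (ds s)) \<and>
      (\<forall>s'\<in>T. lf (ds s) (q (Dr s')) = (if s = s' then \<one>\<^bsub>A\<^esub> else \<zero>\<^bsub>A\<^esub>))" if s: "s \<in> T" for s
    unfolding twisted_derivation_def
  proof (intro conjI ballI Pi_I)
    fix x assume "x \<in> carrier A"
    then obtain a where "a \<in> DD" "x = q a" unfolding cA by blast
    then show "lf (ds s) x \<in> carrier A" using s unfolding cA by (simp add: ds_q)
  next
    fix x y assume "x \<in> carrier A" "y \<in> carrier A"
    then obtain a b where "a \<in> DD" "x = q a" "b \<in> DD" "y = q b" unfolding cA by blast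
    then show "lf (ds s) (x \<oplus>\<^bsub>A\<^esub> y) = lf (ds s) x \<oplus>\<^bsub>A\<^esub> lf (ds s) y"
      "lf (ds s) (x \<otimes>\<^bsub>A\<^esub> y) = lf (ds s) x \<otimes>\<^bsub>A\<^esub> y \<oplus>\<^bsub>A\<^esub> ?act s x \<otimes>\<^bsub>A\<^esub> lf (ds s) y"
      using s by (simp_all add: A_ops ds_q aw_q ds_simps)
  qed (use s in \<open>simp add: ds_q ds_simps A_one\<close>)
  ultimately show ?thesis unfolding q_def by blast
qed

section \<open>The anti-involution and the involution\<close>

definition bar0 :: "'i gen falg \<Rightarrow> 'i gen falg" where
  "bar0 = frag_extend (\<lambda>w. mon (rev (letters w)))"

primrec theta_gen :: "'i gen \<Rightarrow> 'i gen falg" where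
  "theta_gen (SG i) = - mon [SG i]"
| "theta_gen (DG i) = 1 - mon [DG i]"

abbreviation theta0 where "theta0 \<equiv> alg_ext theta_gen"

lemma bar0_simps: "bar0 (mon xs) = mon (rev xs)" "bar0 (p + q) = bar0 p + bar0 q"
  "bar0 (p - q) = bar0 p - bar0 q" "bar0 0 = 0" "bar0 1 = 1"
proof -
  show "bar0 (mon xs) = mon (rev xs)" for xs by (simp add: bar0_def mon_frag)
  from this[of "[]"] show "bar0 1 = 1" by (simp add: mon_Nil)
qed (simp_all add: bar0_def frag_extend_add frag_extend_diff)

lemma bar0_mult: "bar0 (p * q) = bar0 q * bar0 p"
proof (induction p rule: falg_induct)
  case (mon xs)
  show ?case
    by (induction q rule: falg_induct) (simp_all add: bar0_simps mon_mult right_diff_distrib left_diff_distrib)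
qed (simp_all add: bar0_simps right_diff_distrib left_diff_distrib)

lemma bar0_involution: "bar0 (bar0 p) = p"
  by (induction p rule: falg_induct) (simp_all add: bar0_simps)

lemma F_induct [consumes 1, case_names zero mon diff]:
  assumes "p \<in> carrier F" "P 0" "\<And>xs. set xs \<subseteq> SG ` I \<union> DG ` I \<Longrightarrow> P (mon xs)"
    and "\<And>p q. P p \<Longrightarrow> P q \<Longrightarrow> P (p - q)"
  shows "P p"
  using assms(1) unfolding HF_def by (rule free_algebra_induct) (use assms in auto)

lemma bar0_closed [simp]: "p \<in> carrier F \<Longrightarrow> bar0 p \<in> carrier F"
  by (induction p rule: F_induct) (simp_all add: bar0_simps)

lemma theta0_closed [simp]: "p \<in> carrier F \<Longrightarrow> theta0 p \<in> carrier F"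
  unfolding HF_def by (erule alg_ext_closed) auto

lemma theta0_mon1: "theta0 (mon [g]) = theta_gen g"
  by (simp add: alg_ext_mon)

lemma theta0_theta_gen: "theta0 (theta_gen g) = mon [g]"
proof (cases g)
  case (SG i)
  have "theta0 (0 - mon [SG i]) = - theta_gen (SG i)"
    unfolding alg_ext_diff alg_ext_zero theta0_mon1 by simp
  then show ?thesis using SG by simp
next
  case (DG i)
  then show ?thesis by (simp add: alg_ext_diff alg_ext_one theta0_mon1)
qed

lemma theta0_involution: "theta0 (theta0 p) = p"
proof (induction p rule: falg_induct)
  case (mon xs)
  have "theta0 (prod_list (map theta_gen xs)) = mon xs"
    by (induction xs) (simp_all add: mon_Nil alg_ext_one alg_ext_mult theta0_theta_gen mon_mult)
  then show ?case by (simp add: alg_ext_mon)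
qed (simp_all add: alg_ext_zero alg_ext_diff)

lemma theta0_SG: "theta0 (mon (map SG u)) = (if even (length u) then mon (map SG u) else - mon (map SG u))"
proof (induction u)
  case (Cons i u)
  have e: "mon (SG i # map SG u) = mon [SG i] * mon (map SG u)" by (simp add: mon_mult)
  show ?case unfolding list.map e alg_ext_mult theta0_mon1 Cons.IH by simp
qed (simp add: mon_Nil alg_ext_one)

lemma bar_anti: "anti_involution F bar0"
  unfolding anti_involution_def by (simp add: bar0_simps bar0_mult bar0_involution)

lemma theta_inv: "ring_involution F theta0"
  by (rule ring_involutionI) (simp_all add: alg_ext_one alg_ext_add alg_ext_mult theta0_involution)

section \<open>The defining relations under reversal and theta\<close>

lemma relations_J0: "r \<in> hecke_hopf_relations I m \<Longrightarrow> r \<in> J0"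
  unfolding hecke_hopf_ideal_def using F.genideal_self[OF relations_closed] by blast

lemma J0_uminus: "r \<in> J0 \<Longrightarrow> - r \<in> J0"
  using J0.a_inv_closed[of r] F_minus(1)[OF J0.a_Hcarr[of r]] by simp

lemma relation_cases [consumes 1, case_names square idem skew cox braid]:
  assumes "r \<in> hecke_hopf_relations I m"
    and "\<And>i. i \<in> I \<Longrightarrow> r = mon [SG i, SG i] - 1 \<Longrightarrow> P"
    and "\<And>i. i \<in> I \<Longrightarrow> r = mon [DG i, DG i] - mon [DG i] \<Longrightarrow> P"
    and "\<And>i. i \<in> I \<Longrightarrow> r = mon [SG i, DG i] + mon [DG i, SG i] - (mon [SG i] - 1) \<Longrightarrow> P"
    and "\<And>i j. i \<in> I \<Longrightarrow> j \<in> I \<Longrightarrow> r = mon (map SG (alt (2 * m i j) i j)) - 1 \<Longrightarrow> P"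
    and "\<And>i j. i \<in> I \<Longrightarrow> j \<in> I \<Longrightarrow> i \<noteq> j \<Longrightarrow> m i j \<noteq> 0 \<Longrightarrow> r = mon (DG i # map SG (alt (m i j - 1) j i))
        - mon (map SG (alt (m i j - 1) j i) @ [DG (if even (m i j) then i else j)]) \<Longrightarrow> P"
  shows P
  using assms(1) unfolding hecke_hopf_relations_def concat_replicate_SG Un_iff
  by (elim disjE CollectE exE conjE) (rule assms(2-), assumption+)+

lemma cox_relation: "i \<in> I \<Longrightarrow> j \<in> I \<Longrightarrow> mon (map SG (alt (2 * m i j) i j)) - 1 \<in> hecke_hopf_relations I m"
  unfolding hecke_hopf_relations_def concat_replicate_SG by blast

lemma braid_relation:
  "i \<in> I \<Longrightarrow> j \<in> I \<Longrightarrow> i \<noteq> j \<Longrightarrow> m i j \<noteq> 0 \<Longrightarrow> mon (DG i # map SG (alt (m i j - 1) j i))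
        - mon (map SG (alt (m i j - 1) j i) @ [DG (if even (m i j) then i else j)]) \<in> hecke_hopf_relations I m"
  unfolding hecke_hopf_relations_def by blast

lemma bar0_relations: "bar0 ` hecke_hopf_relations I m \<subseteq> J0"
proof clarify
  fix r assume r: "r \<in> hecke_hopf_relations I m"
  then show "bar0 r \<in> J0"
  proof (cases r rule: relation_cases)
    case (square i)
    then have "bar0 r = r" by (simp add: bar0_simps)
    then show ?thesis using r relations_J0 by simp
  next
    case (idem i)
    then have "bar0 r = r" by (simp add: bar0_simps)
    then show ?thesis using r relations_J0 by simp
  next
    case (skew i)
    then have "bar0 r = r" by (simp add: bar0_simps add.commute)
    then show ?thesis using r relations_J0 by simp
  next
    case (cox i j)
    then have "bar0 r = mon (map SG (alt (2 * m j i) j i)) - 1"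
      by (simp add: bar0_simps rev_alt m_sym rev_map)
    then show ?thesis using cox cox_relation relations_J0 by metis
  next
    case (braid i j)
    \<comment> \<open>Reversal gives minus the relation of the pair (\<open>?k\<close>,
      \<open>?l\<close>), where \<open>?k\<close> is the index of D on the right-hand side: the same
      pair for even m, the swapped one for odd m.\<close>
    let ?k = "if even (m i j) then i else j" and ?l = "if even (m i j) then j else i"
    have k: "?k \<in> I" "?l \<in> I" "?k \<noteq> ?l" "m ?k ?l = m i j" "(if even (m ?k ?l) then ?k else ?l) = i"
      using braid m_sym by auto
    have "rev (alt (m i j - 1) j i) = alt (m i j - 1) ?l ?k"
      using braid(4) by (auto simp: rev_alt)
    then have "bar0 r = - (mon (DG ?k # map SG (alt (m ?k ?l - 1) ?l ?k))
        - mon (map SG (alt (m ?k ?l - 1) ?l ?k) @ [DG (if even (m ?k ?l) then ?k else ?l)]))"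
      unfolding k(4) braid(5) by (cases "even (m i j)") (simp_all add: bar0_simps rev_map)
    moreover have "mon (DG ?k # map SG (alt (m ?k ?l - 1) ?l ?k))
        - mon (map SG (alt (m ?k ?l - 1) ?l ?k) @ [DG (if even (m ?k ?l) then ?k else ?l)]) \<in> hecke_hopf_relations I m"
      by (rule braid_relation) (use k braid in auto)
    ultimately show ?thesis using relations_J0 J0_uminus by metis
  qed
qed

text \<open>Each relation goes to itself or to its negative. In the braid-type relation the constant
  1 of 1 - D contributes the same word on both sides and cancels.\<close>

lemma theta0_relations: "theta0 ` hecke_hopf_relations I m \<subseteq> J0"
proof clarify
  fix r assume r: "r \<in> hecke_hopf_relations I m"
  have "theta0 r = r \<or> theta0 r = - r"
    using r
  proof (cases r rule: relation_cases)
    case (square i)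
    then show ?thesis using theta0_SG[of "[i, i]"] by (simp add: alg_ext_diff alg_ext_one)
  next
    case (idem i)
    have "theta0 (mon [DG i, DG i]) = 1 - mon [DG i] - mon [DG i] + mon [DG i, DG i]"
      unfolding alg_ext_mon by (simp add: algebra_simps mon_mult)
    then show ?thesis using idem by (simp add: alg_ext_diff theta0_mon1)
  next
    case (skew i)
    have "theta0 (mon [SG i, DG i]) = mon [SG i, DG i] - mon [SG i]"
      "theta0 (mon [DG i, SG i]) = mon [DG i, SG i] - mon [SG i]"
      unfolding alg_ext_mon by (simp_all add: algebra_simps mon_mult)
    then show ?thesis using skew by (simp add: alg_ext_diff alg_ext_add alg_ext_one theta0_mon1)
  next
    case (cox i j)
    then show ?thesis by (simp add: alg_ext_diff alg_ext_one theta0_SG)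
  next
    case (braid i j)
    define a k where "a = alt (m i j - 1) j i" and "k = (if even (m i j) then i else j)"
    have r: "r = mon [DG i] * mon (map SG a) - mon (map SG a) * mon [DG k]"
      using braid(5) by (simp only: a_def k_def mon_mult append.simps)
    show ?thesis
      unfolding r alg_ext_diff alg_ext_mult theta0_SG theta0_mon1 theta_gen.simps
      by (simp add: algebra_simps)
  qed
  then show "theta0 r \<in> J0" using relations_J0[OF r] J0_uminus by metis
qed

section \<open>The symmetries on the presented algebra\<close>

definition hb :: "'i gen falg set \<Rightarrow> 'i gen falg set" where "hb = (`) bar0"
definition ht :: "'i gen falg set \<Rightarrow> 'i gen falg set" where "ht = (`) theta0"

lemma hb_anti: "anti_involution R hb" and hb_hc: "p \<in> carrier F \<Longrightarrow> hb (hc p) = hc (bar0 p)"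
proof -
  have "bar0 ` J0 \<subseteq> J0"
    unfolding hecke_hopf_ideal_def
    by (rule genideal_image[OF F.ring_axioms relations_closed])
      (use bar0_relations bar_anti in \<open>auto simp: hecke_hopf_ideal_def\<close>)
  from quot_anti_involution[OF J0.ideal_axioms bar_anti this]
  show "anti_involution R hb" "p \<in> carrier F \<Longrightarrow> hb (hc p) = hc (bar0 p)"
    unfolding hb_def Hhat_def by blast+
qed

lemma ht_inv: "ring_involution R ht" and ht_hc: "p \<in> carrier F \<Longrightarrow> ht (hc p) = hc (theta0 p)"
proof -
  have "theta0 ` J0 \<subseteq> J0"
    unfolding hecke_hopf_ideal_def
    by (rule genideal_image[OF F.ring_axioms relations_closed])
      (use theta0_relations theta_inv in \<open>auto simp: hecke_hopf_ideal_def\<close>)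
  from quot_ring_involution[OF J0.ideal_axioms theta_inv this]
  show "ring_involution R ht" "p \<in> carrier F \<Longrightarrow> ht (hc p) = hc (theta0 p)"
    unfolding ht_def Hhat_def by blast+
qed

lemma hb_simps:
  "x \<in> carrier R \<Longrightarrow> hb x \<in> carrier R" "hb \<^bold>1 = \<^bold>1"
  "x \<in> carrier R \<Longrightarrow> y \<in> carrier R \<Longrightarrow> hb (x \<^bold>+ y) = hb x \<^bold>+ hb y"
  "x \<in> carrier R \<Longrightarrow> y \<in> carrier R \<Longrightarrow> hb (x \<bullet> y) = hb y \<bullet> hb x"
  "hb \<^bold>0 = \<^bold>0" "x \<in> carrier R \<Longrightarrow> hb (\<^bold>- x) = \<^bold>- hb x"
  "i \<in> I \<Longrightarrow> hb (sh i) = sh i" "i \<in> I \<Longrightarrow> hb (dh i) = dh i"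
proof -
  note a = anti_involutionD[OF hb_anti]
  show "x \<in> carrier R \<Longrightarrow> hb x \<in> carrier R" "hb \<^bold>1 = \<^bold>1"
    "x \<in> carrier R \<Longrightarrow> y \<in> carrier R \<Longrightarrow> hb (x \<^bold>+ y) = hb x \<^bold>+ hb y"
    "x \<in> carrier R \<Longrightarrow> y \<in> carrier R \<Longrightarrow> hb (x \<bullet> y) = hb y \<bullet> hb x" by (fact a)+
  show "hb \<^bold>0 = \<^bold>0" "x \<in> carrier R \<Longrightarrow> hb (\<^bold>- x) = \<^bold>- hb x"
    using H.additive_map[of hb] a by simp_all
  show "i \<in> I \<Longrightarrow> hb (sh i) = sh i" "i \<in> I \<Longrightarrow> hb (dh i) = dh i"
    by (simp_all add: s_hat_def D_hat_def Hmon_def hb_hc bar0_simps)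
qed

lemma ht_simps:
  "x \<in> carrier R \<Longrightarrow> ht x \<in> carrier R" "ht \<^bold>1 = \<^bold>1"
  "x \<in> carrier R \<Longrightarrow> y \<in> carrier R \<Longrightarrow> ht (x \<^bold>+ y) = ht x \<^bold>+ ht y"
  "x \<in> carrier R \<Longrightarrow> y \<in> carrier R \<Longrightarrow> ht (x \<bullet> y) = ht x \<bullet> ht y"
  "ht \<^bold>0 = \<^bold>0" "x \<in> carrier R \<Longrightarrow> ht (\<^bold>- x) = \<^bold>- ht x"
  "i \<in> I \<Longrightarrow> ht (sh i) = \<^bold>- sh i" "i \<in> I \<Longrightarrow> ht (dh i) = \<^bold>1 \<^bold>- dh i"
proof -
  note a = ring_involutionD[OF ht_inv]
  show "x \<in> carrier R \<Longrightarrow> ht x \<in> carrier R" "ht \<^bold>1 = \<^bold>1"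
    "x \<in> carrier R \<Longrightarrow> y \<in> carrier R \<Longrightarrow> ht (x \<^bold>+ y) = ht x \<^bold>+ ht y"
    "x \<in> carrier R \<Longrightarrow> y \<in> carrier R \<Longrightarrow> ht (x \<bullet> y) = ht x \<bullet> ht y" by (fact a)+
  show "ht \<^bold>0 = \<^bold>0" "x \<in> carrier R \<Longrightarrow> ht (\<^bold>- x) = \<^bold>- ht x"
    using H.additive_map[of ht] a by simp_all
  show "i \<in> I \<Longrightarrow> ht (sh i) = \<^bold>- sh i" "i \<in> I \<Longrightarrow> ht (dh i) = \<^bold>1 \<^bold>- dh i"
    by (simp_all add: s_hat_def D_hat_def Hmon_def ht_hc theta0_mon1 hc_ops)
qed


subsection \<open>The counit\<close>

text \<open>The integers appear as the free abelian group on one generator, so additivity is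
  inherited from \<open>frag_extend\<close>.\<close>

lemma counit_free_frag:
  "counit_free p = Poly_Mapping.lookup
     (frag_extend (\<lambda>w. frag_cmul (prod_list (map counit_gen (letters w))) (frag_of ())) p) ()"
  unfolding counit_free_def frag_extend_def by (simp add: lookup_sum)

lemma counit_free_simps:
  "counit_free (mon xs) = prod_list (map counit_gen xs)"
  "counit_free (p + q) = counit_free p + counit_free q"
  "counit_free (p - q) = counit_free p - counit_free q"
  "counit_free 0 = 0" "counit_free 1 = 1" "counit_free (- p) = - counit_free p"
proof -
  show m: "counit_free (mon xs) = prod_list (map counit_gen xs)" for xs :: "'j gen list"
    by (simp add: counit_free_def mon_frag)
  from this[of "[]"] show "counit_free (1 :: 'j gen falg) = 1" by (simp add: mon_Nil)
qed (simp_all add: counit_free_frag frag_extend_add frag_extend_diff frag_extend_minus lookup_add lookup_minus)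

lemma counit_free_mult: "counit_free (p * q) = counit_free p * counit_free q"
proof (induction p rule: falg_induct)
  case (mon xs)
  show ?case
    by (induction q rule: falg_induct) (simp_all add: counit_free_simps mon_mult right_diff_distrib)
qed (simp_all add: counit_free_simps left_diff_distrib)

lemma counit_free_J0:
  assumes "p \<in> J0" shows "counit_free p = 0"
proof -
  let ?K = "{p \<in> carrier F. counit_free p = 0}"
  have "ideal ?K F"
    by (rule F.ideal_intro) (auto simp: counit_free_simps counit_free_mult F_minus)
  moreover have "hecke_hopf_relations I m \<subseteq> ?K"
  proof
    fix r assume r: "r \<in> hecke_hopf_relations I m"
    have SG: "prod_list (map counit_gen (map SG u)) = 1" for u :: "'i list" by (induction u) auto
    have "counit_free r = 0"
      using r by (cases r rule: relation_cases) (simp_all add: counit_free_simps SG del: map_map)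
    then show "r \<in> ?K" using r relations_closed by blast
  qed
  ultimately have "J0 \<subseteq> ?K" unfolding hecke_hopf_ideal_def by (rule F.genideal_minimal)
  then show ?thesis using assms by blast
qed

lemma counit_hc:
  assumes "p \<in> carrier F" shows "counit (hc p) = counit_free p"
proof -
  have "counit_free y = counit_free p" if "y \<in> hc p" for y
    using that counit_free_J0 by (auto simp: a_r_coset_def' counit_free_simps)
  moreover have "p \<in> hc p" using J0.a_rcos_self[OF assms] .
  ultimately have "counit_free ` hc p = {counit_free p}" by blast
  then show ?thesis by (simp add: counit_def)
qed

lemma counit_simps:
  "x \<in> carrier R \<Longrightarrow> y \<in> carrier R \<Longrightarrow> counit (x \<^bold>+ y) = counit x + counit y"
  "x \<in> carrier R \<Longrightarrow> y \<in> carrier R \<Longrightarrow> counit (x \<^bold>- y) = counit x - counit y"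
  "x \<in> carrier R \<Longrightarrow> y \<in> carrier R \<Longrightarrow> counit (x \<bullet> y) = counit x * counit y"
  "x \<in> carrier R \<Longrightarrow> counit (\<^bold>- x) = - counit x"
  "counit \<^bold>1 = 1" "i \<in> I \<Longrightarrow> counit (sh i) = 1" "i \<in> I \<Longrightarrow> counit (dh i) = 0"
proof -
  have "\<exists>p. p \<in> carrier F \<and> x = hc p" if "x \<in> carrier R" for x using that frep by metis
  then show "x \<in> carrier R \<Longrightarrow> y \<in> carrier R \<Longrightarrow> counit (x \<^bold>+ y) = counit x + counit y"
    "x \<in> carrier R \<Longrightarrow> y \<in> carrier R \<Longrightarrow> counit (x \<^bold>- y) = counit x - counit y"
    "x \<in> carrier R \<Longrightarrow> y \<in> carrier R \<Longrightarrow> counit (x \<bullet> y) = counit x * counit y"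
    "x \<in> carrier R \<Longrightarrow> counit (\<^bold>- x) = - counit x"
    by (metis F_closed counit_free_mult counit_free_simps counit_hc hc_ops)+
  show "counit \<^bold>1 = 1" by (simp add: hc_ops counit_hc counit_free_simps)
  show "i \<in> I \<Longrightarrow> counit (sh i) = 1" "i \<in> I \<Longrightarrow> counit (dh i) = 0"
    by (simp_all add: s_hat_def D_hat_def Hmon_def counit_hc counit_free_simps)
qed

lemma counit_wh: "w \<in> carrier W \<Longrightarrow> counit (wh w) = 1"
proof (induction w rule: W_induct)
  case (gen i w)
  then show ?case by (simp add: counit_simps wh_gen flip: wh_mult)
qed (simp add: counit_simps)

lemma counit_Dr: "t \<in> T \<Longrightarrow> counit (Dr t) = 0"
  by (erule refl_pos_cases) (simp add: Dr_conj counit_simps)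

subsection \<open>Stability of the defining ideals\<close>

lemma counit_hb: "x \<in> carrier R \<Longrightarrow> counit (hb x) = counit x"
proof (induction x rule: R_induct)
  case (minus x y)
  then show ?case by (simp add: a_minus_def hb_simps counit_simps)
qed (simp_all add: hb_simps counit_simps)

lemma hb_wh: "w \<in> carrier W \<Longrightarrow> hb (wh w) = wh (inv\<^bsub>W\<^esub> w)"
proof (induction w rule: W_induct)
  case (gen i w)
  have "hb (wh (cox_gen I m i \<star> w)) = wh (inv\<^bsub>W\<^esub> w) \<bullet> wh (cox_gen I m i)"
    using gen by (simp add: hb_simps wh_gen flip: wh_mult)
  then show ?case using gen by (simp add: wh_mult W.inv_mult_group)
qed (simp add: hb_simps)

lemma hb_conj:
  assumes "w \<in> carrier W" "y \<in> carrier R"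
  shows "hb (wh w \<bullet> y \<bullet> wh (inv\<^bsub>W\<^esub> w)) = wh w \<bullet> hb y \<bullet> wh (inv\<^bsub>W\<^esub> w)"
  using assms by (simp add: hb_simps hb_wh H.m_assoc)

text \<open>Theta changes each letter of \<open>w\<close> by a sign, which occurs a second time in
  the inverse.\<close>

lemma ht_conj:
  assumes "w \<in> carrier W" "y \<in> carrier R"
  shows "ht (wh w \<bullet> y \<bullet> wh (inv\<^bsub>W\<^esub> w)) = wh w \<bullet> ht y \<bullet> wh (inv\<^bsub>W\<^esub> w)"
  using assms(1)
proof (induction w rule: W_induct)
  case one
  then show ?case using assms by (simp add: ht_simps)
next
  case (gen i w)
  have e: "wh (cox_gen I m i \<star> w) \<bullet> z \<bullet> wh (inv\<^bsub>W\<^esub> (cox_gen I m i \<star> w)) =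
      sh i \<bullet> (wh w \<bullet> z \<bullet> wh (inv\<^bsub>W\<^esub> w)) \<bullet> sh i" if "z \<in> carrier R" for z
    using gen that by (simp add: W.inv_mult_group H.m_assoc wh_gen flip: wh_mult)
  have c: "wh w \<bullet> ht y \<bullet> wh (inv\<^bsub>W\<^esub> w) \<in> carrier R"
    "wh w \<bullet> y \<bullet> wh (inv\<^bsub>W\<^esub> w) \<in> carrier R"
    using gen assms by (simp_all add: ht_simps)
  have "ht (sh i \<bullet> (wh w \<bullet> y \<bullet> wh (inv\<^bsub>W\<^esub> w)) \<bullet> sh i) =
      (\<^bold>- sh i) \<bullet> (wh w \<bullet> ht y \<bullet> wh (inv\<^bsub>W\<^esub> w)) \<bullet> (\<^bold>- sh i)"
    unfolding gen.IH[symmetric] using gen(1) c by (simp add: ht_simps)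
  also have "\<dots> = sh i \<bullet> (wh w \<bullet> ht y \<bullet> wh (inv\<^bsub>W\<^esub> w)) \<bullet> sh i"
    using gen(1) c(1) by (simp only: H.l_minus H.r_minus H.minus_minus H.m_closed H.a_inv_closed sh_closed)
  finally show ?case using e assms(2) by (simp add: ht_simps)
qed

lemma hb_Dr: "t \<in> T \<Longrightarrow> hb (Dr t) = Dr t"
  by (erule refl_pos_cases) (simp add: Dr_conj hb_wh hb_simps H.m_assoc)

lemma ht_Dr:
  assumes "t \<in> T" shows "ht (Dr t) = \<^bold>1 \<^bold>- Dr t"
proof -
  obtain w i where w: "w \<in> carrier W" "i \<in> I" "\<not> flip w (gen i)" "t = conj w (gen i)"
    by (rule refl_pos_cases[OF assms])
  have "ht (Dr t) = wh w \<bullet> (\<^bold>1 \<^bold>- dh i) \<bullet> wh (inv\<^bsub>W\<^esub> w)"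
    unfolding w(4) Dr_conj[OF w(1-3)] ht_conj[OF w(1) dh_closed[OF w(2)]] ht_simps(8)[OF w(2)] ..
  also have "\<dots> = wh w \<bullet> wh (inv\<^bsub>W\<^esub> w) \<^bold>- wh w \<bullet> dh i \<bullet> wh (inv\<^bsub>W\<^esub> w)"
    using w(1,2) by (simp add: H.minus_eq H.r_distr H.l_distr H.r_minus H.l_minus)
  finally show ?thesis unfolding w(4) Dr_conj[OF w(1-3)] using w(1) by (simp add: wh_mult)
qed

lemma hb_Dhat: "x \<in> Dhat I m V \<Longrightarrow> hb x \<in> Dhat I m V"
  by (induction x rule: Dhat_induct) (simp_all add: hb_simps hb_Dr Dhat_carrier)

lemma ht_Dhat: "x \<in> Dhat I m V \<Longrightarrow> ht x \<in> Dhat I m V"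
  by (induction x rule: Dhat_induct) (simp_all add: ht_simps ht_Dr Dhat_carrier)

lemma K_alg_image:
  assumes "V \<subseteq> carrier W" "x \<in> K_alg I m V"
    and "\<And>y. y \<in> Dhat I m V \<Longrightarrow> f y \<in> Dhat I m V"
    and "\<And>w y. w \<in> carrier W \<Longrightarrow> y \<in> carrier R \<Longrightarrow>
      f (wh w \<bullet> y \<bullet> wh (inv\<^bsub>W\<^esub> w)) = wh w \<bullet> f y \<bullet> wh (inv\<^bsub>W\<^esub> w)"
  shows "f x \<in> K_alg I m V"
  unfolding K_alg_iff
proof
  fix w assume w: "w \<in> V"
  then obtain y where y: "y \<in> Dhat I m V" "x = wh w \<bullet> y \<bullet> wh (inv\<^bsub>W\<^esub> w)"
    using assms(2) unfolding K_alg_iff by blast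
  then have "f x = wh w \<bullet> f y \<bullet> wh (inv\<^bsub>W\<^esub> w)"
    using assms(1,4) w Dhat_carrier by blast
  then show "\<exists>y\<in>Dhat I m V. f x = wh w \<bullet> y \<bullet> wh (inv\<^bsub>W\<^esub> w)"
    using assms(3) y(1) by blast
qed

section \<open>Filtration degree under the symmetries\<close>

definition prods :: "nat \<Rightarrow> 'i gen falg set set" where
  "prods r = {Dl ss | ss. set ss \<subseteq> T \<and> length ss \<le> r}"

lemma prods_carrier: "prods r \<subseteq> carrier R"
  by (auto simp: prods_def Dl_closed)

lemma Dhat_deg_le_aspan: "Dhat_deg_le I m r = aspan (prods r)"
proof -
  have "foldr (\<lambda>s x. D_refl I m s \<bullet> x) ss \<^bold>1 = Dl ss" if "set ss \<subseteq> T" for ss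
    using that by (induction ss) (auto simp: Dl_def D_refl_eq)
  then have "{foldr (\<lambda>s x. D_refl I m s \<bullet> x) ss \<^bold>1 | ss. ss \<in> lists T \<and> length ss \<le> r} = prods r"
    unfolding prods_def lists_iff by (metis (no_types, lifting))
  then have e: "Dhat_deg_le I m r = generate (add_monoid R) (prods r)"
    by (simp only: Dhat_deg_le_def)
  show ?thesis unfolding e
  proof
    show "generate (add_monoid R) (prods r) \<subseteq> aspan (prods r)"
    proof
      fix x assume "x \<in> generate (add_monoid R) (prods r)"
      then show "x \<in> aspan (prods r)"
      proof (induction rule: generate.induct)
        case (inv h)
        then have "\<^bold>- h \<in> aspan (prods r)" by (intro aspan_intros(2,3))
        then show ?case by (simp only: a_inv_def)
      qed (auto intro: aspan_intros)
    qed
    have "subgroup (generate (add_monoid R) (prods r)) (add_monoid R)"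
      by (rule H.add.generate_is_subgroup) (use prods_carrier in simp)
    then interpret S: subgroup "generate (add_monoid R) (prods r)" "add_monoid R" .
    show "aspan (prods r) \<subseteq> generate (add_monoid R) (prods r)"
      by (rule aspan_subset)
        (use S.one_closed S.m_closed S.m_inv_closed in \<open>auto intro: generate.incl simp: a_inv_def\<close>)
  qed
qed

lemma deg_carrier: "aspan (prods r) \<subseteq> carrier R"
  by (rule aspan_subset) (use prods_carrier in auto)

lemma Dl_append: "set l \<subseteq> T \<Longrightarrow> set l' \<subseteq> T \<Longrightarrow> Dl (l @ l') = Dl l \<bullet> Dl l'"
proof (induction l)
  case (Cons t l)
  then show ?case using Dl_closed[of l] Dl_closed[of l'] by (simp add: Dl_def H.m_assoc)
qed (simp add: Dl_def Dl_closed[unfolded Dl_def])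

lemma hb_Dl: "set l \<subseteq> T \<Longrightarrow> hb (Dl l) = Dl (rev l)"
proof (induction l)
  case (Cons t l)
  have "Dl [t] = Dr t" using Cons.prems by (simp add: Dl_def)
  then show ?case using Cons Dl_append[of "rev l" "[t]"] Dl_closed[of l]
    by (simp add: Dl_def[of "t # l"] hb_simps hb_Dr flip: Dl_def)
qed (simp add: Dl_def hb_simps)

lemma deg_Dr: "t \<in> T \<Longrightarrow> x \<in> aspan (prods r) \<Longrightarrow> Dr t \<bullet> x \<in> aspan (prods (Suc r))"
proof (rule aspan_map[of x "prods r" "carrier R" "\<lambda>x. Dr t \<bullet> x"])
  fix x assume "t \<in> T" "x \<in> prods r"
  then obtain ss where "set ss \<subseteq> T" "length ss \<le> r" "x = Dl ss" by (auto simp: prods_def)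
  moreover have "Dr t \<bullet> Dl ss = Dl (t # ss)" by (simp add: Dl_def)
  ultimately have "Dr t \<bullet> x \<in> prods (Suc r)"
    unfolding prods_def using \<open>t \<in> T\<close> by (intro CollectI exI[of _ "t # ss"]) simp
  then show "Dr t \<bullet> x \<in> aspan (prods (Suc r))" by (rule aspan_intros(2))
qed (use prods_carrier deg_carrier in \<open>simp_all add: H.r_minus H.r_distr\<close>)

lemma deg_Suc: "aspan (prods r) \<subseteq> aspan (prods (Suc r))"
proof (rule aspan_subset)
  have "prods r \<subseteq> prods (Suc r)" by (auto simp: prods_def intro: le_SucI)
  then show "prods r \<subseteq> aspan (prods (Suc r))" using aspan_incl by (rule order_trans)
qed (auto intro: aspan_intros)

lemma ht_Dl: "set l \<subseteq> T \<Longrightarrow> length l \<le> r \<Longrightarrow> ht (Dl l) \<in> aspan (prods r)"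
proof (induction l arbitrary: r)
  case Nil
  have "\<^bold>1 \<in> prods r" unfolding prods_def by (intro CollectI exI[of _ "[]"]) (simp add: Dl_def)
  then show ?case by (simp add: Dl_def ht_simps aspan_intros)
next
  case (Cons t l)
  then obtain n where n: "r = Suc n" "length l \<le> n" by (cases r) auto
  have IH: "ht (Dl l) \<in> aspan (prods n)" using Cons n by simp
  have c: "ht (Dl l) \<in> carrier R" using IH deg_carrier by blast
  have "ht (Dl (t # l)) = ht (Dl l) \<^bold>+ \<^bold>- (Dr t \<bullet> ht (Dl l))"
    using Cons.prems c Dl_closed[of l]
    by (simp add: Dl_def[of "t # l"] ht_simps ht_Dr H.minus_eq H.l_distr H.l_minus flip: Dl_def)
  also have "\<dots> \<in> aspan (prods (Suc n))"
    using IH deg_Dr[OF _ IH, of t] deg_Suc[of n] Cons.prems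
    by (intro aspan_intros(3,4)) auto
  finally show ?case using n by simp
qed

lemma deg_hb: "x \<in> aspan (prods r) \<Longrightarrow> hb x \<in> aspan (prods r)"
proof (rule aspan_map[of x "prods r" "carrier R" hb])
  fix x assume "x \<in> prods r"
  then obtain ss where "set ss \<subseteq> T" "length ss \<le> r" "x = Dl ss" by (auto simp: prods_def)
  then have "hb x \<in> prods r"
    unfolding prods_def by (intro CollectI exI[of _ "rev ss"]) (simp add: hb_Dl)
  then show "hb x \<in> aspan (prods r)" by (rule aspan_intros(2))
qed (use prods_carrier deg_carrier in \<open>simp_all add: hb_simps\<close>)

lemma deg_ht: "x \<in> aspan (prods r) \<Longrightarrow> ht x \<in> aspan (prods r)"
proof (rule aspan_map[of x "prods r" "carrier R" ht])
  fix x assume "x \<in> prods r"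
  then obtain ss where "set ss \<subseteq> T" "length ss \<le> r" "x = Dl ss" by (auto simp: prods_def)
  then show "ht x \<in> aspan (prods r)" by (simp add: ht_Dl)
qed (use prods_carrier deg_carrier in \<open>simp_all add: ht_simps\<close>)

section \<open>The counit on finite dihedral parabolic subgroups\<close>

lemma parabolic_subset: "J \<subseteq> I \<Longrightarrow> parabolic I m J \<subseteq> carrier W"
  unfolding parabolic_def by (rule W.generate_incl) auto

lemma dihedral_len:
  assumes "i \<in> I" "j \<in> I" "i \<noteq> j" "m i j \<noteq> 0" "v \<in> parabolic I m {i, j}"
  shows "len v \<le> m i j"
proof -
  have J: "{i, j} \<subseteq> I" using assms by simp
  obtain u where u: "set u \<subseteq> {i, j}" "v = ev u"
    using generate_gens[OF J] assms(5) unfolding parabolic_def by blast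
  obtain u' where u': "redw {i, j} u'" "ev u' = ev u" using redw_exists[OF u(1)] by blast
  have "set u' \<subseteq> I" using u'(1) J by (auto simp: redw_def)
  then show ?thesis using len_le[of u'] redw_length[OF u'(1) assms(1-4)] u u' by simp
qed

text \<open>An element of maximal length in a finite dihedral parabolic subgroup makes all its positive
  roots negative, so that on stable elements \<^term>\<open>ht\<close> agrees with it up to a permutation of the
  generators, which the counit does not see.\<close>

lemma counit_ht:
  assumes "i \<in> I" "j \<in> I" "i \<noteq> j" "m i j \<noteq> 0" and x: "x \<in> K_alg I m (parabolic I m {i, j})"
  shows "counit (ht x) = counit x"
proof -
  let ?V = "parabolic I m {i, j}"
  have J: "{i, j} \<subseteq> I" using assms by simp
  have V: "subgroup ?V W" unfolding parabolic_def by (rule W.generate_is_subgroup) (use J in auto)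
  \<comment> \<open>Lengths in the subgroup are bounded by \<open>m i j\<close>, so an element of
    maximal length exists.\<close>
  have "\<exists>w. w \<in> ?V \<and> (\<forall>y. y \<in> ?V \<longrightarrow> len y \<le> len w)"
    by (rule ex_has_greatest_nat[of _ "\<one>\<^bsub>W\<^esub>" _ "Suc (m i j)"])
      (use subgroup.one_closed[OF V] dihedral_len[OF assms(1-4)] in \<open>auto simp: less_Suc_eq_le\<close>)
  then obtain w where w: "w \<in> ?V" "\<And>y. y \<in> ?V \<Longrightarrow> len y \<le> len w" by blast
  have wW: "w \<in> carrier W" using w(1) parabolic_subset[OF J] by blast
  have f: "flip w t" if "t \<in> T" "t \<in> ?V" for t
    using len_flip_iff(2)[OF wW that(1)] w(2)[of "w \<star> t"] subgroup.m_closed[OF V w(1) that(2)]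
    by auto
  \<comment> \<open>Both sides are ring homomorphisms to the integers on \<open>Dhat I m ?V\<close>.
    On a generator they evaluate 1 - D_t and 1 - D_(w t w^-1), and both give 1.\<close>
  have e: "counit (ht a) = counit (aw w a)" if "a \<in> Dhat I m ?V" for a
    using that
  proof (induction a rule: Dhat_induct)
    case (Dr t)
    then show ?case using f wW by (simp add: ht_Dr aw_simps Er_def counit_simps counit_Dr)
  next
    case (uminus x)
    then show ?case using wW by (simp add: ht_simps aw_simps counit_simps Dhat_carrier Dhat_mono)
  next
    case (plus x y)
    then show ?case using wW by (simp add: ht_simps aw_simps counit_simps Dhat_carrier Dhat_mono)
  next
    case (mult x y)
    then show ?case using wW by (simp add: ht_simps aw_simps counit_simps Dhat_carrier Dhat_mono)
  qed (use wW in \<open>simp add: ht_simps aw_simps\<close>)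
  note z = K_alg_Zd[OF J parabolic_def x]
  \<comment> \<open>Group elements have counit 1, so commuting \<open>w\<close> past a stable
    \<open>x\<close> shows that \<open>x\<close> and w(x) have equal counit.\<close>
  have "counit (wh w \<bullet> x) = counit (aw w x \<bullet> wh w)" using Zd_conj[OF z(1) wW] by simp
  then have "counit x = counit (aw w x)" using wW Zd_DD[OF z(1)] by (simp add: counit_simps counit_wh)
  then show ?thesis using e[OF z(2)] by simp
qed

lemma K_rank2_iff:
  "x \<in> K_rank2 I m i j \<longleftrightarrow> x \<in> K_alg I m (parabolic I m {i, j}) \<and> x \<in> carrier R \<and> counit x = 0 \<and>
    x \<in> aspan (prods (m i j))"
  by (auto simp: K_rank2_def Ker_counit_def Dhat_deg_le_aspan)

lemma K_rank2_hb:
  assumes "i \<in> I" "j \<in> I" "x \<in> K_rank2 I m i j" shows "hb x \<in> K_rank2 I m i j"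
proof -
  have "parabolic I m {i, j} \<subseteq> carrier W" using parabolic_subset assms by simp
  then have "hb x \<in> K_alg I m (parabolic I m {i, j})"
    by (rule K_alg_image) (use assms hb_Dhat hb_conj in \<open>simp_all add: K_rank2_iff\<close>)
  then show ?thesis using assms by (simp add: K_rank2_iff hb_simps counit_hb deg_hb)
qed

lemma K_rank2_ht:
  assumes "i \<in> I" "j \<in> I" "i \<noteq> j" "x \<in> K_rank2 I m i j" shows "ht x \<in> K_rank2 I m i j"
proof -
  note x = assms(4)[unfolded K_rank2_iff]
  have "parabolic I m {i, j} \<subseteq> carrier W" using parabolic_subset assms by simp
  then have "ht x \<in> K_alg I m (parabolic I m {i, j})"
    by (rule K_alg_image) (use x ht_Dhat ht_conj in simp_all)
  moreover have "counit (ht x) = 0"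
  proof (cases "m i j = 0")
    case True
    have "aspan (prods 0) \<subseteq> {x \<in> carrier R. ht x = x}"
      by (rule aspan_subset) (auto simp: prods_def Dl_def ht_simps)
    then show ?thesis using x True by auto
  next
    case False
    then show ?thesis using counit_ht[OF assms(1-3)] x by simp
  qed
  ultimately show ?thesis using x by (simp add: K_rank2_iff ht_simps deg_ht)
qed

section \<open>The two generating sets, their ideals and the quotients\<close>

abbreviation G_rank2 where "G_rank2 \<equiv> \<Union>i\<in>I. \<Union>j\<in>I - {i}. K_rank2 I m i j"
abbreviation G_full where "G_full \<equiv> K_alg I m (carrier W) \<inter> Ker_counit I m"

lemma G_rank2_Zd: "G_rank2 \<subseteq> Zd"
proof (intro UN_least subsetI)
  fix i j x assume "i \<in> I" "j \<in> I - {i}" "x \<in> K_rank2 I m i j"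
  then show "x \<in> Zd" using K_alg_Zd(1)[of "{i, j}" "parabolic I m {i, j}" x]
    by (simp add: K_rank2_iff parabolic_def)
qed

lemma G_full_Zd: "G_full \<subseteq> Zd"
  using K_alg_Zd(1)[OF order_refl generate_all[symmetric]] by blast

lemma J_rank2_hb: "hb ` J_rank2 I m \<subseteq> J_rank2 I m"
proof -
  have "hb ` G_rank2 \<subseteq> G_rank2"
  proof (rule image_subsetI)
    fix x assume "x \<in> G_rank2"
    then obtain i j where "i \<in> I" "j \<in> I" "i \<noteq> j" "x \<in> K_rank2 I m i j" by blast
    then show "hb x \<in> G_rank2" using K_rank2_hb[of i j x] by blast
  qed
  then have "hb ` G_rank2 \<subseteq> genideal R G_rank2"
    using H.genideal_self[OF G_carrier[OF G_rank2_Zd]] by (rule order_trans)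
  from genideal_image[OF H.ring_axioms G_carrier[OF G_rank2_Zd] this disjI1[OF hb_anti]]
  show ?thesis by (simp only: J_rank2_def)
qed

lemma J_rank2_ht: "ht ` J_rank2 I m \<subseteq> J_rank2 I m"
proof -
  have "ht ` G_rank2 \<subseteq> G_rank2"
  proof (rule image_subsetI)
    fix x assume "x \<in> G_rank2"
    then obtain i j where "i \<in> I" "j \<in> I" "i \<noteq> j" "x \<in> K_rank2 I m i j" by blast
    then show "ht x \<in> G_rank2" using K_rank2_ht[of i j x] by blast
  qed
  then have "ht ` G_rank2 \<subseteq> genideal R G_rank2"
    using H.genideal_self[OF G_carrier[OF G_rank2_Zd]] by (rule order_trans)
  from genideal_image[OF H.ring_axioms G_carrier[OF G_rank2_Zd] this disjI2[OF ht_inv]]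
  show ?thesis by (simp only: J_rank2_def)
qed

lemma J_full_hb: "hb ` J_full I m \<subseteq> J_full I m"
proof -
  have "hb x \<in> G_full" if "x \<in> G_full" for x
    using that K_alg_image[OF order_refl, of x hb] hb_Dhat hb_conj counit_hb
    by (simp add: Ker_counit_def hb_simps)
  then have "hb ` G_full \<subseteq> G_full" by blast
  then have "hb ` G_full \<subseteq> genideal R G_full"
    using H.genideal_self[OF G_carrier[OF G_full_Zd]] by (rule order_trans)
  from genideal_image[OF H.ring_axioms G_carrier[OF G_full_Zd] this disjI1[OF hb_anti]]
  show ?thesis by (simp only: J_full_def)
qed

lemma ideal_J_rank2: "ideal (J_rank2 I m) R" and ideal_J_full: "ideal (J_full I m) R"
  unfolding J_rank2_def J_full_def
  by (rule H.genideal_ideal[OF G_carrier[OF G_rank2_Zd]], rule H.genideal_ideal[OF G_carrier[OF G_full_Zd]])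

lemma anti_involution_quotient:
  assumes "ideal J R" "hb ` J \<subseteq> J"
  shows "\<exists>f. anti_involution (R Quot J) f \<and>
    (\<forall>i\<in>I. f (J +>\<^bsub>R\<^esub> sh i) = J +>\<^bsub>R\<^esub> sh i \<and> f (J +>\<^bsub>R\<^esub> dh i) = J +>\<^bsub>R\<^esub> dh i)"
  using quot_anti_involution[OF assms(1) hb_anti assms(2)] by (intro exI[of _ "(`) hb"]) (simp add: hb_simps)

lemma involution_H_alg:
  "\<exists>\<theta>. ring_involution (H_alg I m) \<theta> \<and>
    (\<forall>i\<in>I. \<theta> (proj_H I m (sh i)) = \<ominus>\<^bsub>H_alg I m\<^esub> proj_H I m (sh i) \<and>
      \<theta> (proj_H I m (dh i)) = \<one>\<^bsub>H_alg I m\<^esub> \<ominus>\<^bsub>H_alg I m\<^esub> proj_H I m (dh i))"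
proof -
  interpret J: ideal "J_rank2 I m" R by (rule ideal_J_rank2)
  show ?thesis
    using quot_ring_involution[OF ideal_J_rank2 ht_inv J_rank2_ht]
    unfolding H_alg_def proj_H_def
    by (intro exI[of _ "(`) ht"]) (simp add: ht_simps J.quot_ops)
qed

lemma D_alg_symmetries:
  assumes "(A, D) = (D_alg I m, \<lambda>s. proj_H I m (D_refl I m s)) \<or>
    (A, D) = (D_low I m, \<lambda>s. proj_low I m (D_refl I m s))"
  shows "\<exists>act. group_action W (carrier A) act \<and>
      (\<forall>w\<in>carrier W. act w \<in> ring_iso A A) \<and>
      (\<forall>i\<in>I. \<forall>s\<in>T. act (gen i) (D s) =
         (if s = gen i then \<one>\<^bsub>A\<^esub> \<ominus>\<^bsub>A\<^esub> D (gen i) else D (gen i \<star> s \<star> gen i))) \<and>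
      (\<forall>s\<in>T. \<exists>d. twisted_derivation A (act s) d \<and>
         (\<forall>s'\<in>T. d (D s') = (if s = s' then \<one>\<^bsub>A\<^esub> else \<zero>\<^bsub>A\<^esub>)))"
proof -
  obtain G where G: "G \<subseteq> Zd" "A = (R Quot genideal R G)\<lparr>carrier := (\<lambda>x. genideal R G +>\<^bsub>R\<^esub> x) ` DD\<rparr>"
    and D: "\<And>s. s \<in> T \<Longrightarrow> D s = genideal R G +>\<^bsub>R\<^esub> Dr s"
    using assms
  proof
    assume "(A, D) = (D_alg I m, \<lambda>s. proj_H I m (D_refl I m s))"
    then show thesis using that[OF G_rank2_Zd]
      by (simp add: D_alg_def H_alg_def proj_H_def J_rank2_def D_refl_eq image_def)
  next
    assume "(A, D) = (D_low I m, \<lambda>s. proj_low I m (D_refl I m s))"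
    then show thesis using that[OF G_full_Zd]
      by (simp add: D_low_def H_low_def proj_low_def J_full_def D_refl_eq image_def)
  qed
  have T: "gen i \<star> s \<star> gen i \<in> T" if "i \<in> I" "s \<in> T" for i s
    using that conj_refl[of "gen i" s] by (simp add: conj_gen)
  show ?thesis using Dquot_symmetries[OF G(1)] unfolding G(2)[symmetric] by (simp add: D T cong: if_cong)
qed

end

theorem theorem1p37:
  fixes I :: "'i set" and m :: "'i \<Rightarrow> 'i \<Rightarrow> nat"
  assumes "coxeter_matrix I m"
  shows
    "(\<exists>bar. anti_involution (H_alg I m) bar \<and>
        (\<forall>i\<in>I. bar (proj_H I m (s_hat I m i)) = proj_H I m (s_hat I m i) \<and>
               bar (proj_H I m (D_hat I m i)) = proj_H I m (D_hat I m i)))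
   \<and> (\<exists>bar. anti_involution (H_low I m) bar \<and>
        (\<forall>i\<in>I. bar (proj_low I m (s_hat I m i)) = proj_low I m (s_hat I m i) \<and>
               bar (proj_low I m (D_hat I m i)) = proj_low I m (D_hat I m i)))
   \<and> (\<forall>(A, D) \<in> {(D_alg I m, \<lambda>s. proj_H I m (D_refl I m s)),
                   (D_low I m, \<lambda>s. proj_low I m (D_refl I m s))}.
        \<exists>act. group_action (coxeter_group I m) (carrier A) act \<and>
          (\<forall>w\<in>carrier (coxeter_group I m). act w \<in> ring_iso A A) \<and>
          (\<forall>i\<in>I. \<forall>s\<in>reflections I m. act (cox_gen I m i) (D s) =
             (if s = cox_gen I m i then \<one>\<^bsub>A\<^esub> \<ominus>\<^bsub>A\<^esub> D (cox_gen I m i)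
              else D (cox_gen I m i \<otimes>\<^bsub>coxeter_group I m\<^esub> s \<otimes>\<^bsub>coxeter_group I m\<^esub> cox_gen I m i))) \<and>
          (\<forall>s\<in>reflections I m. \<exists>d. twisted_derivation A (act s) d \<and>
             (\<forall>s'\<in>reflections I m. d (D s') = (if s = s' then \<one>\<^bsub>A\<^esub> else \<zero>\<^bsub>A\<^esub>))))
   \<and> (\<exists>\<theta>. ring_involution (H_alg I m) \<theta> \<and>
        (\<forall>i\<in>I. \<theta> (proj_H I m (s_hat I m i)) = \<ominus>\<^bsub>H_alg I m\<^esub> proj_H I m (s_hat I m i) \<and>
               \<theta> (proj_H I m (D_hat I m i))
                 = \<one>\<^bsub>H_alg I m\<^esub> \<ominus>\<^bsub>H_alg I m\<^esub> proj_H I m (D_hat I m i)))"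
proof -
  interpret coxeter I m by standard (rule assms)
  note anti = anti_involution_quotient[OF ideal_J_rank2 J_rank2_hb, folded H_alg_def proj_H_def]
    anti_involution_quotient[OF ideal_J_full J_full_hb, folded H_low_def proj_low_def]
  show ?thesis
    by (intro conjI ballI case_prodI2) (rule anti involution_H_alg | (rule D_alg_symmetries, simp))+
qed

end
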